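(* For all $m\ge 4$ and $1\le k\le m-2$, the wide melting lollipop graph $WL_{m,1}^{(k)}$, which is the labelled unit interval graph on $m+1$ vertices given by the sequence $(w_i)_{i=1}^{m+1}$ with $w_i=1$ for $1\le i\le m-1$, $w_m=k+1$, and $w_{m+1}=m-1$, and its reverse graph $(WL_{m,1}^{(k)})^r$, are both appendable $(e)$-positive.
   Context: All graphs are finite and simple with nonempty vertex set. A labelled graph on $d$ vertices is a graph with vertex set $[d]=\{1,\dots,d\}$. A labelled unit interval graph is a labelled graph $G$ such that whenever $i\le v<w\le j$ and $ij\in E(G)$, also $vw\in E(G)$; it is determined by the weakly increasing sequence $(w_i)$, where $w_i\le i$ is the smallest label in the closed neighbourhood of $i$ (so for $j<i$, $ji$ is an edge iff $j\ge w_i$). The reverse graph $G^r$ of a labelled graph $G$ on $d$ vertices is obtained by relabelling each vertex $i$ as $d+1-i$. For a set partition $\pi$ of $[d]$, let $B_{\pi,i}$ be the block containing $i$, and let $e_\pi=\sum x_{i_1}\cdots x_{i_d}$ in noncommuting variables $x_1,x_2,\dots$, summed over all tuples $(i_1,\dots,i_d)$ of positive integers with $i_j\ne i_k$ whenever $j\neq k$ and $B_{\pi,j}=B_{\pi,k}$. The $e_\pi$, over set partitions $\pi$ of $[d]$, form a $\mathbb Q$-basis of $\mathrm{NCSym}^d$, the degree-$d$ part of the algebra of symmetric functions in noncommuting variables. For $d\ge 1$ let $\mathrm{type}(\pi)=(\lambda,b)$, where $b=|B_{\pi,d}|$ and $\lambda$ is the integer partition (possibly empty) formed by the sizes of the other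 blocks. $\mathrm{UBCSym}^d$ is the $\mathbb Q$-vector space with basis $\{e_{(\lambda,b)}\}$ over pairs of a partition $\lambda$ and an integer $b\ge 1$ with $|\lambda|+b=d$, and $\nu:\mathrm{NCSym}^d\to\mathrm{UBCSym}^d$ is the linear map with $\nu(e_\pi)=e_{\mathrm{type}(\pi)}$. For a labelled graph $G$ on $d$ vertices, $Y_G=\sum_\kappa x_{\kappa(1)}\cdots x_{\kappa(d)}\in\mathrm{NCSym}^d$, summed over all proper colourings $\kappa:[d]\to\mathbb Z_{>0}$ of $G$, and $y_G=\nu(Y_G)$. $G$ is $(e)$-positive if all coefficients of $y_G$ in the basis $\{e_{(\lambda,b)}\}$ are nonnegative. For labelled graphs $G$ on $n$ vertices and $H$ on $m$ vertices, the concatenation $G+H$ is the labelled graph on $[n+m-1]$ obtained by placing $G$ on labels $1,\dots,n$ and $H$ on labels $n,\dots,n+m-1$ (vertex $i$ of $H$ becoming $n-1+i$), so vertex $n$ of $G$ is identified with vertex $1$ of $H$. A labelled graph $H$ is appendable $(e)$-positive if $G+H$ is $(e)$-positive for every $(e)$-positive labelled graph $G$. *)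

theory Defs
  imports
    Complex_Main
    "HOL-Library.Disjoint_Sets"
    "HOL-Library.FuncSet"
    "HOL-Library.Function_Algebras"
    "HOL-Library.Multiset"
    "HOL-Library.Poly_Mapping"
begin

section \<open>Labelled graphs\<close>

text \<open>A labelled graph on \<open>d\<close> vertices is given by \<open>d\<close> together with its set of edges, each edge
  being a two-element subset of \<open>{1..d}\<close>.\<close>

definition labelled_graph :: "nat \<Rightarrow> nat set set \<Rightarrow> bool" where
  "labelled_graph d G \<longleftrightarrow>
     1 \<le> d \<and> G \<subseteq> {{u, v} | u v. u \<in> {1..d} \<and> v \<in> {1..d} \<and> u \<noteq> v}"

definition unit_interval_graph :: "nat \<Rightarrow> nat set set \<Rightarrow> bool" where
  "unit_interval_graph d G \<longleftrightarrow> labelled_graph d G \<and>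
     (\<forall>i v w j. i \<le> v \<and> v < w \<and> w \<le> j \<and> {i, j} \<in> G \<longrightarrow> {v, w} \<in> G)"

definition smallest_closed_nbr :: "nat set set \<Rightarrow> nat \<Rightarrow> nat" where
  "smallest_closed_nbr G i = Min {j. j = i \<or> {j, i} \<in> G}"

definition graph_of_seq :: "nat \<Rightarrow> (nat \<Rightarrow> nat) \<Rightarrow> nat set set" where
  "graph_of_seq d w = {{j, i} | j i. 1 \<le> j \<and> j < i \<and> i \<le> d \<and> w i \<le> j}"

definition reverse_graph :: "nat \<Rightarrow> nat set set \<Rightarrow> nat set set" where
  "reverse_graph d G = (\<lambda>e. (\<lambda>i. d + 1 - i) ` e) ` G"

text \<open>Concatenation of a graph \<open>G\<close> on \<open>n\<close> vertices with a graph \<open>H\<close> on \<open>m\<close> vertices; the result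
  is a graph on \<open>n + m - 1\<close> vertices.\<close>

definition concatenation :: "nat \<Rightarrow> nat set set \<Rightarrow> nat set set \<Rightarrow> nat set set" where
  "concatenation n G H = G \<union> (\<lambda>e. (\<lambda>i. n - 1 + i) ` e) ` H"

section \<open>Symmetric functions in noncommuting variables\<close>

text \<open>A formal power series over the rationals in noncommuting variables \<open>x\<^sub>1, x\<^sub>2, \<dots>\<close> is the
  function assigning to each word its coefficient; the monomial \<open>x\<^bsub>i\<^sub>1\<^esub> \<cdots> x\<^bsub>i\<^sub>d\<^esub>\<close> is the word
  \<open>[i\<^sub>1, \<dots>, i\<^sub>d]\<close>. Addition is the pointwise one.\<close>

type_synonym nc_series = "nat list \<Rightarrow> rat"

definition nc_scale :: "rat \<Rightarrow> nc_series \<Rightarrow> nc_series" where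
  "nc_scale c F = (\<lambda>w. c * F w)"

global_interpretation nc: vector_space nc_scale
  by unfold_locales (auto simp: nc_scale_def fun_eq_iff algebra_simps)

text \<open>For a set \<open>T\<close> of \<open>d\<close>-tuples, regarded as functions on \<open>{1..d}\<close>, the sum of
  \<open>x\<^bsub>t 1\<^esub> \<cdots> x\<^bsub>t d\<^esub>\<close> over all \<open>t\<close> in \<open>T\<close>. For the two sets \<open>T\<close> used below, each word comes from at
  most one tuple, so \<open>card\<close> is never applied to an infinite set.\<close>

definition nc_sum :: "nat \<Rightarrow> (nat \<Rightarrow> nat) set \<Rightarrow> nc_series" where
  "nc_sum d T = (\<lambda>w. of_nat (card {t \<in> T. map t [1..<d + 1] = w}))"

definition block :: "nat set set \<Rightarrow> nat \<Rightarrow> nat set" where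
  "block \<pi> i = (THE B. B \<in> \<pi> \<and> i \<in> B)"

definition nc_e :: "nat \<Rightarrow> nat set set \<Rightarrow> nc_series" where
  "nc_e d \<pi> = nc_sum d {t \<in> {1..d} \<rightarrow>\<^sub>E {1..}.
     \<forall>j\<in>{1..d}. \<forall>k\<in>{1..d}. j \<noteq> k \<and> block \<pi> j = block \<pi> k \<longrightarrow> t j \<noteq> t k}"

definition proper_colouring :: "nat \<Rightarrow> nat set set \<Rightarrow> (nat \<Rightarrow> nat) \<Rightarrow> bool" where
  "proper_colouring d G \<kappa> \<longleftrightarrow>
     \<kappa> \<in> {1..d} \<rightarrow>\<^sub>E {1..} \<and> (\<forall>u v. {u, v} \<in> G \<longrightarrow> \<kappa> u \<noteq> \<kappa> v)"

definition Y_nc :: "nat \<Rightarrow> nat set set \<Rightarrow> nc_series" where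
  "Y_nc d G = nc_sum d {\<kappa>. proper_colouring d G \<kappa>}"

section \<open>The quotient space and positivity\<close>

text \<open>\<open>UBCSym\<^sup>d\<close> consists of the finitely supported functions on the pairs in \<open>ubc_index d\<close>, where an
  integer partition is the multiset of its parts; \<open>e\<^bsub>(\<lambda>,b)\<^esub>\<close> is \<open>Poly_Mapping.single (\<lambda>, b) 1\<close>.\<close>

type_synonym ubc = "(nat multiset \<times> nat) \<Rightarrow>\<^sub>0 rat"

definition ubc_index :: "nat \<Rightarrow> (nat multiset \<times> nat) set" where
  "ubc_index d = {(l, b). 0 \<notin># l \<and> 1 \<le> b \<and> sum_mset l + b = d}"

definition partition_type :: "nat \<Rightarrow> nat set set \<Rightarrow> nat multiset \<times> nat" where
  "partition_type d \<pi> =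
     (image_mset card (mset_set (\<pi> - {block \<pi> d})), card (block \<pi> d))"

text \<open>The linear map \<open>\<nu>\<close> with \<open>\<nu>(e\<^sub>\<pi>) = e\<^bsub>type(\<pi>)\<^esub>\<close>: the number
  \<open>nc.representation (nc_e d ` {\<pi>. partition_on {1..d} \<pi>}) F (nc_e d \<pi>)\<close> is the coefficient of
  \<open>e\<^sub>\<pi>\<close> in the expansion of \<open>F\<close> in the basis of all \<open>e\<^sub>\<pi>\<close> of \<open>NCSym\<^sup>d\<close>. Only the values at elements
  of \<open>NCSym\<^sup>d\<close>, the span of the \<open>e\<^sub>\<pi>\<close>, are meaningful.\<close>

definition nu :: "nat \<Rightarrow> nc_series \<Rightarrow> ubc" where
  "nu d F = (\<Sum>\<pi> | partition_on {1..d} \<pi>.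
     Poly_Mapping.single (partition_type d \<pi>)
       (nc.representation (nc_e d ` {\<pi>. partition_on {1..d} \<pi>}) F (nc_e d \<pi>)))"

definition y_ubc :: "nat \<Rightarrow> nat set set \<Rightarrow> ubc" where
  "y_ubc d G = nu d (Y_nc d G)"

definition e_positive :: "nat \<Rightarrow> nat set set \<Rightarrow> bool" where
  "e_positive d G \<longleftrightarrow> (\<forall>p \<in> ubc_index d. 0 \<le> Poly_Mapping.lookup (y_ubc d G) p)"

definition appendable_e_positive :: "nat \<Rightarrow> nat set set \<Rightarrow> bool" where
  "appendable_e_positive m H \<longleftrightarrow> labelled_graph m H \<and>
     (\<forall>n G. labelled_graph n G \<and> e_positive n G \<longrightarrow>
        e_positive (n + m - 1) (concatenation n G H))"

section \<open>Wide melting lollipop graphs\<close>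

definition WL_seq :: "nat \<Rightarrow> nat \<Rightarrow> nat \<Rightarrow> nat" where
  "WL_seq m k i = (if i \<le> m - 1 then 1 else if i = m then k + 1 else m - 1)"

text \<open>\<open>WL m k\<close> is \<open>WL\<^bsub>m,1\<^esub>\<^bsup>(k)\<^esup>\<close>, a graph on \<open>m + 1\<close> vertices.\<close>

definition WL :: "nat \<Rightarrow> nat \<Rightarrow> nat set set" where
  "WL m k = graph_of_seq (m + 1) (WL_seq m k)"

lemma edge_graph_of_seq_iff:
  "{a, b} \<in> graph_of_seq d w \<longleftrightarrow>
     (1 \<le> a \<and> a < b \<and> b \<le> d \<and> w b \<le> a) \<or> (1 \<le> b \<and> b < a \<and> a \<le> d \<and> w a \<le> b)"
  unfolding graph_of_seq_def by (auto simp: doubleton_eq_iff)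

lemma unit_interval_graph_of_seq:
  assumes "1 \<le> d" and "mono_on {1..d} w"
  shows "unit_interval_graph d (graph_of_seq d w)"
proof -
  have "labelled_graph d (graph_of_seq d w)"
    using assms(1) unfolding labelled_graph_def graph_of_seq_def by fastforce
  moreover have "{v, x} \<in> graph_of_seq d w"
    if "i \<le> v" "v < x" "x \<le> j" "{i, j} \<in> graph_of_seq d w" for i v x j
  proof -
    have "1 \<le> i" "j \<le> d" "w j \<le> i"
      using that by (auto simp: edge_graph_of_seq_iff)
    moreover from this have "w x \<le> w j"
      using that assms(2) by (intro mono_onD[of "{1..d}" w]) auto
    ultimately show ?thesis
      using that by (auto simp: edge_graph_of_seq_iff)
  qed
  ultimately show ?thesis
    unfolding unit_interval_graph_def by blast
qed

lemma smallest_closed_nbr_graph_of_seq: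
  assumes "mono_on {1..d} w" and "i \<in> {1..d}" and "1 \<le> w i" and "w i \<le> i"
    and "\<And>j. j \<in> {1..d} \<Longrightarrow> w j \<le> j"
  shows "smallest_closed_nbr (graph_of_seq d w) i = w i"
  unfolding smallest_closed_nbr_def
proof (rule Min_eqI)
  have "{j. j = i \<or> {j, i} \<in> graph_of_seq d w} \<subseteq> {..d}"
    using assms(2) by (auto simp: edge_graph_of_seq_iff)
  then show "finite {j. j = i \<or> {j, i} \<in> graph_of_seq d w}"
    using finite_subset by blast
next
  fix j assume "j \<in> {j. j = i \<or> {j, i} \<in> graph_of_seq d w}"
  then show "w i \<le> j"
    using assms by (auto simp: edge_graph_of_seq_iff)
next
  show "w i \<in> {j. j = i \<or> {j, i} \<in> graph_of_seq d w}"
    using assms by (auto simp: edge_graph_of_seq_iff)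
qed

lemma WL_unit_interval_graph:
  assumes "4 \<le> m" and "1 \<le> k" and "k \<le> m - 2"
  shows "unit_interval_graph (m + 1) (WL m k)"
    and "i \<in> {1..m + 1} \<Longrightarrow> smallest_closed_nbr (WL m k) i = WL_seq m k i"
proof -
  have mono: "mono_on {1..m + 1} (WL_seq m k)"
    using assms by (intro mono_onI) (auto simp: WL_seq_def)
  then show "unit_interval_graph (m + 1) (WL m k)"
    unfolding WL_def by (intro unit_interval_graph_of_seq) auto
  show "smallest_closed_nbr (WL m k) i = WL_seq m k i" if "i \<in> {1..m + 1}"
    unfolding WL_def using mono that assms
    by (intro smallest_closed_nbr_graph_of_seq) (auto simp: WL_seq_def)
qed

end

theory Submission
  imports Defs
begin

text \<open>Letting all variables but the last commute, the class of a chromatic function in \<open>UBCSym\<close> becomes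
  a symmetric function in \<open>x\<close> with one marked colour \<open>z\<close>: the sum over the colourings that give the
  last vertex the colour \<open>z\<close>. The basis element indexed by \<open>(\<lambda>, b)\<close> becomes, up to a positive factor,
  \<open>e\<^sub>\<lambda> E\<^bsub>b-1\<^esub>\<close>, where \<open>E\<^sub>j\<close> is the elementary symmetric polynomial \<open>e\<^sub>j\<close> in the variables other than
  \<open>x\<^sub>z\<close>. Appending a graph is an operator that is linear over the symmetric functions, hence it has to be
  computed only on the \<open>E\<^sub>i\<close>, that is, on cliques.

  For the wide melting lollipops the operator is affine in \<open>k\<close>, which leaves the two extreme cases. For
  \<open>k = m - 2\<close> the graph is a clique followed by a triangle. For \<open>k = 1\<close> the image of \<open>E\<^sub>i\<close> is a
  combination of sums \<open>\<Sum>\<^sub>c x\<^sub>c e\<^sub>i(x - x\<^sub>c) e\<^sub>j(x - x\<^sub>c - x\<^sub>z)\<close> and products \<open>E\<^sub>p E\<^sub>q\<close>, which telescope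
  to explicit combinations of the \<open>e\<^sub>r E\<^sub>s\<close>; the coefficients of the total turn out to be nonnegative.
  Reversing the graph transposes the kernel of the operator.\<close>

section \<open>Elementary symmetric polynomials\<close>

text \<open>The coefficients of \<open>nu\<close> are given by \<open>nc.representation\<close> and
  have to be recovered from evaluations. This works because \<open>nu\<close> does not change when
  all positions but the last are permuted, and because the evaluations determine the sum over these
  permutations: when x_c counts the positions in a set S that carry the colour c, the evaluation
  becomes a sum over maps into S, and inclusion-exclusion over S isolates the bijections. So any
  series with the same evaluations as Y_G and with visibly nonnegative coefficients certifies
  (e)-positivity, and every identity may be checked for finite alphabets and rational values. The
  dependence on k is affine because an injective colouring of the interior clique vertices uses the
  colour of vertex m at most once, and the interior positions are interchangeable: each further edge
  at m removes the same weighted sum of colourings. Negative signs enter when the marked variable is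
  eliminated by x_z E_j = e_(j+1) - E_(j+1). The products E_p E_q also expand with both signs, so
  the single terms of the melting case are not positive; only their total is.\<close>

definition es :: "'a set \<Rightarrow> ('a \<Rightarrow> 'b::comm_ring_1) \<Rightarrow> nat \<Rightarrow> 'b" where
  "es V x j = (\<Sum>S | S \<subseteq> V \<and> card S = j. \<Prod>s\<in>S. x s)"

text \<open>Finiteness of \<open>V\<close> excludes infinite subsets, whose \<open>card\<close>
  would also be 0.\<close>

lemma es_0 [simp]: "finite V \<Longrightarrow> es V x 0 = 1"
proof -
  assume "finite V"
  then have "{S. S \<subseteq> V \<and> card S = 0} = {{}}"
    by (auto dest: finite_subset)
  then show ?thesis by (simp add: es_def)
qed

lemma es_empty [simp]: "es ({}::'a set) x (Suc j) = 0"
proof -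
  have "{S::'a set. S \<subseteq> {} \<and> card S = Suc j} = {}" by auto
  then show ?thesis by (simp only: es_def sum.empty)
qed

lemma es_insert:
  assumes "finite V" "c \<notin> V"
  shows "es (insert c V) x (Suc j) = es V x (Suc j) + x c * es V x j"
proof -
  have eq: "{S. S \<subseteq> insert c V \<and> card S = Suc j} =
      {S. S \<subseteq> V \<and> card S = Suc j} \<union> insert c ` {S. S \<subseteq> V \<and> card S = j}"
  proof (intro equalityI subsetI)
    fix S assume S: "S \<in> {S. S \<subseteq> insert c V \<and> card S = Suc j}"
    show "S \<in> {S. S \<subseteq> V \<and> card S = Suc j} \<union> insert c ` {S. S \<subseteq> V \<and> card S = j}"
    proof (cases "c \<in> S")
      case True
      moreover have "finite S" using S assms(1) finite_subset by blast
      ultimately have "S = insert c (S - {c})" "S - {c} \<subseteq> V" "card (S - {c}) = j"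
        using S by auto
      then show ?thesis by blast
    qed (use S in auto)
  next
    fix S assume "S \<in> {S. S \<subseteq> V \<and> card S = Suc j} \<union> insert c ` {S. S \<subseteq> V \<and> card S = j}"
    then show "S \<in> {S. S \<subseteq> insert c V \<and> card S = Suc j}"
      using assms by (auto dest: finite_subset intro!: card_insert_disjoint)
  qed
  have inj: "inj_on (insert c) {S. S \<subseteq> V \<and> card S = j}"
    using assms by (intro inj_onI) (metis (no_types, lifting) insert_ident mem_Collect_eq subset_iff)
  have "(\<Sum>S\<in>insert c ` {S. S \<subseteq> V \<and> card S = j}. \<Prod>s\<in>S. x s) =
      (\<Sum>S | S \<subseteq> V \<and> card S = j. x c * (\<Prod>s\<in>S. x s))"
    unfolding sum.reindex[OF inj] o_def
    using assms by (intro sum.cong refl prod.insert) (auto dest: finite_subset)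
  then show ?thesis
    unfolding es_def eq using assms
    by (subst sum.union_disjoint) (auto simp: sum_distrib_left)
qed

lemma es_remove:
  assumes "finite V" "c \<in> V"
  shows "es V x (Suc j) = es (V - {c}) x (Suc j) + x c * es (V - {c}) x j"
  using es_insert[of "V - {c}" c x j] assms by (simp add: insert_absorb)

text \<open>Each squarefree monomial of degree \<open>Suc j\<close> arises once for each of its
  variables, as the choice of \<open>c\<close>.\<close>

lemma sum_es_remove:
  assumes "finite V"
  shows "(\<Sum>c\<in>V. x c * es (V - {c}) x j) = of_nat (Suc j) * es V x (Suc j)"
  using assms
proof (induction V arbitrary: j)
  case (insert v W)
  have rem: "insert v W - {c} = insert v (W - {c})" "insert v W - {v} = W" if "c \<in> W" for c
    using insert.hyps that by auto
  have *: "(\<Sum>c\<in>W. x c * es (insert v W - {c}) x j) =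
      of_nat (Suc j) * es W x (Suc j) + of_nat j * x v * es W x j"
  proof (cases j)
    case 0
    have "es (insert v W - {c}) x j = es (W - {c}) x j" for c
      using insert.hyps 0 by simp
    then show ?thesis using insert.IH[of j] 0 by simp
  next
    case (Suc i)
    have "(\<Sum>c\<in>W. x c * es (insert v W - {c}) x j) =
        (\<Sum>c\<in>W. x c * es (W - {c}) x j + x v * (x c * es (W - {c}) x i))"
      using insert.hyps by (intro sum.cong refl) (simp add: rem Suc es_insert algebra_simps)
    also have "\<dots> = of_nat (Suc j) * es W x (Suc j) + x v * (of_nat j * es W x j)"
      unfolding sum.distrib sum_distrib_left[symmetric] insert.IH Suc ..
    finally show ?thesis by (simp add: algebra_simps)
  qed
  have "insert v W - {v} = W" using insert.hyps by auto
  then show ?case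
    using insert.hyps * by (simp add: es_insert algebra_simps)
qed simp

section \<open>Weighted sums over one colour of products of two elementary symmetric
  polynomials\<close>

definition es_pair :: "'a set \<Rightarrow> ('a \<Rightarrow> 'b::comm_ring_1) \<Rightarrow> nat \<Rightarrow> nat \<Rightarrow> 'b" where
  "es_pair V x i j = (\<Sum>c\<in>V. x c * es (V - {c}) x i * es (V - {c}) x j)"

lemma es_pair_0:
  assumes "finite V"
  shows "es_pair V x i 0 = of_nat (Suc i) * es V x (Suc i)"
  unfolding es_pair_def using assms by (simp add: sum_es_remove del: of_nat_Suc)

text \<open>Removing \<open>c\<close> from one factor of (p+1) e_(p+1) e_(q+1) leaves
  \<open>es_pair V x p (Suc q)\<close> plus the sum \<open>C p q\<close> with squared variables. As
  \<open>C\<close> is symmetric, comparing the two orders of the indices eliminates it.\<close>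

lemma es_pair_Suc:
  assumes "finite V"
  shows "es_pair V x i (Suc j) =
    es_pair V x (Suc i) j + (of_nat i - of_nat j) * es V x (Suc i) * es V x (Suc j)"
proof -
  define C where "C p q = (\<Sum>c\<in>V. x c * x c * es (V - {c}) x p * es (V - {c}) x q)" for p q
  have *: "of_nat (Suc p) * es V x (Suc p) * es V x (Suc q) = es_pair V x p (Suc q) + C p q" for p q
  proof -
    have "of_nat (Suc p) * es V x (Suc p) * es V x (Suc q) =
        (\<Sum>c\<in>V. x c * es (V - {c}) x p * es V x (Suc q))"
      by (simp add: sum_es_remove[OF assms] flip: sum_distrib_right)
    also have "\<dots> = (\<Sum>c\<in>V. x c * es (V - {c}) x p * es (V - {c}) x (Suc q) +
        x c * x c * es (V - {c}) x p * es (V - {c}) x q)"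
    proof (intro sum.cong refl)
      fix c assume "c \<in> V"
      then show "x c * es (V - {c}) x p * es V x (Suc q) =
          x c * es (V - {c}) x p * es (V - {c}) x (Suc q) + x c * x c * es (V - {c}) x p * es (V - {c}) x q"
        unfolding es_remove[OF assms \<open>c \<in> V\<close>, of x q] by (simp add: algebra_simps)
    qed
    finally show ?thesis by (simp add: es_pair_def C_def sum.distrib)
  qed
  have sym: "C i j = C j i" "es_pair V x j (Suc i) = es_pair V x (Suc i) j"
    by (simp_all add: C_def es_pair_def mult_ac)
  have "es_pair V x i (Suc j) = of_nat (Suc i) * es V x (Suc i) * es V x (Suc j) - C j i"
    using *[of i j] sym by simp
  also have "C j i = of_nat (Suc j) * es V x (Suc j) * es V x (Suc i) - es_pair V x (Suc i) j"
    using *[of j i] sym by simp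
  finally show ?thesis by (simp add: algebra_simps)
qed

lemma sum_of_bool_eq:
  fixes f :: "nat \<Rightarrow> 'b::comm_ring_1"
  assumes "k \<le> N"
  shows "(\<Sum>r\<le>N. of_bool (r = k) * f r) = f k"
proof -
  have "(\<Sum>r\<le>N. of_bool (r = k) * f r) = (\<Sum>r\<le>N. if r = k then f r else 0)"
    by (intro sum.cong) auto
  then show ?thesis using assms by simp
qed

text \<open>Both e_(p+1) E_q - E_(p+1) E_q and e_(q+1) E_p - E_(q+1) E_p equal x_z E_p E_q. This
  exchange moves degree from the second factor to the first at the price of two terms e_r E_s;
  iterated, it ends at E_(p+q) E_0.\<close>

lemma es_pointed_mult:
  fixes x :: "'a \<Rightarrow> 'b::comm_ring_1"
  assumes "finite V" "z \<in> V"
  shows "es (V - {z}) x p * es (V - {z}) x q =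
    (\<Sum>r\<le>p + q. (of_bool (r \<le> q) - of_bool (p < r)) * (es V x r * es (V - {z}) x (p + q - r)))"
proof (induction q arbitrary: p)
  case 0
  have "(of_bool (r \<le> 0) - of_bool (p < r)) * (es V x r * es (V - {z}) x (p - r)) =
      (if r = 0 then es (V - {z}) x p else 0)" if "r \<le> p" for r
    using that assms by auto
  then have "(\<Sum>r\<le>p. (of_bool (r \<le> 0) - of_bool (p < r)) * (es V x r * es (V - {z}) x (p - r))) =
      (\<Sum>r\<le>p. if r = 0 then es (V - {z}) x p else 0)"
    by (intro sum.cong) auto
  then show ?case using assms by simp
next
  case (Suc q)
  let ?e = "es V x" and ?E = "es (V - {z}) x"
  have "?E p * ?E (Suc q) = ?E (Suc p) * ?E q + ?e (Suc q) * ?E p - ?e (Suc p) * ?E q"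
    using es_remove[OF assms, of x p] es_remove[OF assms, of x q] by (simp add: algebra_simps)
  also have "\<dots> = (\<Sum>r\<le>p + Suc q. (of_bool (r \<le> q) - of_bool (Suc p < r)) * (?e r * ?E (p + Suc q - r)))
      + (\<Sum>r\<le>p + Suc q. of_bool (r = Suc q) * (?e r * ?E (p + Suc q - r)))
      - (\<Sum>r\<le>p + Suc q. of_bool (r = Suc p) * (?e r * ?E (p + Suc q - r)))"
    using Suc[of "Suc p"] by (subst (1 2) sum_of_bool_eq) simp_all
  also have "\<dots> = (\<Sum>r\<le>p + Suc q. (of_bool (r \<le> Suc q) - of_bool (p < r)) * (?e r * ?E (p + Suc q - r)))"
    unfolding sum.distrib[symmetric] sum_subtractf[symmetric]
    by (intro sum.cong refl) (auto simp: algebra_simps)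
  finally show ?case .
qed

text \<open>The coefficients for appending a clique on \<open>j + 2\<close> vertices to one on \<open>i + 1\<close>: the two ranges
  overlap when \<open>i < j\<close>, and then cancel.\<close>

definition clique_coeff :: "nat \<Rightarrow> nat \<Rightarrow> nat \<Rightarrow> 'b::comm_ring_1" where
  "clique_coeff i j r =
     of_bool (r \<le> j) * (of_nat j + 1 - of_nat r) + of_bool (i < r) * (of_nat r - 1 - of_nat j)"

lemma clique_coeff_nonneg: "0 \<le> (clique_coeff i j r :: rat)"
proof -
  have "r \<le> j \<Longrightarrow> (of_nat r :: rat) \<le> of_nat j" "j < r \<Longrightarrow> (of_nat j + 1 :: rat) \<le> of_nat r"
    by (simp_all flip: of_nat_Suc add: of_nat_le_iff del: of_nat_Suc)
  then show ?thesis by (cases "r \<le> j") (auto simp: clique_coeff_def of_bool_def not_le)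
qed

definition es_clique :: "'a set \<Rightarrow> ('a \<Rightarrow> 'b::comm_ring_1) \<Rightarrow> 'a \<Rightarrow> nat \<Rightarrow> nat \<Rightarrow> 'b" where
  "es_clique V x z i j = (\<Sum>c\<in>V - {z}. x c * es (V - {c}) x i * es (V - {z} - {c}) x j)"

lemma es_clique_0:
  assumes "finite V" "z \<in> V"
  shows "es_clique V x z 0 j = es_pair (V - {z}) x 0 j"
  using assms by (simp add: es_clique_def es_pair_def)

lemma es_clique_Suc:
  assumes "finite V" "z \<in> V"
  shows "es_clique V x z (Suc i) j = es_pair (V - {z}) x (Suc i) j + x z * es_pair (V - {z}) x i j"
proof -
  have "es (V - {c}) x (Suc i) = es (V - {z} - {c}) x (Suc i) + x z * es (V - {z} - {c}) x i"
    if "c \<in> V - {z}" for c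
  proof -
    have "V - {c} - {z} = V - {z} - {c}" by auto
    then show ?thesis using es_remove[of "V - {c}" z x i] that assms by auto
  qed
  then show ?thesis
    by (simp add: es_clique_def es_pair_def algebra_simps sum.distrib sum_distrib_left)
qed

text \<open>Splitting \<open>z\<close> off \<open>V - {c}\<close> reduces both sides to
  \<open>es_pair\<close> over \<open>V - {z}\<close>. The two instances of
  \<open>es_pair_Suc\<close> carry factors that differ by 1; with x_z E_i = e_(i+1) - E_(i+1) they
  merge into one multiple of e_(i+1) E_(j+1), and the difference 1 leaves the last summand.\<close>

lemma es_clique_step:
  assumes "finite V" "z \<in> V"
  shows "es_clique V x z i (Suc j) = es_clique V x z (Suc i) j +
    (of_nat i - 1 - of_nat j) * es V x (Suc i) * es (V - {z}) x (Suc j) +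
    es (V - {z}) x (Suc i) * es (V - {z}) x (Suc j)"
proof (cases i)
  case 0
  then show ?thesis
    using assms es_pair_Suc[of "V - {z}" x 0 j] es_pair_0[of "V - {z}" x j] es_remove[OF assms, of x 0]
    by (simp add: es_clique_0 es_clique_Suc es_pair_def algebra_simps)
next
  case (Suc i')
  then show ?thesis
    using assms
    by (simp add: es_clique_Suc es_pair_Suc[of "V - {z}" x i' j]
        es_pair_Suc[of "V - {z}" x "Suc i'" j] es_remove[OF assms, of x "Suc i'"] algebra_simps)
qed

lemma es_clique_right_0:
  assumes "finite V" "z \<in> V"
  shows "es_clique V x z i 0 = of_nat i * es V x (Suc i) + es (V - {z}) x (Suc i)"
proof (cases i)
  case 0
  then show ?thesis using assms by (simp add: es_clique_0 es_pair_0)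
next
  case (Suc i')
  then show ?thesis
    using assms es_remove[OF assms, of x i] by (simp add: es_clique_Suc es_pair_0 algebra_simps)
qed

lemma es_clique_expand:
  fixes x :: "'a \<Rightarrow> 'b::comm_ring_1"
  assumes "finite V" "z \<in> V"
  shows "es_clique V x z i j =
    (\<Sum>r\<le>i + j + 1. clique_coeff i j r * (es V x r * es (V - {z}) x (i + j + 1 - r)))"
proof (induction j arbitrary: i)
  case 0
  have "clique_coeff i 0 r * (es V x r * es (V - {z}) x (Suc i - r)) =
     (if r = 0 then es (V - {z}) x (Suc i) else 0) +
     (if r = Suc i then of_nat i * es V x (Suc i) else 0)"
    if "r \<le> Suc i" for r
  proof -
    consider "r = 0" | "0 < r" "r \<le> i" | "r = Suc i" using \<open>r \<le> Suc i\<close> by linarith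
    then show ?thesis using assms by cases (auto simp: clique_coeff_def)
  qed
  then have "(\<Sum>r\<le>Suc i. clique_coeff i 0 r * (es V x r * es (V - {z}) x (Suc i - r))) =
    (\<Sum>r\<le>Suc i. (if r = 0 then es (V - {z}) x (Suc i) else 0) +
     (if r = Suc i then of_nat i * es V x (Suc i) else 0))"
    by (intro sum.cong) auto
  then show ?case using assms by (simp add: es_clique_right_0 sum.distrib del: sum.atMost_Suc)
next
  case (Suc j)
  let ?e = "es V x" and ?E = "es (V - {z}) x" and ?n = "i + Suc j + 1"
  \<comment> \<open>This is \<open>es_clique_step\<close> on the level of coefficients; the last
    bracket is the expansion of E_(i+1) E_(j+1) by \<open>es_pointed_mult\<close>.\<close>
  have c: "clique_coeff i (Suc j) r = clique_coeff (Suc i) j r +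
      of_bool (r = Suc i) * (of_nat i - 1 - of_nat j) +
      (of_bool (r \<le> Suc j) - of_bool (Suc i < r) :: 'b)" for r
    by (auto simp: clique_coeff_def algebra_simps le_Suc_eq less_Suc_eq)
  have "es_clique V x z i (Suc j) = es_clique V x z (Suc i) j +
    (of_nat i - 1 - of_nat j) * (?e (Suc i) * ?E (Suc j)) + ?E (Suc i) * ?E (Suc j)"
    using es_clique_step[OF assms] by (simp add: mult.assoc)
  also have "\<dots> = (\<Sum>r\<le>?n. clique_coeff (Suc i) j r * (?e r * ?E (?n - r))) +
     (\<Sum>r\<le>?n. of_bool (r = Suc i) * ((of_nat i - 1 - of_nat j) * (?e r * ?E (?n - r)))) +
     (\<Sum>r\<le>?n. (of_bool (r \<le> Suc j) - of_bool (Suc i < r)) * (?e r * ?E (?n - r)))"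
    using Suc[of "Suc i"] es_pointed_mult[OF assms, of x "Suc i" "Suc j"]
    by (subst sum_of_bool_eq) (simp_all del: sum.atMost_Suc)
  also have "\<dots> = (\<Sum>r\<le>?n. clique_coeff i (Suc j) r * (?e r * ?E (?n - r)))"
    unfolding sum.distrib[symmetric] c by (simp add: algebra_simps)
  finally show ?case .
qed

section \<open>The kernel of the melting case and its image of the E_i\<close>

lemma sum_es_remove2:
  assumes "finite V"
  shows "(\<Sum>u\<in>V. \<Sum>v\<in>V - {u}. x u * x v * es (V - {u} - {v}) x j) =
    of_nat (Suc j) * of_nat (Suc (Suc j)) * es V x (Suc (Suc j))"
proof -
  have "(\<Sum>v\<in>V - {u}. x u * x v * es (V - {u} - {v}) x j) =
      of_nat (Suc j) * (x u * es (V - {u}) x (Suc j))" for u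
  proof -
    have "(\<Sum>v\<in>V - {u}. x u * x v * es (V - {u} - {v}) x j) =
        x u * (\<Sum>v\<in>V - {u}. x v * es (V - {u} - {v}) x j)"
      by (simp only: sum_distrib_left mult.assoc)
    then show ?thesis using sum_es_remove[of "V - {u}" x j] assms by (simp add: mult_ac)
  qed
  then show ?thesis
    using sum_es_remove[OF assms, of x "Suc j"]
    by (simp only: mult.assoc flip: sum_distrib_left)
qed

text \<open>Up to the factor \<open>a!\<close>, the kernel of \<open>WL (a + 3) 1\<close> from its first vertex, coloured \<open>p\<close>, to its
  last, coloured \<open>q\<close>. The vertices \<open>a + 2\<close> and \<open>a + 3\<close> are coloured \<open>u\<close> and \<open>v\<close>, where
  \<open>v = p\<close> is allowed; the \<open>a\<close> vertices before them contribute the elementary symmetric polynomial.\<close>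

definition melt_kernel :: "nat \<Rightarrow> 'a set \<Rightarrow> ('a \<Rightarrow> 'b::comm_ring_1) \<Rightarrow> 'a \<Rightarrow> 'a \<Rightarrow> 'b" where
  "melt_kernel a V x p q =
     (\<Sum>u\<in>V - {p, q}. \<Sum>v\<in>V - {u, q}. x u * x v * es (V - {p, u, v}) x a)"

lemma melt_kernel_same:
  assumes "finite V"
  shows "melt_kernel a V x p p =
    of_nat (Suc a) * of_nat (Suc (Suc a)) * es (V - {p}) x (Suc (Suc a))"
proof -
  have "V - {u, p} = V - {p} - {u}" "V - {p, u, v} = V - {p} - {u} - {v}" for u v by auto
  then show ?thesis
    using sum_es_remove2[of "V - {p}" x a] assms by (simp add: melt_kernel_def)
qed

text \<open>The four terms come from two alternatives: whether \<open>v = p\<close>, and whether the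
  colour \<open>q\<close> occurs among the \<open>a\<close> interior vertices, which are not
  adjacent to the last vertex.\<close>

lemma melt_kernel_neq:
  fixes x :: "'a \<Rightarrow> 'b::comm_ring_1"
  assumes "finite V" "p \<in> V" "q \<in> V" "p \<noteq> q" and a: "a = Suc a'"
  defines "Y \<equiv> V - {p, q}"
  shows "melt_kernel a V x p q =
    of_nat (Suc a) * of_nat (Suc (Suc a)) * es Y x (Suc (Suc a)) +
    x q * of_nat a * of_nat (Suc a) * es Y x (Suc a) +
    x p * (of_nat (Suc a) * es Y x (Suc a) + x q * of_nat a * es Y x a)"
proof -
  have fin: "finite Y" using assms by simp
  have q1: "es (V - {p, u, p}) x a = es (Y - {u}) x a + x q * es (Y - {u}) x a'" if "u \<in> Y" for u
  proof -
    have "V - {p, u, p} = insert q (Y - {u})" using that assms by auto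
    then show ?thesis using es_insert[of "Y - {u}" q x a'] fin by (simp add: a Y_def)
  qed
  have q2: "es (V - {p, u, v}) x a = es (Y - {u} - {v}) x a + x q * es (Y - {u} - {v}) x a'"
    if "u \<in> Y" "v \<in> Y - {u}" for u v
  proof -
    have "V - {p, u, v} = insert q (Y - {u} - {v})" using that assms by auto
    then show ?thesis using es_insert[of "Y - {u} - {v}" q x a'] fin by (simp add: a Y_def)
  qed
  have ins: "V - {u, q} = insert p (Y - {u})" if "u \<in> Y" for u
    using that assms by auto
  have pY: "p \<notin> Y" by (simp add: Y_def)
  have "melt_kernel a V x p q = (\<Sum>u\<in>Y. x u * x p * es (V - {p, u, p}) x a +
      (\<Sum>v\<in>Y - {u}. x u * x v * es (V - {p, u, v}) x a))"
    unfolding melt_kernel_def Y_def[symmetric] using fin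
    by (intro sum.cong refl) (simp add: ins pY del: insert_Diff_single)
  also have "\<dots> = (\<Sum>u\<in>Y. x p * (x u * es (Y - {u}) x a) + x p * x q * (x u * es (Y - {u}) x a') +
      ((\<Sum>v\<in>Y - {u}. x u * x v * es (Y - {u} - {v}) x a) +
       x q * (\<Sum>v\<in>Y - {u}. x u * x v * es (Y - {u} - {v}) x a')))"
    unfolding sum_distrib_left
    by (intro sum.cong refl arg_cong2[where f = "(+)"])
       (simp_all add: q1 q2 algebra_simps sum.distrib del: insert_Diff_single)
  also have "\<dots> = x p * (of_nat (Suc a) * es Y x (Suc a)) + x p * x q * (of_nat a * es Y x a) +
      (of_nat (Suc a) * of_nat (Suc (Suc a)) * es Y x (Suc (Suc a)) +
       x q * (of_nat a * of_nat (Suc a) * es Y x (Suc a)))"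
    unfolding sum.distrib sum_distrib_left[symmetric] sum_es_remove[OF fin] sum_es_remove2[OF fin] a ..
  finally show ?thesis by (simp add: algebra_simps)
qed

text \<open>For the graph itself \<open>q\<close> is the fixed last colour and \<open>p\<close> is
  summed over. Eliminating x_p leaves terms that are either constant in \<open>p\<close> or contain
  one polynomial without \<open>p\<close>, as \<open>es_clique\<close> requires. The factors are
  (a+1)(a+2) - (a+1) = (a+1)^2 and a(a+1) - a = a^2.\<close>

lemma melt_kernel_neq_right:
  fixes x :: "'a \<Rightarrow> 'b::comm_ring_1"
  assumes "finite V" "p \<in> V" "q \<in> V" "p \<noteq> q" and a: "a = Suc a'"
  shows "melt_kernel a V x p q =
    of_nat (Suc a) * of_nat (Suc a) * es (V - {q} - {p}) x (Suc (Suc a)) +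
    of_nat (Suc a) * es (V - {q}) x (Suc (Suc a)) +
    x q * of_nat a * (of_nat a * es (V - {q} - {p}) x (Suc a) + es (V - {q}) x (Suc a))"
proof -
  have Y: "V - {p, q} = V - {q} - {p}" by auto
  have *: "x p * es (V - {q} - {p}) x j = es (V - {q}) x (Suc j) - es (V - {q} - {p}) x (Suc j)" for j
    using es_remove[of "V - {q}" p x j] assms by simp
  have "melt_kernel a V x p q =
    of_nat (Suc a) * of_nat (Suc (Suc a)) * es (V - {q} - {p}) x (Suc (Suc a)) +
    x q * of_nat a * of_nat (Suc a) * es (V - {q} - {p}) x (Suc a) +
    (of_nat (Suc a) * (x p * es (V - {q} - {p}) x (Suc a)) +
     x q * of_nat a * (x p * es (V - {q} - {p}) x a))"
    unfolding melt_kernel_neq[OF assms] Y by (simp add: algebra_simps)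
  then show ?thesis unfolding * by (simp add: algebra_simps)
qed

text \<open>For the reverse graph \<open>p\<close> is fixed and \<open>q\<close> is summed over, so
  x_q is the variable to eliminate. The factors are (a+1)(a+2) - a(a+1) = 2(a+1) and (a+1) - a =
  1.\<close>

lemma melt_kernel_neq_left:
  fixes x :: "'a \<Rightarrow> 'b::comm_ring_1"
  assumes "finite V" "p \<in> V" "q \<in> V" "p \<noteq> q" and a: "a = Suc a'"
  shows "melt_kernel a V x p q =
    2 * of_nat (Suc a) * es (V - {p} - {q}) x (Suc (Suc a)) +
    of_nat a * of_nat (Suc a) * es (V - {p}) x (Suc (Suc a)) +
    x p * (es (V - {p} - {q}) x (Suc a) + of_nat a * es (V - {p}) x (Suc a))"
proof -
  have Y: "V - {p, q} = V - {p} - {q}" by auto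
  have *: "x q * es (V - {p} - {q}) x j = es (V - {p}) x (Suc j) - es (V - {p} - {q}) x (Suc j)" for j
    using es_remove[of "V - {p}" q x j] assms by simp
  have "melt_kernel a V x p q =
    of_nat (Suc a) * of_nat (Suc (Suc a)) * es (V - {p} - {q}) x (Suc (Suc a)) +
    of_nat a * of_nat (Suc a) * (x q * es (V - {p} - {q}) x (Suc a)) +
    x p * (of_nat (Suc a) * es (V - {p} - {q}) x (Suc a) +
      of_nat a * (x q * es (V - {p} - {q}) x a))"
    unfolding melt_kernel_neq[OF assms] Y by (simp add: algebra_simps)
  then show ?thesis unfolding * by (simp add: algebra_simps)
qed

text \<open>The common form of the sums for the graph and for its reverse, which differ only in
  \<open>P\<close>, \<open>R\<close> and \<open>c\<close>. The third summand collects the colourings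
  in which both ends are coloured \<open>z\<close>.\<close>

definition melt_sum :: "'b \<Rightarrow> 'b \<Rightarrow> 'b \<Rightarrow> nat \<Rightarrow> nat \<Rightarrow> 'a set \<Rightarrow> ('a \<Rightarrow> 'b::comm_ring_1) \<Rightarrow> 'a \<Rightarrow> 'b" where
  "melt_sum P R c a i V x z =
     P * es_clique V x z i (a + 2) + R * (x z * es_clique V x z i (a + 1)) +
     of_nat (a + 1) * of_nat (a + 2) * (x z * es (V - {z}) x i * es (V - {z}) x (a + 2)) +
     (c * es (V - {z}) x (a + 2) + of_nat a * (x z * es (V - {z}) x (a + 1))) * es_clique V x z i 0"

lemma sum_melt_kernel_right:
  fixes x :: "'a \<Rightarrow> 'b::comm_ring_1"
  assumes "finite V" "z \<in> V" and a: "a = Suc a'"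
  shows "(\<Sum>p\<in>V. x p * es (V - {p}) x i * melt_kernel a V x p z) =
    melt_sum (of_nat (a + 1) * of_nat (a + 1)) (of_nat a * of_nat a) (of_nat (a + 1)) a i V x z"
proof -
  let ?E = "es (V - {z}) x"
  have "(\<Sum>p\<in>V - {z}. x p * es (V - {p}) x i * melt_kernel a V x p z) =
    (\<Sum>p\<in>V - {z}.
      of_nat (Suc a) * of_nat (Suc a) * (x p * es (V - {p}) x i * es (V - {z} - {p}) x (Suc (Suc a))) +
      of_nat a * of_nat a * x z * (x p * es (V - {p}) x i * es (V - {z} - {p}) x (Suc a)) +
      (of_nat (Suc a) * ?E (Suc (Suc a)) + of_nat a * x z * ?E (Suc a)) * (x p * es (V - {p}) x i))"
    using assms by (intro sum.cong refl) (simp add: melt_kernel_neq_right algebra_simps)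
  also have "\<dots> = of_nat (Suc a) * of_nat (Suc a) * es_clique V x z i (Suc (Suc a)) +
      of_nat a * of_nat a * x z * es_clique V x z i (Suc a) +
      (of_nat (Suc a) * ?E (Suc (Suc a)) + of_nat a * x z * ?E (Suc a)) * es_clique V x z i 0"
    unfolding sum.distrib sum_distrib_left[symmetric] using assms(1) by (simp add: es_clique_def)
  finally show ?thesis
    using assms by (simp add: melt_sum_def sum.remove[of V z] melt_kernel_same algebra_simps)
qed

lemma sum_melt_kernel_left:
  fixes x :: "'a \<Rightarrow> 'b::comm_ring_1"
  assumes "finite V" "z \<in> V" and a: "a = Suc a'"
  shows "(\<Sum>p\<in>V. x p * es (V - {p}) x i * melt_kernel a V x z p) =
    melt_sum (2 * of_nat (a + 1)) 1 (of_nat a * of_nat (a + 1)) a i V x z"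
proof -
  let ?E = "es (V - {z}) x"
  have "(\<Sum>p\<in>V - {z}. x p * es (V - {p}) x i * melt_kernel a V x z p) =
    (\<Sum>p\<in>V - {z}.
      2 * of_nat (Suc a) * (x p * es (V - {p}) x i * es (V - {z} - {p}) x (Suc (Suc a))) +
      x z * (x p * es (V - {p}) x i * es (V - {z} - {p}) x (Suc a)) +
      (of_nat a * of_nat (Suc a) * ?E (Suc (Suc a)) + of_nat a * x z * ?E (Suc a)) * (x p * es (V - {p}) x i))"
  proof (intro sum.cong refl)
    fix p assume "p \<in> V - {z}"
    then have "p \<in> V" "z \<noteq> p" by auto
    note melt_kernel_neq_left[where x = x, OF assms(1,2) this a]
    then show "x p * es (V - {p}) x i * melt_kernel a V x z p =
      2 * of_nat (Suc a) * (x p * es (V - {p}) x i * es (V - {z} - {p}) x (Suc (Suc a))) +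
      x z * (x p * es (V - {p}) x i * es (V - {z} - {p}) x (Suc a)) +
      (of_nat a * of_nat (Suc a) * ?E (Suc (Suc a)) + of_nat a * x z * ?E (Suc a)) * (x p * es (V - {p}) x i)"
      by (simp add: algebra_simps)
  qed
  also have "\<dots> = 2 * of_nat (Suc a) * es_clique V x z i (Suc (Suc a)) +
      x z * es_clique V x z i (Suc a) +
      (of_nat a * of_nat (Suc a) * ?E (Suc (Suc a)) + of_nat a * x z * ?E (Suc a)) * es_clique V x z i 0"
    unfolding sum.distrib sum_distrib_left[symmetric] using assms(1) by (simp add: es_clique_def)
  finally show ?thesis
    using assms by (simp add: melt_sum_def sum.remove[of V z] melt_kernel_same algebra_simps)
qed

text \<open>The coefficient of e_r E_s after every x_z E_j has been replaced by e_(j+1) - E_(j+1)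
  and E_(i+1) E_(a+2) has been expanded. The products e_r e_s that arise on the way are kept apart;
  their coefficients are nonnegative on their own.\<close>

definition melt_coeff :: "'b \<Rightarrow> 'b \<Rightarrow> 'b \<Rightarrow> nat \<Rightarrow> nat \<Rightarrow> nat \<Rightarrow> 'b::comm_ring_1" where
  "melt_coeff P R c a i r =
     P * clique_coeff i (a + 2) r - R * clique_coeff i (a + 1) r +
     of_bool (r = i + 1) * (of_nat (a + 1) * of_nat (a + 2) + of_nat i * (c - of_nat a)) -
     (of_bool (r \<le> a + 2) - of_bool (i + 1 < r)) * (of_nat (a + 1) * of_nat (a + 2) - (c - of_nat a)) +
     of_bool (r = a + 2) * of_nat a"

lemma melt_sum_expand:
  fixes x :: "'a \<Rightarrow> 'b::comm_ring_1"
  assumes "finite V" "z \<in> V"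
  shows "melt_sum P R c a i V x z =
    (\<Sum>r\<le>i + a + 3. melt_coeff P R c a i r * (es V x r * es (V - {z}) x (i + a + 3 - r))) +
    (\<Sum>r\<le>i + a + 3. (R * clique_coeff i (a + 1) r + of_bool (r = i + 1) * (of_nat i * of_nat a)) *
      (es V x r * es V x (i + a + 3 - r)))"
proof -
  let ?e = "es V x" and ?E = "es (V - {z}) x" and ?N = "i + a + 3"
  have shift: "x z * ?E j = ?e (Suc j) - ?E (Suc j)" for j
    using es_remove[OF assms, of x j] by simp
  have c1: "es_clique V x z i (a + 2) = (\<Sum>r\<le>?N. clique_coeff i (a + 2) r * (?e r * ?E (?N - r)))"
    using es_clique_expand[OF assms, of x i "a + 2"] by (simp add: algebra_simps numeral_3_eq_3 del: sum.atMost_Suc)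
  have "x z * es_clique V x z i (a + 1) =
      (\<Sum>r\<le>i + a + 2. clique_coeff i (a + 1) r * (?e r * (x z * ?E (i + a + 2 - r))))"
    using es_clique_expand[OF assms, of x i "a + 1"]
    by (simp add: sum_distrib_left mult_ac del: sum.atMost_Suc)
  also have "\<dots> = (\<Sum>r\<le>i + a + 2. clique_coeff i (a + 1) r * (?e r * (?e (?N - r) - ?E (?N - r))))"
  proof (intro sum.cong refl)
    fix r assume "r \<in> {..i + a + 2}"
    then have "Suc (i + a + 2 - r) = ?N - r" by auto
    then show "clique_coeff i (a + 1) r * (?e r * (x z * ?E (i + a + 2 - r))) =
        clique_coeff i (a + 1) r * (?e r * (?e (?N - r) - ?E (?N - r)))"
      by (simp only: shift)
  qed
  \<comment> \<open>The new term at \<open>r = ?N\<close> vanishes because e_0 - E_0 = 0.\<close>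
  also have "\<dots> = (\<Sum>r\<le>?N. clique_coeff i (a + 1) r * (?e r * (?e (?N - r) - ?E (?N - r))))"
    using assms(1) by (simp add: numeral_3_eq_3)
  finally have c2: "x z * es_clique V x z i (a + 1) =
      (\<Sum>r\<le>?N. clique_coeff i (a + 1) r * (?e r * (?e (?N - r) - ?E (?N - r))))" .
  have EE: "?E (i + 1) * ?E (a + 2) =
      (\<Sum>r\<le>?N. (of_bool (r \<le> a + 2) - of_bool (i + 1 < r)) * (?e r * ?E (?N - r)))"
    using es_pointed_mult[OF assms, of x "i + 1" "a + 2"]
    by (simp add: algebra_simps numeral_3_eq_3 del: sum.atMost_Suc)
  have s1: "?e (i + 1) * ?E (a + 2) = (\<Sum>r\<le>?N. of_bool (r = i + 1) * (?e r * ?E (?N - r)))"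
    by (subst sum_of_bool_eq) auto
  have s2: "?e (a + 2) * ?E (i + 1) = (\<Sum>r\<le>?N. of_bool (r = a + 2) * (?e r * ?E (?N - r)))"
    by (subst sum_of_bool_eq) auto
  have s3: "?e (i + 1) * ?e (a + 2) = (\<Sum>r\<le>?N. of_bool (r = i + 1) * (?e r * ?e (?N - r)))"
    by (subst sum_of_bool_eq) auto
  have "melt_sum P R c a i V x z =
     P * es_clique V x z i (a + 2) + R * (x z * es_clique V x z i (a + 1)) +
     (of_nat (a + 1) * of_nat (a + 2) + of_nat i * (c - of_nat a)) * (?e (i + 1) * ?E (a + 2)) -
     (of_nat (a + 1) * of_nat (a + 2) - (c - of_nat a)) * (?E (i + 1) * ?E (a + 2)) +
     of_nat a * (?e (a + 2) * ?E (i + 1)) +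
     of_nat i * of_nat a * (?e (i + 1) * ?e (a + 2))"
    using assms
    by (simp add: melt_sum_def es_clique_right_0 es_remove[OF assms, of x i]
        es_remove[OF assms, of x "Suc a"] algebra_simps)
  also have "\<dots> = (\<Sum>r\<le>?N. melt_coeff P R c a i r * (?e r * ?E (?N - r)) +
      (R * clique_coeff i (a + 1) r + of_bool (r = i + 1) * (of_nat i * of_nat a)) *
      (?e r * ?e (?N - r)))"
    unfolding c1 c2 EE s1 s2 s3 sum_distrib_left sum.distrib[symmetric] sum_subtractf[symmetric]
    by (intro sum.cong refl) (simp add: melt_coeff_def algebra_simps)
  finally show ?thesis by (simp only: sum.distrib)
qed

text \<open>Both parameter triples satisfy P - R = 2a + 1 and P + c = (a+1)(a+2), so their
  coefficients agree for \<open>r \<noteq> i + 1\<close>. For r at most i and at most a + 1 the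
  value is (2a+1)(a+2-r) - a, for r larger than i + 1 and a + 2 it is (2a+1)(r-a-2) + a. At r = a +
  2 \<le> i the last summand of \<open>melt_coeff\<close> just compensates the -a. At r = i + 1 the
  multiple of c - a contributes, which is 1 or a^2.\<close>

lemma melt_coeff_nonneg:
  fixes a i r :: nat
  shows "0 \<le> (melt_coeff (of_nat (a + 1) * of_nat (a + 1)) (of_nat a * of_nat a) (of_nat (a + 1)) a i r :: rat)"
    and "0 \<le> (melt_coeff (2 * of_nat (a + 1)) 1 (of_nat a * of_nat (a + 1)) a i r :: rat)"
proof -
  define A I r' :: rat where "A = of_nat a" and "I = of_nat i" and "r' = of_nat r"
  have nn: "0 \<le> A" "0 \<le> I" "0 \<le> r'" "0 \<le> A * A" "0 \<le> I * A" "0 \<le> A * (A * I)"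
    by (simp_all add: A_def I_def r'_def)
  note sym = A_def[symmetric] I_def[symmetric] r'_def[symmetric]
  let ?f = "melt_coeff (of_nat (a + 1) * of_nat (a + 1)) (of_nat a * of_nat a) (of_nat (a + 1)) a i r :: rat"
  let ?g = "melt_coeff (2 * of_nat (a + 1)) 1 (of_nat a * of_nat (a + 1)) a i r :: rat"
  have i: "r \<le> i \<or> r = i + 1 \<or> i + 1 < r" by linarith
  consider "r \<le> a + 1" | "r = a + 2" | "a + 3 \<le> r" by linarith
  then have "0 \<le> ?f \<and> 0 \<le> ?g"
  proof cases
    case 1
    note r = this
    from i show ?thesis
    proof (elim disjE)
      assume "r \<le> i"
      note rr = r this
      from rr have "r' \<le> A + 1" by (simp add: A_def r'_def flip: of_nat_Suc)
      then have "r' * (2 * A + 1) \<le> (A + 1) * (2 * A + 1)" using nn by (intro mult_right_mono) auto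
      then show ?thesis using rr nn by (simp add: melt_coeff_def clique_coeff_def sym algebra_simps)
    next
      assume "r = i + 1"
      note rr = r this
      from rr have "r' = I + 1" by (simp add: I_def r'_def)
      then show ?thesis using rr nn by (simp add: melt_coeff_def clique_coeff_def sym algebra_simps)
    next
      assume "i + 1 < r"
      note rr = r this
      from rr show ?thesis by (simp add: melt_coeff_def clique_coeff_def sym algebra_simps)
    qed
  next
    case 2
    note r = this
    from i show ?thesis
    proof (elim disjE)
      assume "r \<le> i"
      note rr = r this
      from rr have "r' = A + 2" by (simp add: A_def r'_def)
      then show ?thesis using rr by (simp add: melt_coeff_def clique_coeff_def sym algebra_simps)
    next
      assume "r = i + 1"
      note rr = r this
      from rr have "r' = A + 2" "i = a + 1" "I = A + 1" by (simp_all add: A_def r'_def I_def)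
      then show ?thesis using rr nn by (simp add: melt_coeff_def clique_coeff_def sym algebra_simps)
    next
      assume "i + 1 < r"
      note rr = r this
      from rr have "r' = A + 2" by (simp add: A_def r'_def)
      then show ?thesis using rr nn by (simp add: melt_coeff_def clique_coeff_def sym algebra_simps)
    qed
  next
    case 3
    note r = this
    from i show ?thesis
    proof (elim disjE)
      assume "r \<le> i"
      note rr = r this
      from rr show ?thesis by (simp add: melt_coeff_def clique_coeff_def sym algebra_simps)
    next
      assume "r = i + 1"
      note rr = r this
      from rr have r': "r' = I + 1" "A + 2 \<le> I" by (simp_all add: A_def r'_def I_def flip: of_nat_Suc)
      then have "0 \<le> (I - A - 2) * (2 * A + 1)" using nn by (intro mult_nonneg_nonneg) auto
      then show ?thesis using r' rr nn
        by (simp add: melt_coeff_def clique_coeff_def sym algebra_simps) (use nn in linarith)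
    next
      assume "i + 1 < r"
      note rr = r this
      from rr have "A + 3 \<le> r'" by (simp add: A_def r'_def)
      then have "(A + 3) * (2 * A + 1) \<le> r' * (2 * A + 1)" using nn by (intro mult_right_mono) auto
      then show ?thesis using rr nn by (simp add: melt_coeff_def clique_coeff_def sym algebra_simps)
    qed
  qed
  then show "0 \<le> ?f" and "0 \<le> ?g" by auto
qed

section \<open>Pointed symmetric functions\<close>

lemma block_eq:
  assumes "partition_on A \<pi>" "B \<in> \<pi>" "i \<in> B"
  shows "block \<pi> i = B"
  unfolding block_def
  using assms by (intro the_equality) (auto simp: partition_on_def disjoint_def)

lemma block_in:
  assumes "partition_on A \<pi>" "i \<in> A"
  shows "block \<pi> i \<in> \<pi>" "i \<in> block \<pi> i"
proof -
  obtain B where "B \<in> \<pi>" "i \<in> B" using assms by (auto simp: partition_on_def)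
  then show "block \<pi> i \<in> \<pi>" "i \<in> block \<pi> i" using block_eq[OF assms(1)] by auto
qed

lemma ex_partition_on_card:
  assumes "finite A" "0 \<notin># l" "sum_mset l = card A"
  shows "\<exists>\<pi>. partition_on A \<pi> \<and> image_mset card (mset_set \<pi>) = l"
  using assms
proof (induction l arbitrary: A)
  case empty
  then show ?case by (intro exI[of _ "{}"]) (auto simp: partition_on_def)
next
  case (add c l)
  then obtain C where C: "C \<subseteq> A" "card C = c" by (metis le_add1 obtain_subset_with_card_n sum_mset.add_mset)
  then have "sum_mset l = card (A - C)" using add.prems by (simp add: card_Diff_subset finite_subset)
  then obtain \<pi> where \<pi>: "partition_on (A - C) \<pi>" "image_mset card (mset_set \<pi>) = l"
    using add.IH[of "A - C"] add.prems by auto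
  have C': "C \<noteq> {}" using C add.prems by auto
  then have part: "partition_on A (insert C \<pi>)" using \<pi>(1) C(1) 
    by (auto simp: partition_on_def disjoint_def)
  have "C \<notin> \<pi>" using \<pi>(1) C' by (auto simp: partition_on_def)
  moreover have "finite \<pi>" using \<pi>(1) add.prems(1) finite_elements[of "A - C"] by simp
  ultimately show ?case using part \<pi>(2) C(2) by (intro exI[of _ "insert C \<pi>"]) auto
qed

lemma partition_on_Diff_block:
  assumes "partition_on A \<pi>" "B \<in> \<pi>"
  shows "partition_on (A - B) (\<pi> - {B})"
  using assms by (fastforce simp: partition_on_def disjoint_def)

text \<open>Surjectivity supplies, for each basis index, a set partition of that type; this is how
  an expansion in the cone is lifted back to NCSym. Finiteness of \<open>ubc_index\<close> also
  follows from it.\<close>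

lemma partition_type_image:
  assumes "1 \<le> d"
  shows "partition_type d ` {\<pi>. partition_on {1..d} \<pi>} = ubc_index d"
proof (intro equalityI subsetI)
  fix p assume "p \<in> partition_type d ` {\<pi>. partition_on {1..d} \<pi>}"
  then obtain \<pi> where \<pi>: "partition_on {1..d} \<pi>" and p: "p = partition_type d \<pi>" by auto
  let ?B = "block \<pi> d"
  have B: "?B \<in> \<pi>" "d \<in> ?B" using block_in[OF \<pi>] assms by auto
  have fin: "finite \<pi>" "\<And>C. C \<in> \<pi> \<Longrightarrow> finite C"
    using finite_elements[OF _ \<pi>] \<pi> by (auto simp: partition_on_def intro: finite_subset)
  have "sum card (\<pi> - {?B}) + card ?B = sum card \<pi>"
    using B fin by (simp add: sum.remove)
  also have "\<dots> = card (\<Union>\<pi>)"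
    using \<pi> fin by (intro card_Union_disjoint[symmetric]) (auto simp: partition_on_def disjoint_def pairwise_def disjnt_def)
  also have "\<dots> = d" using \<pi> by (simp add: partition_on_def)
  finally have "sum card (\<pi> - {?B}) + card ?B = d" .
  moreover have "card C \<noteq> 0" if "C \<in> \<pi>" for C
    using that fin \<pi> by (auto simp: partition_on_def)
  moreover from this[OF B(1)] have "1 \<le> card ?B" by simp
  ultimately show "p \<in> ubc_index d"
    using fin by (auto simp: p ubc_index_def partition_type_def sum_unfold_sum_mset)
next
  fix p assume "p \<in> ubc_index d"
  then obtain l b where p: "p = (l, b)" "0 \<notin># l" "1 \<le> b" "sum_mset l + b = d"
    by (auto simp: ubc_index_def)
  \<comment> \<open>The last \<open>b\<close> labels serve as a block of size \<open>b\<close> that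
    contains \<open>d\<close>.\<close>
  define B where "B = {d + 1 - b..d}"
  have B: "B \<subseteq> {1..d}" "card B = b" "d \<in> B" using p by (auto simp: B_def)
  then have "sum_mset l = card ({1..d} - B)" using p by (simp add: card_Diff_subset finite_subset B_def)
  then obtain \<sigma> where \<sigma>: "partition_on ({1..d} - B) \<sigma>" "image_mset card (mset_set \<sigma>) = l"
    using ex_partition_on_card[of "{1..d} - B" l] p by auto
  have part: "partition_on {1..d} (insert B \<sigma>)"
    using \<sigma>(1) B by (auto simp: partition_on_def disjoint_def)
  have "B \<notin> \<sigma>" using \<sigma>(1) B by (auto simp: partition_on_def)
  then have "partition_type d (insert B \<sigma>) = p"
    using block_eq[OF part _ B(3)] \<sigma>(2) B(2) p(1) by (simp add: partition_type_def)
  then show "p \<in> partition_type d ` {\<pi>. partition_on {1..d} \<pi>}" using part by auto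
qed

lemma finite_ubc_index: "finite (ubc_index d)"
proof (cases "d = 0")
  case True
  then have "ubc_index d = {}" by (auto simp: ubc_index_def)
  then show ?thesis by simp
next
  case False
  have "finite {\<pi>. partition_on {1..d} \<pi>}"
    using finitely_many_partition_on[of "{1..d}"] by simp
  then show ?thesis using partition_type_image[of d] False by (metis One_nat_def Suc_leI finite_imageI neq0_conv)
qed

section \<open>The cone spanned by the pointed functions of the basis\<close>

type_synonym pointed = "nat set \<Rightarrow> (nat \<Rightarrow> rat) \<Rightarrow> nat \<Rightarrow> rat"

text \<open>Letting the variables in all positions but the last commute and fixing the last one to be
  \<open>x\<^sub>z\<close> (and then dropping it) sends \<open>e\<^bsub>(\<lambda>,b)\<^esub>\<close> to a positive multiple of this function.\<close>

definition e_pointed :: "nat multiset \<times> nat \<Rightarrow> pointed" where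
  "e_pointed p V x z = (\<Prod>c\<in>#fst p. es V x c) * es (V - {z}) x (snd p - 1)"

text \<open>The coefficients are chosen before \<open>V\<close>, \<open>x\<close> and
  \<open>z\<close>: one expansion serves all finite alphabets and all values, which takes the place
  of an identity of formal series. The index \<open>d\<close> counts the last vertex as well, so it
  exceeds the degree in \<open>x\<close> by one.\<close>

definition e_cone :: "nat \<Rightarrow> pointed \<Rightarrow> bool" where
  "e_cone d f \<longleftrightarrow> (\<exists>a. (\<forall>p. 0 \<le> a p) \<and> (\<forall>V x z. finite V \<longrightarrow> V \<subseteq> {1..} \<longrightarrow> z \<in> V \<longrightarrow>
     f V x z = (\<Sum>p\<in>ubc_index d. a p * e_pointed p V x z)))"

lemma e_cone_cong:
  assumes "e_cone d f" "\<And>V x z. finite V \<Longrightarrow> V \<subseteq> {1..} \<Longrightarrow> z \<in> V \<Longrightarrow> g V x z = f V x z"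
  shows "e_cone d g"
  using assms unfolding e_cone_def by simp

lemma e_cone_zero: "e_cone d (\<lambda>V x z. 0)"
  unfolding e_cone_def by (intro exI[of _ "\<lambda>_. 0"]) simp

lemma e_cone_add:
  assumes "e_cone d f" "e_cone d g"
  shows "e_cone d (\<lambda>V x z. f V x z + g V x z)"
proof -
  obtain a where a: "\<And>p. 0 \<le> a p" "\<And>V x z. finite V \<Longrightarrow> V \<subseteq> {1..} \<Longrightarrow> z \<in> V \<Longrightarrow>
      f V x z = (\<Sum>p\<in>ubc_index d. a p * e_pointed p V x z)"
    using assms(1) unfolding e_cone_def by blast
  obtain b where b: "\<And>p. 0 \<le> b p" "\<And>V x z. finite V \<Longrightarrow> V \<subseteq> {1..} \<Longrightarrow> z \<in> V \<Longrightarrow>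
      g V x z = (\<Sum>p\<in>ubc_index d. b p * e_pointed p V x z)"
    using assms(2) unfolding e_cone_def by blast
  show ?thesis unfolding e_cone_def using a b
    by (intro exI[of _ "\<lambda>p. a p + b p"]) (simp add: algebra_simps sum.distrib)
qed

lemma e_cone_scale:
  assumes "e_cone d f" "0 \<le> c"
  shows "e_cone d (\<lambda>V x z. c * f V x z)"
proof -
  obtain a where a: "\<And>p. 0 \<le> a p" "\<And>V x z. finite V \<Longrightarrow> V \<subseteq> {1..} \<Longrightarrow> z \<in> V \<Longrightarrow>
      f V x z = (\<Sum>p\<in>ubc_index d. a p * e_pointed p V x z)"
    using assms(1) unfolding e_cone_def by blast
  show ?thesis unfolding e_cone_def using a assms(2)
    by (intro exI[of _ "\<lambda>p. c * a p"]) (simp add: sum_distrib_left mult.assoc)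
qed

lemma e_cone_sum:
  assumes "\<And>i. i \<in> I \<Longrightarrow> e_cone d (f i)"
  shows "e_cone d (\<lambda>V x z. \<Sum>i\<in>I. f i V x z)"
  using assms by (induction I rule: infinite_finite_induct) (auto intro: e_cone_zero e_cone_add)

lemma e_cone_e_pointed:
  assumes "p \<in> ubc_index d"
  shows "e_cone d (e_pointed p)"
  unfolding e_cone_def
proof (intro exI conjI allI impI)
  fix V x z
  have "of_bool (q = p) * e_pointed q V x z = (if q = p then e_pointed p V x z else 0)" for q by simp
  then show "e_pointed p V x z = (\<Sum>q\<in>ubc_index d. of_bool (q = p) * e_pointed q V x z)"
    using assms finite_ubc_index by simp
qed simp

lemma e_cone_mult:
  assumes "e_cone d f" "0 \<notin># l"
  shows "e_cone (sum_mset l + d) (\<lambda>V x z. (\<Prod>c\<in>#l. es V x c) * f V x z)"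
proof -
  obtain a where a: "\<And>p. 0 \<le> a p" "\<And>V x z. finite V \<Longrightarrow> V \<subseteq> {1..} \<Longrightarrow> z \<in> V \<Longrightarrow>
      f V x z = (\<Sum>p\<in>ubc_index d. a p * e_pointed p V x z)"
    using assms(1) unfolding e_cone_def by blast
  have "e_cone (sum_mset l + d) (\<lambda>V x z. \<Sum>p\<in>ubc_index d. a p * e_pointed (l + fst p, snd p) V x z)"
    using a(1) assms(2)
    by (intro e_cone_sum e_cone_scale e_cone_e_pointed) (auto simp: ubc_index_def)
  then show ?thesis
    by (rule e_cone_cong) (simp add: a(2) e_pointed_def sum_distrib_left mult_ac)
qed

lemma e_cone_mult_es:
  assumes "e_cone d f"
  shows "e_cone (r + d) (\<lambda>V x z. es V x r * f V x z)"
\<comment> \<open>An integer partition has no part 0, so the factor e_0 = 1 is treated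
  apart.\<close>
proof (cases "r = 0")
  case True
  then show ?thesis using assms by (auto elim: e_cone_cong)
next
  case False
  then show ?thesis using e_cone_mult[OF assms, of "{#r#}"] by simp
qed

lemma e_cone_es_pointed: "e_cone (s + 1) (\<lambda>V x z. es (V - {z}) x s)"
proof -
  have "e_cone (s + 1) (e_pointed ({#}, s + 1))" by (rule e_cone_e_pointed) (simp add: ubc_index_def)
  then show ?thesis by (rule e_cone_cong) (simp add: e_pointed_def)
qed

text \<open>Appending a graph acts on pointed functions through a kernel in the colours \<open>c\<close> of the shared
  vertex and \<open>z\<close> of the new last vertex. It is linear over the symmetric functions, so positivity has
  to be tested only on the \<open>es (V - {z})\<close>.\<close>

definition transfer :: "(nat set \<Rightarrow> (nat \<Rightarrow> rat) \<Rightarrow> nat \<Rightarrow> nat \<Rightarrow> rat) \<Rightarrow> pointed \<Rightarrow> pointed" where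
  "transfer K f V x z = (\<Sum>c\<in>V. x c * f V x c * K V x c z)"

lemma e_cone_transfer:
  assumes "e_cone n f" and K: "\<And>i. e_cone (i + 1 + m) (transfer K (\<lambda>V x z. es (V - {z}) x i))"
  shows "e_cone (n + m) (transfer K f)"
proof -
  obtain a where a: "\<And>p. 0 \<le> a p" "\<And>V x z. finite V \<Longrightarrow> V \<subseteq> {1..} \<Longrightarrow> z \<in> V \<Longrightarrow>
      f V x z = (\<Sum>p\<in>ubc_index n. a p * e_pointed p V x z)"
    using assms(1) unfolding e_cone_def by blast
  have "e_cone (n + m) (\<lambda>V x z. \<Sum>p\<in>ubc_index n. a p *
      ((\<Prod>c\<in>#fst p. es V x c) * transfer K (\<lambda>V x z. es (V - {z}) x (snd p - 1)) V x z))"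
  proof (intro e_cone_sum e_cone_scale a(1))
    fix p assume p: "p \<in> ubc_index n"
    then have "sum_mset (fst p) + (snd p - 1 + 1 + m) = n + m" by (auto simp: ubc_index_def)
    then show "e_cone (n + m) (\<lambda>V x z. (\<Prod>c\<in>#fst p. es V x c) *
        transfer K (\<lambda>V x z. es (V - {z}) x (snd p - 1)) V x z)"
      using e_cone_mult[OF K, of "fst p" "snd p - 1"] p by (simp only:) (simp add: ubc_index_def split_def)
  qed
  then show ?thesis
  proof (rule e_cone_cong)
    fix V x z assume V: "finite V" "V \<subseteq> {1..}" "z \<in> (V :: nat set)"
    have "transfer K f V x z =
        (\<Sum>c\<in>V. \<Sum>p\<in>ubc_index n. x c * (a p * e_pointed p V x c) * K V x c z)"
      using V by (simp add: transfer_def a(2) sum_distrib_left sum_distrib_right)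
    also have "\<dots> = (\<Sum>p\<in>ubc_index n. \<Sum>c\<in>V. x c * (a p * e_pointed p V x c) * K V x c z)"
      by (rule sum.swap)
    finally show "transfer K f V x z = (\<Sum>p\<in>ubc_index n. a p *
      ((\<Prod>c\<in>#fst p. es V x c) * transfer K (\<lambda>V x z. es (V - {z}) x (snd p - 1)) V x z))"
      by (simp add: transfer_def e_pointed_def sum_distrib_left mult_ac)
  qed
qed

text \<open>Up to the factor j!, the kernel of the clique on \<open>j + 2\<close> vertices from its
  first to its last vertex, with the \<open>j\<close> interior vertices summed out.\<close>

definition clique_kernel :: "nat \<Rightarrow> 'a set \<Rightarrow> ('a \<Rightarrow> 'b::comm_ring_1) \<Rightarrow> 'a \<Rightarrow> 'a \<Rightarrow> 'b" where
  "clique_kernel j V x p q = of_bool (p \<noteq> q) * es (V - {p, q}) x j"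

lemma e_cone_clique_kernel: "e_cone n f \<Longrightarrow> e_cone (n + (j + 1)) (transfer (clique_kernel j) f)"
proof (erule e_cone_transfer)
  fix i
  have "e_cone (i + 1 + (j + 1)) (\<lambda>V x z. \<Sum>r\<le>i + j + 1. clique_coeff i j r *
      (es V x r * es (V - {z}) x (i + j + 1 - r)))"
  proof (intro e_cone_sum e_cone_scale clique_coeff_nonneg)
    fix r assume "r \<in> {..i + j + 1}"
    then have "r + ((i + j + 1 - r) + 1) = i + 1 + (j + 1)" by auto
    then show "e_cone (i + 1 + (j + 1)) (\<lambda>V x z. es V x r * es (V - {z}) x (i + j + 1 - r))"
      using e_cone_mult_es[OF e_cone_es_pointed, of r "i + j + 1 - r"] by simp
  qed
  then show "e_cone (i + 1 + (j + 1)) (transfer (clique_kernel j) (\<lambda>V x z. es (V - {z}) x i))"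
  proof (rule e_cone_cong)
    fix V x z assume V: "finite V" "z \<in> (V :: nat set)"
    have "transfer (clique_kernel j) (\<lambda>V x z. es (V - {z}) x i) V x z = es_clique V x z i j"
    proof -
      have "V - {c, z} = V - {z} - {c}" for c by auto
      then show ?thesis
        using V unfolding transfer_def es_clique_def by (simp add: sum.remove[of V z] clique_kernel_def)
    qed
    then show "transfer (clique_kernel j) (\<lambda>V x z. es (V - {z}) x i) V x z =
        (\<Sum>r\<le>i + j + 1. clique_coeff i j r * (es V x r * es (V - {z}) x (i + j + 1 - r)))"
      using es_clique_expand[OF V, of x i j] by simp
  qed
qed

lemma e_cone_melt_sum:
  assumes "\<And>r. 0 \<le> melt_coeff P R c a i r" "0 \<le> R"
  shows "e_cone (i + a + 4) (melt_sum P R c a i)"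
proof -
  have "e_cone (i + a + 4) (\<lambda>V x z. es V x r * es (V - {z}) x (i + a + 3 - r))" if "r \<le> i + a + 3" for r
  proof -
    have "r + ((i + a + 3 - r) + 1) = i + a + 4" using that by auto
    then show ?thesis using e_cone_mult_es[OF e_cone_es_pointed, of r "i + a + 3 - r"] by (simp only:)
  qed
  \<comment> \<open>Since E_0 = 1, the product e_r e_s is the pointed function with b = 1 whose
    other parts are the nonzero ones among r and s.\<close>
  moreover have "e_cone (i + a + 4) (\<lambda>V x z. es V x r * es V x (i + a + 3 - r))" if "r \<le> i + a + 3" for r
  proof -
    have "r + ((i + a + 3 - r) + (0 + 1)) = i + a + 4" using that by auto
    then have "e_cone (i + a + 4) (\<lambda>V x z. es V x r * (es V x (i + a + 3 - r) * es (V - {z}) x 0))"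
      using e_cone_mult_es[OF e_cone_mult_es[OF e_cone_es_pointed, of "i + a + 3 - r" 0], of r]
      by (simp only:)
    then show ?thesis by (rule e_cone_cong) simp
  qed
  moreover have "0 \<le> R * clique_coeff i (a + 1) r + of_bool (r = i + 1) * (of_nat i * of_nat a)" for r
    using assms(2) clique_coeff_nonneg by simp
  ultimately have "e_cone (i + a + 4) (\<lambda>V x z.
    (\<Sum>r\<le>i + a + 3. melt_coeff P R c a i r * (es V x r * es (V - {z}) x (i + a + 3 - r))) +
    (\<Sum>r\<le>i + a + 3. (R * clique_coeff i (a + 1) r + of_bool (r = i + 1) * (of_nat i * of_nat a)) *
      (es V x r * es V x (i + a + 3 - r))))"
    using assms(1) by (intro e_cone_add e_cone_sum e_cone_scale) auto
  then show ?thesis by (rule e_cone_cong) (rule melt_sum_expand)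
qed

lemma e_cone_melt_kernel:
  assumes "e_cone n f" "1 \<le> a"
  shows "e_cone (n + (a + 3)) (transfer (melt_kernel a) f)"
    and "e_cone (n + (a + 3)) (transfer (\<lambda>V x p q. melt_kernel a V x q p) f)"
proof -
  obtain a' where a': "a = Suc a'" using assms(2) by (cases a) auto
  show "e_cone (n + (a + 3)) (transfer (melt_kernel a) f)"
  proof (rule e_cone_transfer[OF assms(1)])
    fix i
    have "e_cone (i + a + 4) (melt_sum (of_nat (a + 1) * of_nat (a + 1)) (of_nat a * of_nat a) (of_nat (a + 1)) a i)"
      using melt_coeff_nonneg(1) by (intro e_cone_melt_sum) auto
    then have "e_cone (i + a + 4) (transfer (melt_kernel a) (\<lambda>V x z. es (V - {z}) x i))"
      by (rule e_cone_cong) (simp only: transfer_def sum_melt_kernel_right[OF _ _ a'])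
    then show "e_cone (i + 1 + (a + 3)) (transfer (melt_kernel a) (\<lambda>V x z. es (V - {z}) x i))"
      by (simp add: algebra_simps)
  qed
  show "e_cone (n + (a + 3)) (transfer (\<lambda>V x p q. melt_kernel a V x q p) f)"
  proof (rule e_cone_transfer[OF assms(1)])
    fix i
    have "e_cone (i + a + 4) (melt_sum (2 * of_nat (a + 1)) 1 (of_nat a * of_nat (a + 1)) a i)"
      using melt_coeff_nonneg(2) by (intro e_cone_melt_sum) auto
    then have "e_cone (i + a + 4) (transfer (\<lambda>V x p q. melt_kernel a V x q p) (\<lambda>V x z. es (V - {z}) x i))"
      by (rule e_cone_cong) (simp only: transfer_def sum_melt_kernel_left[OF _ _ a'])
    then show "e_cone (i + 1 + (a + 3)) (transfer (\<lambda>V x p q. melt_kernel a V x q p) (\<lambda>V x z. es (V - {z}) x i))"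
      by (simp add: algebra_simps)
  qed
qed

section \<open>The elementary functions of NCSym\<close>

text \<open>Keeps \<open>[1..<d + 1]\<close> and the numeral 1 in the form in which the definitions
  write words and index sets.\<close>

declare upt_Suc [simp del] One_nat_def [simp del]

abbreviation word :: "nat \<Rightarrow> (nat \<Rightarrow> nat) \<Rightarrow> nat list" where
  "word d t \<equiv> map t [1..<d + 1]"

lemma word_eq_iff:
  assumes "s \<in> extensional {1..d}" "t \<in> extensional {1..d}"
  shows "word d s = word d t \<longleftrightarrow> s = t"
proof
  assume "word d s = word d t"
  then have "s i = t i" if "i \<in> {1..d}" for i using that by (auto simp: map_eq_conv)
  then show "s = t" using assms by (auto intro: extensionalityI)
qed auto

lemma nc_sum_word:
  assumes "T \<subseteq> extensional {1..d}" "t \<in> extensional {1..d}"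
  shows "nc_sum d T (word d t) = of_bool (t \<in> T)"
proof -
  have "word d s = word d t \<longleftrightarrow> s = t" if "s \<in> T" for s
    using that assms by (intro word_eq_iff) auto
  then have "{s \<in> T. word d s = word d t} = (if t \<in> T then {t} else {})"
    by (auto simp del: map_eq_conv)
  then show ?thesis unfolding nc_sum_def by (simp del: upt_Suc)
qed

definition nc_homogeneous :: "nat \<Rightarrow> nc_series \<Rightarrow> bool" where
  "nc_homogeneous d F \<longleftrightarrow> (\<forall>w. F w \<noteq> 0 \<longrightarrow> (\<exists>t\<in>{1..d} \<rightarrow>\<^sub>E {1..}. w = word d t))"

lemma nc_homogeneous_eqI:
  assumes "nc_homogeneous d F" "nc_homogeneous d G"
    and "\<And>t. t \<in> {1..d} \<rightarrow>\<^sub>E {1..} \<Longrightarrow> F (word d t) = G (word d t)"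
  shows "F = G"
proof
  fix w
  show "F w = G w"
  proof (cases "\<exists>t\<in>{1..d} \<rightarrow>\<^sub>E {1..}. w = word d t")
    case True
    then show ?thesis using assms(3) by auto
  next
    case False
    then show ?thesis using assms(1,2) unfolding nc_homogeneous_def by metis
  qed
qed

lemma nc_homogeneous_nc_sum:
  assumes "T \<subseteq> {1..d} \<rightarrow>\<^sub>E {1..}"
  shows "nc_homogeneous d (nc_sum d T)"
  unfolding nc_homogeneous_def
proof (intro allI impI)
  fix w assume "nc_sum d T w \<noteq> 0"
  then have "{t \<in> T. word d t = w} \<noteq> {}" unfolding nc_sum_def by (metis card.empty of_nat_0)
  then show "\<exists>t\<in>{1..d} \<rightarrow>\<^sub>E {1..}. w = word d t" using assms by blast
qed

lemma sum_series_apply: "(\<Sum>i\<in>I. F i) w = (\<Sum>i\<in>I. (F i :: nc_series) w)"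
  by (induction I rule: infinite_finite_induct) auto

lemma nc_homogeneous_combination:
  assumes "\<And>i. i \<in> I \<Longrightarrow> nc_homogeneous d (F i)"
  shows "nc_homogeneous d (\<Sum>i\<in>I. nc_scale (c i) (F i))"
  unfolding nc_homogeneous_def
proof (intro allI impI)
  fix w assume "(\<Sum>i\<in>I. nc_scale (c i) (F i)) w \<noteq> 0"
  then obtain i where "i \<in> I" "nc_scale (c i) (F i) w \<noteq> 0"
    unfolding sum_series_apply by (meson sum.neutral)
  then show "\<exists>t\<in>{1..d} \<rightarrow>\<^sub>E {1..}. w = word d t"
    using assms unfolding nc_homogeneous_def nc_scale_def by auto
qed

abbreviation partitions :: "nat \<Rightarrow> nat set set set" where
  "partitions d \<equiv> {\<pi>. partition_on {1..d} \<pi>}"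

lemma finite_partitions: "finite (partitions d)"
  using finitely_many_partition_on[of "{1..d}"] by simp

lemma nc_e_word:
  assumes "partition_on {1..d} \<pi>" "t \<in> {1..d} \<rightarrow>\<^sub>E {1..}"
  shows "nc_e d \<pi> (word d t) = of_bool (\<forall>B\<in>\<pi>. inj_on t B)"
proof -
  have "(\<forall>j\<in>{1..d}. \<forall>k\<in>{1..d}. j \<noteq> k \<and> block \<pi> j = block \<pi> k \<longrightarrow> t j \<noteq> t k) \<longleftrightarrow>
      (\<forall>B\<in>\<pi>. inj_on t B)" (is "?L \<longleftrightarrow> ?R")
  proof
    assume L: ?L
    show ?R
    proof (intro ballI inj_onI)
      fix B j k assume "B \<in> \<pi>" "j \<in> B" "k \<in> B" "t j = t k"
      moreover from this have "j \<in> {1..d}" "k \<in> {1..d}" "block \<pi> j = block \<pi> k"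
        using assms(1) block_eq[OF assms(1)] unfolding partition_on_def by blast+
      ultimately show "j = k" using L by blast
    qed
  next
    assume R: ?R
    show ?L
      using R block_in[OF assms(1)] by (metis inj_on_eq_iff)
  qed
  moreover have "{t \<in> {1..d} \<rightarrow>\<^sub>E {1..}. P t} \<subseteq> extensional {1..d}" for P :: "(nat \<Rightarrow> nat) \<Rightarrow> bool"
    by (auto simp: PiE_def)
  moreover have "t \<in> extensional {1..d}" using assms(2) by (auto simp: PiE_def)
  ultimately show ?thesis
    unfolding nc_e_def using assms(2) by (subst nc_sum_word) auto
qed

lemma nc_homogeneous_nc_e: "nc_homogeneous d (nc_e d \<pi>)"
  unfolding nc_e_def by (rule nc_homogeneous_nc_sum) auto

text \<open>The word in which only the positions \<open>j\<close> and \<open>k\<close> carry equal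
  letters has coefficient 0 exactly when \<open>j\<close> and \<open>k\<close> share a block. The
  series therefore determines the relation of lying in one block, and with it the partition.\<close>

lemma inj_on_nc_e: "inj_on (nc_e d) (partitions d)"
proof -
  have sub: "\<pi> \<subseteq> \<sigma>" if \<pi>: "partition_on {1..d} \<pi>" and \<sigma>: "partition_on {1..d} \<sigma>"
    and eq: "nc_e d \<pi> = nc_e d \<sigma>" for \<pi> \<sigma>
  proof
    have same: "(\<exists>B\<in>\<rho>. j \<in> B \<and> k \<in> B) \<longleftrightarrow>
        nc_e d \<rho> (word d (\<lambda>i\<in>{1..d}. if i = k then j else i)) = 0"
      if "partition_on {1..d} \<rho>" "j \<in> {1..d}" "k \<in> {1..d}" "j \<noteq> k" for \<rho> j k
    proof -
      let ?t = "\<lambda>i\<in>{1..d}. if i = k then j else i"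
      have "inj_on ?t B \<longleftrightarrow> \<not> (j \<in> B \<and> k \<in> B)" if "B \<subseteq> {1..d}" for B
        using that \<open>j \<in> _\<close> \<open>k \<in> _\<close> \<open>j \<noteq> k\<close> by (auto simp: inj_on_def subset_iff split: if_splits)
      moreover have "B \<subseteq> {1..d}" if "B \<in> \<rho>" for B
        using that \<open>partition_on {1..d} \<rho>\<close> unfolding partition_on_def by blast
      ultimately show ?thesis
        using that by (subst nc_e_word) auto
    qed
    fix B assume B: "B \<in> \<pi>"
    then obtain i where i: "i \<in> B" "B \<subseteq> {1..d}" using \<pi> unfolding partition_on_def by fastforce
    then have i': "i \<in> {1..d}" by auto
    have transfer: "(\<exists>C\<in>\<pi>. i \<in> C \<and> j \<in> C) \<longleftrightarrow> (\<exists>C\<in>\<sigma>. i \<in> C \<and> j \<in> C)"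
      if "j \<in> {1..d}" "j \<noteq> i" for j
      unfolding same[OF \<pi> i' that(1) that(2)[symmetric]] same[OF \<sigma> i' that(1) that(2)[symmetric]] eq ..
    have "B = block \<sigma> i"
    proof (intro equalityI subsetI)
      fix j assume j: "j \<in> B"
      then have j': "j \<in> {1..d}" using i by auto
      show "j \<in> block \<sigma> i"
      proof (cases "j = i")
        case True
        then show ?thesis using block_in[OF \<sigma> i'] by simp
      next
        case False
        then have "\<exists>C\<in>\<sigma>. i \<in> C \<and> j \<in> C"
          using transfer[OF j'] j i(1) B by blast
        then show ?thesis using block_eq[OF \<sigma>] by auto
      qed
    next
      fix j assume j: "j \<in> block \<sigma> i"
      then have j': "j \<in> {1..d}" using block_in[OF \<sigma> i'] \<sigma> unfolding partition_on_def by blast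
      show "j \<in> B"
      proof (cases "j = i")
        case True
        then show ?thesis using i by simp
      next
        case False
        then have "\<exists>C\<in>\<pi>. i \<in> C \<and> j \<in> C"
          using transfer[OF j'] j block_in[OF \<sigma> i'] by blast
        then obtain C where "C \<in> \<pi>" "i \<in> C" "j \<in> C" by blast
        then show ?thesis using block_eq[OF \<pi>, of C i] block_eq[OF \<pi> B i(1)] by simp
      qed
    qed
    then show "B \<in> \<sigma>" using block_in[OF \<sigma> i'] by simp
  qed
  show ?thesis by (intro inj_onI equalityI) (simp_all add: sub)
qed

abbreviation e_set :: "nat \<Rightarrow> nc_series set" where
  "e_set d \<equiv> nc_e d ` partitions d"

lemma sum_e_set:
  "(\<Sum>v\<in>e_set d. nc_scale (c v) v) = (\<Sum>\<pi>\<in>partitions d. nc_scale (c (nc_e d \<pi>)) (nc_e d \<pi>))"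
  using inj_on_nc_e by (simp add: sum.reindex)

text \<open>Adding the singleton block \<open>{Suc d}\<close> to every set partition turns a linear dependence in degree
  \<open>d\<close> into one in degree \<open>Suc d\<close>.\<close>

lemma independent_e_set_Suc:
  assumes "nc.independent (e_set (Suc d))"
  shows "nc.independent (e_set d)"
proof (rule nc.independent_if_scalars_zero)
  show "finite (e_set d)" using finite_partitions by blast
  fix u F assume u: "(\<Sum>v\<in>e_set d. nc_scale (u v) v) = 0" and "F \<in> e_set d"
  then obtain \<pi>0 where \<pi>0: "\<pi>0 \<in> partitions d" "F = nc_e d \<pi>0" by auto
  define ext where "ext \<pi> = insert {Suc d} \<pi>" for \<pi> :: "nat set set"
  have ext: "ext \<pi> \<in> partitions (Suc d)" "{Suc d} \<notin> \<pi>" if "\<pi> \<in> partitions d" for \<pi>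
  proof -
    have "{1..Suc d} = insert (Suc d) {1..d}" by auto
    then show "ext \<pi> \<in> partitions (Suc d)"
      using that unfolding ext_def mem_Collect_eq
      by (subst partition_on_insert) (auto simp: partition_on_def disjnt_def)
    show "{Suc d} \<notin> \<pi>"
    proof
      assume "{Suc d} \<in> \<pi>"
      moreover have "\<Union>\<pi> = {1..d}" using that by (simp add: partition_on_def)
      ultimately have "Suc d \<in> {1..d}" by blast
      then show False by simp
    qed
  qed
  have inj: "inj_on ext (partitions d)"
    using ext(2) by (intro inj_onI) (metis Diff_insert_absorb ext_def)
  \<comment> \<open>A singleton block imposes no condition, so the last letter does not influence
    the coefficient.\<close>
  have ev: "nc_e (Suc d) (ext \<pi>) (word (Suc d) t) = nc_e d \<pi> (word d (restrict t {1..d}))"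
    if "\<pi> \<in> partitions d" "t \<in> {1..Suc d} \<rightarrow>\<^sub>E {1..}" for \<pi> t
  proof -
    have "restrict t {1..d} \<in> {1..d} \<rightarrow>\<^sub>E {1..}" using that(2) by (auto simp: PiE_iff)
    moreover have "inj_on (restrict t {1..d}) B \<longleftrightarrow> inj_on t B" if "B \<in> \<pi>" for B
    proof -
      have "B \<subseteq> {1..d}" using that \<open>\<pi> \<in> partitions d\<close> by (auto simp: partition_on_def)
      then show ?thesis by (intro inj_on_cong) auto
    qed
    ultimately show ?thesis
      using that ext(1)[OF that(1)] nc_e_word[of "Suc d" "ext \<pi>" t]
        nc_e_word[of d \<pi> "restrict t {1..d}"]
      by (auto simp: ext_def)
  qed
  \<comment> \<open>Dropping the block \<open>{Suc d}\<close> recovers the original partition, whose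
    scalar is reused; only the values on the extended partitions matter.\<close>
  define c where "c v = u (nc_e d (inv_into (partitions (Suc d)) (nc_e (Suc d)) v - {{Suc d}}))" for v
  have c: "c (nc_e (Suc d) (ext \<pi>)) = u (nc_e d \<pi>)" if "\<pi> \<in> partitions d" for \<pi>
    using ext[OF that] inj_on_nc_e[of "Suc d"] by (simp add: c_def inv_into_f_f ext_def)
  have inj': "inj_on (\<lambda>\<pi>. nc_e (Suc d) (ext \<pi>)) (partitions d)"
    using comp_inj_on[OF inj inj_on_subset[OF inj_on_nc_e]] ext(1) by (auto simp: o_def)
  have "(\<Sum>v\<in>(\<lambda>\<pi>. nc_e (Suc d) (ext \<pi>)) ` partitions d. nc_scale (c v) v) =
      (\<Sum>\<pi>\<in>partitions d. nc_scale (u (nc_e d \<pi>)) (nc_e (Suc d) (ext \<pi>)))"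
    by (simp add: sum.reindex[OF inj'] c)
  also have "\<dots> = 0"
  proof (rule nc_homogeneous_eqI)
    fix t :: "nat \<Rightarrow> nat" assume t: "t \<in> {1..Suc d} \<rightarrow>\<^sub>E {1..}"
    have "(\<Sum>\<pi>\<in>partitions d. nc_scale (u (nc_e d \<pi>)) (nc_e (Suc d) (ext \<pi>))) (word (Suc d) t) =
      (\<Sum>v\<in>e_set d. nc_scale (u v) v) (word d (restrict t {1..d}))"
      unfolding sum_e_set[of u d] unfolding sum_series_apply nc_scale_def using ev[OF _ t] by simp
    then show "(\<Sum>\<pi>\<in>partitions d. nc_scale (u (nc_e d \<pi>)) (nc_e (Suc d) (ext \<pi>))) (word (Suc d) t) =
        0 (word (Suc d) t)"
      unfolding u by simp
  qed (auto intro: nc_homogeneous_combination nc_homogeneous_nc_e simp: nc_homogeneous_def[of _ 0])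
  finally have "c (nc_e (Suc d) (ext \<pi>0)) = 0"
    using \<pi>0 ext(1) finite_partitions
    by (intro nc.independentD[OF assms, where t = "(\<lambda>\<pi>. nc_e (Suc d) (ext \<pi>)) ` partitions d"]) auto
  then show "u F = 0" using c \<pi>0 by simp
qed

lemma independent_e_set_mono:
  assumes "n \<le> d" "nc.independent (e_set d)"
  shows "nc.independent (e_set n)"
proof -
  have "nc.independent (e_set d) \<longrightarrow> nc.independent (e_set n)"
    using assms(1)
    by (induction rule: dec_induct) (use independent_e_set_Suc in blast)+
  then show ?thesis using assms(2) by blast
qed

section \<open>Symmetric series and the span of the e_pi\<close>

definition kernel_blocks :: "nat \<Rightarrow> (nat \<Rightarrow> nat) \<Rightarrow> nat set set" where
  "kernel_blocks d t = (\<lambda>i. {j \<in> {1..d}. t j = t i}) ` {1..d}"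

text \<open>Invariance under permutations of the variables, expressed by equality patterns: a
  permutation of the variables carries one word to another exactly when equal letters occur at the
  same positions.\<close>

definition symmetric_series :: "nat \<Rightarrow> nc_series \<Rightarrow> bool" where
  "symmetric_series d F \<longleftrightarrow> nc_homogeneous d F \<and>
     (\<forall>s\<in>{1..d} \<rightarrow>\<^sub>E {1..}. \<forall>t\<in>{1..d} \<rightarrow>\<^sub>E {1..}.
        (\<forall>j\<in>{1..d}. \<forall>k\<in>{1..d}. s j = s k \<longleftrightarrow> t j = t k) \<longrightarrow> F (word d s) = F (word d t))"

lemma symmetric_seriesD:
  assumes "symmetric_series d F" "s \<in> {1..d} \<rightarrow>\<^sub>E {1..}" "t \<in> {1..d} \<rightarrow>\<^sub>E {1..}"
    and "\<And>j k. j \<in> {1..d} \<Longrightarrow> k \<in> {1..d} \<Longrightarrow> s j = s k \<longleftrightarrow> t j = t k"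
  shows "F (word d s) = F (word d t)"
proof -
  have "\<forall>s\<in>{1..d} \<rightarrow>\<^sub>E {1..}. \<forall>t\<in>{1..d} \<rightarrow>\<^sub>E {1..}.
      (\<forall>j\<in>{1..d}. \<forall>k\<in>{1..d}. s j = s k \<longleftrightarrow> t j = t k) \<longrightarrow> F (word d s) = F (word d t)"
    using assms(1) unfolding symmetric_series_def by (rule conjunct2)
  from mp[OF bspec[OF bspec[OF this assms(2)] assms(3)]] show ?thesis
    using assms(4) by blast
qed

lemma kernel_blocks_partition: "kernel_blocks d t \<in> partitions d"
  by (auto simp: kernel_blocks_def partition_on_def disjoint_def)

lemma kernel_blocks_eqD:
  assumes "kernel_blocks d s = kernel_blocks d t" "j \<in> {1..d}" "k \<in> {1..d}"
  shows "s j = s k \<longleftrightarrow> t j = t k"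
proof -
  have "s j = s k \<longleftrightarrow> (\<exists>B\<in>kernel_blocks d s. j \<in> B \<and> k \<in> B)" for s
    using assms(2,3) by (auto simp: kernel_blocks_def)
  then show ?thesis using assms(1) by simp
qed

text \<open>The element of the monomial basis of NCSym that belongs to \<sigma>.\<close>

definition nc_m :: "nat \<Rightarrow> nat set set \<Rightarrow> nc_series" where
  "nc_m d \<sigma> = nc_sum d {t \<in> {1..d} \<rightarrow>\<^sub>E {1..}. kernel_blocks d t = \<sigma>}"

lemma symmetric_series_in_span_nc_m:
  assumes "symmetric_series d F"
  shows "F \<in> nc.span (nc_m d ` partitions d)"
proof -
  \<comment> \<open>Any tuple with the pattern \<sigma> may represent it, since symmetry gives all
    of them the same coefficient.\<close>
  define c where "c \<sigma> = F (word d (SOME t. t \<in> {1..d} \<rightarrow>\<^sub>E {1..} \<and> kernel_blocks d t = \<sigma>))" for \<sigma>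
  have "F = (\<Sum>\<sigma>\<in>partitions d. nc_scale (c \<sigma>) (nc_m d \<sigma>))"
  proof (rule nc_homogeneous_eqI)
    fix t :: "nat \<Rightarrow> nat" assume t: "t \<in> {1..d} \<rightarrow>\<^sub>E {1..}"
    define s where "s = (SOME s. s \<in> {1..d} \<rightarrow>\<^sub>E {1..} \<and> kernel_blocks d s = kernel_blocks d t)"
    have s: "s \<in> {1..d} \<rightarrow>\<^sub>E {1..} \<and> kernel_blocks d s = kernel_blocks d t"
      using someI[of "\<lambda>s. s \<in> {1..d} \<rightarrow>\<^sub>E {1..} \<and> kernel_blocks d s = kernel_blocks d t" t] t
      unfolding s_def by blast
    have te: "t \<in> extensional {1..d}" using t by (auto simp: PiE_def)
    have m: "nc_m d \<sigma> (word d t) = of_bool (kernel_blocks d t = \<sigma>)" for \<sigma>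
      unfolding nc_m_def using t te by (subst nc_sum_word) (auto simp: PiE_def)
    have "(\<Sum>\<sigma>\<in>partitions d. nc_scale (c \<sigma>) (nc_m d \<sigma>)) (word d t) =
        (\<Sum>\<sigma>\<in>partitions d. if \<sigma> = kernel_blocks d t then c (kernel_blocks d t) else 0)"
      unfolding sum_series_apply nc_scale_def m by (intro sum.cong) auto
    also have "\<dots> = c (kernel_blocks d t)"
      using kernel_blocks_partition finite_partitions by simp
    also have "\<dots> = F (word d s)" by (simp add: c_def s_def)
    also have "\<dots> = F (word d t)"
      using s t by (intro symmetric_seriesD[OF assms] kernel_blocks_eqD) auto
    finally show "F (word d t) = (\<Sum>\<sigma>\<in>partitions d. nc_scale (c \<sigma>) (nc_m d \<sigma>)) (word d t)" by simp
  qed (use assms in \<open>auto simp: symmetric_series_def nc_m_def intro!: nc_homogeneous_combination nc_homogeneous_nc_sum\<close>)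
  also have "\<dots> \<in> nc.span (nc_m d ` partitions d)"
    by (intro nc.span_sum nc.span_scale nc.span_base) auto
  finally show ?thesis .
qed

lemma symmetric_series_nc_e:
  assumes "\<pi> \<in> partitions d"
  shows "symmetric_series d (nc_e d \<pi>)"
  unfolding symmetric_series_def
proof (intro conjI ballI impI)
  fix s t :: "nat \<Rightarrow> nat"
  assume st: "s \<in> {1..d} \<rightarrow>\<^sub>E {1..}" "t \<in> {1..d} \<rightarrow>\<^sub>E {1..}"
    and eq: "\<forall>j\<in>{1..d}. \<forall>k\<in>{1..d}. (s j = s k) = (t j = t k)"
  have "inj_on s B \<longleftrightarrow> inj_on t B" if "B \<in> \<pi>" for B
  proof -
    have "B \<subseteq> {1..d}" using that assms by (auto simp: partition_on_def)
    then show ?thesis using eq by (auto simp: inj_on_def subset_iff)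
  qed
  then show "nc_e d \<pi> (word d s) = nc_e d \<pi> (word d t)"
    using assms st by (simp add: nc_e_word)
qed (rule nc_homogeneous_nc_e)

text \<open>Both families are indexed by the set partitions, so once the \<open>e\<^sub>\<pi>\<close> are independent they span
  by exchange.\<close>

lemma symmetric_series_in_span:
  assumes "nc.independent (e_set d)" "symmetric_series d F"
  shows "F \<in> nc.span (e_set d)"
proof -
  let ?M = "nc_m d ` partitions d"
  have "e_set d \<subseteq> nc.span ?M"
    using symmetric_series_nc_e symmetric_series_in_span_nc_m by auto
  moreover have finM: "finite ?M" using finite_partitions by simp
  ultimately have "?M \<subseteq> nc.span (e_set d)"
  proof -
    assume sub: "e_set d \<subseteq> nc.span ?M"
    show ?thesis
    proof
      fix v assume v: "v \<in> ?M"
      show "v \<in> nc.span (e_set d)"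
      proof (rule ccontr)
        assume nv: "v \<notin> nc.span (e_set d)"
        have ind: "nc.independent (insert v (e_set d))"
          by (rule nc.independent_insertI[OF nv assms(1)])
        have "insert v (e_set d) \<subseteq> nc.span ?M" using sub nc.span_base[OF v] by simp
        then have "card (insert v (e_set d)) \<le> card ?M"
          using nc.independent_span_bound[OF finM ind] by simp
        also have "\<dots> \<le> card (partitions d)" using finite_partitions card_image_le by blast
        also have "\<dots> = card (e_set d)" using inj_on_nc_e by (simp add: card_image)
        finally show False
          using nv nc.span_base[of v "e_set d"] finite_partitions
          by (auto simp: card_insert_if split: if_splits)
      qed
    qed
  qed
  then have "nc.span ?M \<subseteq> nc.span (e_set d)" by (simp add: nc.span_minimal)
  then show ?thesis using symmetric_series_in_span_nc_m[OF assms(2)] by blast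
qed

section \<open>Evaluation at commuting variables\<close>

lemma sum_PiE_insert:
  assumes "a \<notin> A"
  shows "(\<Sum>f\<in>insert a A \<rightarrow>\<^sub>E V. h f) = (\<Sum>c\<in>V. \<Sum>g\<in>A \<rightarrow>\<^sub>E V. h (g(a := c)))"
  unfolding sum.cartesian_product
proof (rule sum.reindex_bij_witness[of _ "\<lambda>(c, g). g(a := c)" "\<lambda>f. (f a, f(a := undefined))"])
  fix f assume "f \<in> insert a A \<rightarrow>\<^sub>E V"
  then show "(f a, f(a := undefined)) \<in> V \<times> (A \<rightarrow>\<^sub>E V)"
    using assms by (auto simp: PiE_iff extensional_def)
next
  fix p assume "p \<in> V \<times> (A \<rightarrow>\<^sub>E V)"
  then show "(\<lambda>(c, g). g(a := c)) p \<in> insert a A \<rightarrow>\<^sub>E V"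
    and "(\<lambda>f. (f a, f(a := undefined))) ((\<lambda>(c, g). g(a := c)) p) = p"
    using assms by (auto simp: PiE_iff extensional_def fun_eq_iff)
qed auto

lemma sum_PiE_Un:
  assumes "A \<inter> B = {}"
  shows "(\<Sum>f\<in>(A \<union> B) \<rightarrow>\<^sub>E V. p (restrict f A) * q (restrict f B)) =
    (\<Sum>f\<in>A \<rightarrow>\<^sub>E V. p f) * (\<Sum>g\<in>B \<rightarrow>\<^sub>E V. (q g :: 'b::comm_semiring_0))"
  unfolding sum_product sum.cartesian_product
proof (rule sum.reindex_bij_witness[of _ "\<lambda>(f, g) i. if i \<in> A then f i else g i"
      "\<lambda>f. (restrict f A, restrict f B)"])
  fix f assume "f \<in> (A \<union> B) \<rightarrow>\<^sub>E V"
  then show "(\<lambda>(f, g) i. if i \<in> A then f i else g i) (restrict f A, restrict f B) = f"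
    by (auto simp: PiE_iff extensional_def fun_eq_iff)
next
  fix r assume "r \<in> (A \<rightarrow>\<^sub>E V) \<times> (B \<rightarrow>\<^sub>E V)"
  then show "(\<lambda>f. (restrict f A, restrict f B)) ((\<lambda>(f, g) i. if i \<in> A then f i else g i) r) = r"
    and "(\<lambda>(f, g) i. if i \<in> A then f i else g i) r \<in> (A \<union> B) \<rightarrow>\<^sub>E V"
    using assms by (auto simp: PiE_iff extensional_def fun_eq_iff)
qed auto

lemma sum_inj_PiE_fixed:
  fixes x :: "'a \<Rightarrow> 'b::comm_ring_1"
  assumes "finite A" "finite V" "a \<notin> A"
  shows "(\<Sum>g\<in>A \<rightarrow>\<^sub>E V. of_bool (inj_on (g(a := c)) (insert a A)) * (\<Prod>i\<in>insert a A. x ((g(a := c)) i))) =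
    x c * (\<Sum>g\<in>A \<rightarrow>\<^sub>E (V - {c}). of_bool (inj_on g A) * (\<Prod>i\<in>A. x (g i)))"
proof -
  have "(\<Sum>g\<in>A \<rightarrow>\<^sub>E V. of_bool (inj_on (g(a := c)) (insert a A)) * (\<Prod>i\<in>insert a A. x ((g(a := c)) i))) =
      (\<Sum>g\<in>A \<rightarrow>\<^sub>E (V - {c}). x c * (of_bool (inj_on g A) * (\<Prod>i\<in>A. x (g i))))"
  proof (rule sum.mono_neutral_cong_right)
    show "finite (A \<rightarrow>\<^sub>E V)" using assms by (intro finite_PiE) auto
    show "A \<rightarrow>\<^sub>E V - {c} \<subseteq> A \<rightarrow>\<^sub>E V" by (intro PiE_mono) auto
    show "\<forall>g\<in>(A \<rightarrow>\<^sub>E V) - (A \<rightarrow>\<^sub>E V - {c}). of_bool (inj_on (g(a := c)) (insert a A)) *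
        (\<Prod>i\<in>insert a A. x ((g(a := c)) i)) = 0"
    proof
      fix g assume g: "g \<in> (A \<rightarrow>\<^sub>E V) - (A \<rightarrow>\<^sub>E V - {c})"
      then obtain i where "i \<in> A" "g i = c" by (auto simp: PiE_iff)
      then have "\<not> inj_on (g(a := c)) (insert a A)"
        using assms(3) by (auto simp: inj_on_def)
      then show "of_bool (inj_on (g(a := c)) (insert a A)) * (\<Prod>i\<in>insert a A. x ((g(a := c)) i)) = 0"
        by (simp only: of_bool_eq mult_zero_left)
    qed
    fix g assume g: "g \<in> A \<rightarrow>\<^sub>E V - {c}"
    then have "c \<notin> g ` A" by (auto simp: PiE_iff)
    then have "inj_on (g(a := c)) (insert a A) \<longleftrightarrow> inj_on g A"
      using assms(3) by (auto simp: inj_on_def)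
    moreover have "(\<Prod>i\<in>A. x ((g(a := c)) i)) = (\<Prod>i\<in>A. x (g i))"
      using assms(3) by (intro prod.cong) auto
    ultimately show "of_bool (inj_on (g(a := c)) (insert a A)) * (\<Prod>i\<in>insert a A. x ((g(a := c)) i)) =
        x c * (of_bool (inj_on g A) * (\<Prod>i\<in>A. x (g i)))"
      using assms by (simp add: mult.left_commute del: fun_upd_apply) simp
  qed
  then show ?thesis by (simp only: sum_distrib_left)
qed

lemma sum_inj_PiE:
  fixes x :: "'a \<Rightarrow> 'b::{comm_ring_1,ring_char_0}"
  assumes "finite A" "finite V"
  shows "(\<Sum>f\<in>A \<rightarrow>\<^sub>E V. of_bool (inj_on f A) * (\<Prod>i\<in>A. x (f i))) = fact (card A) * es V x (card A)"
  using assms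
proof (induction A arbitrary: V rule: finite_induct)
  case (insert a A)
  have "(\<Sum>f\<in>insert a A \<rightarrow>\<^sub>E V. of_bool (inj_on f (insert a A)) * (\<Prod>i\<in>insert a A. x (f i))) =
      (\<Sum>c\<in>V. \<Sum>g\<in>A \<rightarrow>\<^sub>E V. of_bool (inj_on (g(a := c)) (insert a A)) * (\<Prod>i\<in>insert a A. x ((g(a := c)) i)))"
    by (rule sum_PiE_insert[OF insert.hyps(2)])
  also have "\<dots> = (\<Sum>c\<in>V. x c * (fact (card A) * es (V - {c}) x (card A)))"
    by (simp only: sum_inj_PiE_fixed[OF insert.hyps(1) insert.prems insert.hyps(2)]
        insert.IH[OF finite_Diff[OF insert.prems]])
  also have "\<dots> = fact (card A) * (\<Sum>c\<in>V. x c * es (V - {c}) x (card A))"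
    by (simp add: sum_distrib_left mult_ac)
  also have "\<dots> = fact (card (insert a A)) * es V x (card (insert a A))"
    using insert by (simp add: sum_es_remove algebra_simps)
  finally show ?case .
qed simp

text \<open>An injective \<open>f\<close> takes the value \<open>v\<close> at most once, so the maps
  hitting \<open>v\<close> on \<open>J\<close> split according to the position in \<open>J\<close>,
  and each position contributes the same sum. The result is affine in \<open>card J\<close>; this is
  the source of the affine dependence on k.\<close>

lemma sum_inj_PiE_avoiding:
  fixes x :: "'a \<Rightarrow> 'b::{comm_ring_1,ring_char_0}"
  assumes "finite I" "finite V" "J \<subseteq> I"
  shows "(\<Sum>f\<in>I \<rightarrow>\<^sub>E V. of_bool (inj_on f I \<and> v \<notin> f ` J) * (\<Prod>i\<in>I. x (f i))) =
    fact (card I) * es V x (card I) -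
    of_nat (card J) * (of_bool (v \<in> V) * (x v * (fact (card I - 1) * es (V - {v}) x (card I - 1))))"
proof -
  have finJ: "finite J" using assms finite_subset by blast
  have ob: "of_bool (inj_on f I \<and> v \<notin> f ` J) =
      of_bool (inj_on f I) - (\<Sum>j\<in>J. of_bool (inj_on f I \<and> f j = v) :: 'b)" for f :: "'c \<Rightarrow> 'a"
  proof (cases "inj_on f I \<and> v \<in> f ` J")
    case True
    then obtain j where j: "j \<in> J" "f j = v" by auto
    have "(\<Sum>i\<in>J. of_bool (inj_on f I \<and> f i = v) :: 'b) = (\<Sum>i\<in>J. if i = j then 1 else 0)"
      using True j assms(3) by (intro sum.cong refl) (auto dest: inj_onD)
    then show ?thesis using True finJ j(1) by simp
  next
    case False
    then have "(\<Sum>i\<in>J. of_bool (inj_on f I \<and> f i = v) :: 'b) = 0" by (intro sum.neutral) auto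
    then show ?thesis using False by auto
  qed
  have fixed: "(\<Sum>f\<in>I \<rightarrow>\<^sub>E V. of_bool (inj_on f I \<and> f j = v) * (\<Prod>i\<in>I. x (f i))) =
      of_bool (v \<in> V) * (x v * (fact (card I - 1) * es (V - {v}) x (card I - 1)))" if "j \<in> J" for j
  proof -
    define A where "A = I - {j}"
    have A: "I = insert j A" "j \<notin> A" "finite A" "card A = card I - 1"
      using that assms by (auto simp: A_def)
    have "(\<Sum>f\<in>I \<rightarrow>\<^sub>E V. of_bool (inj_on f I \<and> f j = v) * (\<Prod>i\<in>I. x (f i))) =
      (\<Sum>c\<in>V. \<Sum>g\<in>A \<rightarrow>\<^sub>E V. of_bool (inj_on (g(j := c)) (insert j A) \<and> (g(j := c)) j = v) *
        (\<Prod>i\<in>insert j A. x ((g(j := c)) i)))"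
      unfolding A(1) by (rule sum_PiE_insert[OF A(2)])
    also have "\<dots> = (\<Sum>c\<in>V. if c = v then \<Sum>g\<in>A \<rightarrow>\<^sub>E V. of_bool (inj_on (g(j := v)) (insert j A)) *
        (\<Prod>i\<in>insert j A. x ((g(j := v)) i)) else 0)"
    proof (intro sum.cong refl)
      fix c
      show "(\<Sum>g\<in>A \<rightarrow>\<^sub>E V. of_bool (inj_on (g(j := c)) (insert j A) \<and> (g(j := c)) j = v) *
          (\<Prod>i\<in>insert j A. x ((g(j := c)) i))) =
        (if c = v then \<Sum>g\<in>A \<rightarrow>\<^sub>E V. of_bool (inj_on (g(j := v)) (insert j A)) *
          (\<Prod>i\<in>insert j A. x ((g(j := v)) i)) else 0)"
        by (cases "c = v") (simp_all only: fun_upd_same simp_thms if_True if_False of_bool_eq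
            mult_zero_left sum.neutral_const)
    qed
    also have "\<dots> = of_bool (v \<in> V) * (x v * (fact (card A) * es (V - {v}) x (card A)))"
      using assms(2) unfolding sum_inj_PiE_fixed[OF A(3) assms(2) A(2)]
        sum_inj_PiE[OF A(3) finite_Diff[OF assms(2)]] by simp
    finally show ?thesis by (simp only: A(4))
  qed
  have "(\<Sum>f\<in>I \<rightarrow>\<^sub>E V. of_bool (inj_on f I \<and> v \<notin> f ` J) * (\<Prod>i\<in>I. x (f i))) =
     (\<Sum>f\<in>I \<rightarrow>\<^sub>E V. of_bool (inj_on f I) * (\<Prod>i\<in>I. x (f i)) -
       (\<Sum>j\<in>J. of_bool (inj_on f I \<and> f j = v) * (\<Prod>i\<in>I. x (f i))))"
    unfolding ob by (simp only: left_diff_distrib sum_distrib_right)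
  also have "\<dots> = (\<Sum>f\<in>I \<rightarrow>\<^sub>E V. of_bool (inj_on f I) * (\<Prod>i\<in>I. x (f i))) -
      (\<Sum>j\<in>J. \<Sum>f\<in>I \<rightarrow>\<^sub>E V. of_bool (inj_on f I \<and> f j = v) * (\<Prod>i\<in>I. x (f i)))"
    unfolding sum_subtractf by (subst (2) sum.swap) (rule refl)
  also have "\<dots> = fact (card I) * es V x (card I) -
      (\<Sum>j\<in>J. of_bool (v \<in> V) * (x v * (fact (card I - 1) * es (V - {v}) x (card I - 1))))"
    unfolding sum_inj_PiE[OF assms(1,2)] using fixed by (intro arg_cong2[where f = "(-)"] sum.cong refl) auto
  finally show ?thesis by simp
qed

lemma sum_partition_PiE:
  fixes x :: "'a \<Rightarrow> 'b::{comm_ring_1,ring_char_0}"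
  assumes "finite \<tau>" "partition_on A \<tau>" "finite A" "finite V"
  shows "(\<Sum>f\<in>A \<rightarrow>\<^sub>E V. of_bool (\<forall>B\<in>\<tau>. inj_on f B) * (\<Prod>i\<in>A. x (f i))) =
    (\<Prod>B\<in>\<tau>. fact (card B) * es V x (card B))"
  using assms(1-3)
proof (induction \<tau> arbitrary: A rule: finite_induct)
  case empty
  then show ?case by (simp add: partition_on_def)
next
  case (insert C \<tau>)
  have A: "A = C \<union> (A - C)" "C \<inter> (A - C) = {}" and fin: "finite C" "finite (A - C)"
    using insert.prems by (auto simp: partition_on_def finite_subset)
  have part: "partition_on (A - C) \<tau>"
    using partition_on_Diff_block[OF insert.prems(1), of C] insert.hyps(2) by simp
  have sub: "B \<subseteq> A - C" if "B \<in> \<tau>" for B using part that by (auto simp: partition_on_def)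
  have "(\<Sum>f\<in>A \<rightarrow>\<^sub>E V. of_bool (\<forall>B\<in>insert C \<tau>. inj_on f B) * (\<Prod>i\<in>A. x (f i))) =
     (\<Sum>f\<in>(C \<union> (A - C)) \<rightarrow>\<^sub>E V. (of_bool (inj_on (restrict f C) C) * (\<Prod>i\<in>C. x (restrict f C i))) *
       (of_bool (\<forall>B\<in>\<tau>. inj_on (restrict f (A - C)) B) * (\<Prod>i\<in>A - C. x (restrict f (A - C) i))))"
  proof (rule sum.cong)
    fix f
    have "(\<Prod>i\<in>A. x (f i)) = (\<Prod>i\<in>C. x (f i)) * (\<Prod>i\<in>A - C. x (f i))"
      using prod.union_disjoint[OF fin A(2), of "\<lambda>i. x (f i)"] A(1) by simp
    moreover have "inj_on (restrict f (A - C)) B \<longleftrightarrow> inj_on f B" if "B \<in> \<tau>" for B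
      using sub[OF that] by (intro inj_on_cong) auto
    moreover have "inj_on (restrict f C) C \<longleftrightarrow> inj_on f C" by (intro inj_on_cong) auto
    ultimately show "of_bool (\<forall>B\<in>insert C \<tau>. inj_on f B) * (\<Prod>i\<in>A. x (f i)) =
      (of_bool (inj_on (restrict f C) C) * (\<Prod>i\<in>C. x (restrict f C i))) *
       (of_bool (\<forall>B\<in>\<tau>. inj_on (restrict f (A - C)) B) * (\<Prod>i\<in>A - C. x (restrict f (A - C) i)))"
      by (simp add: of_bool_conj mult_ac)
  qed (use A(1) in auto)
  also have "\<dots> = (fact (card C) * es V x (card C)) * (\<Prod>B\<in>\<tau>. fact (card B) * es V x (card B))"
    unfolding sum_PiE_Un[OF A(2), of "\<lambda>f. of_bool (inj_on f C) * (\<Prod>i\<in>C. x (f i))"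
        "\<lambda>f. of_bool (\<forall>B\<in>\<tau>. inj_on f B) * (\<Prod>i\<in>A - C. x (f i))" V]
    by (simp only: sum_inj_PiE[OF fin(1) assms(4)] insert.IH[OF part fin(2)])
  finally show ?case using insert.hyps by simp
qed

definition phi :: "nat \<Rightarrow> nc_series \<Rightarrow> pointed" where
  "phi d F V x z = (\<Sum>\<kappa> | \<kappa> \<in> {1..d} \<rightarrow>\<^sub>E V \<and> \<kappa> d = z. F (word d \<kappa>) * (\<Prod>i\<in>{1..<d}. x (\<kappa> i)))"

lemma phi_combination:
  "phi d (\<Sum>i\<in>I. nc_scale (c i) (F i)) V x z = (\<Sum>i\<in>I. c i * phi d (F i) V x z)"
proof -
  have "phi d (\<Sum>i\<in>I. nc_scale (c i) (F i)) V x z =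
    (\<Sum>\<kappa> | \<kappa> \<in> {1..d} \<rightarrow>\<^sub>E V \<and> \<kappa> d = z. \<Sum>i\<in>I. c i * (F i (word d \<kappa>) * (\<Prod>i\<in>{1..<d}. x (\<kappa> i))))"
    by (simp add: phi_def sum_series_apply nc_scale_def sum_distrib_right mult.assoc)
  also have "\<dots> = (\<Sum>i\<in>I. \<Sum>\<kappa> | \<kappa> \<in> {1..d} \<rightarrow>\<^sub>E V \<and> \<kappa> d = z. c i * (F i (word d \<kappa>) * (\<Prod>i\<in>{1..<d}. x (\<kappa> i))))"
    by (rule sum.swap)
  finally show ?thesis by (simp add: phi_def sum_distrib_left)
qed

lemma sum_PiE_last:
  fixes d :: nat
  assumes "1 \<le> d" "z \<in> V"
  shows "(\<Sum>\<kappa> | \<kappa> \<in> {1..d} \<rightarrow>\<^sub>E V \<and> \<kappa> d = z. h \<kappa>) = (\<Sum>g\<in>{1..<d} \<rightarrow>\<^sub>E V. h (g(d := z)))"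
proof (rule sum.reindex_bij_witness[of _ "\<lambda>g. g(d := z)" "\<lambda>\<kappa>. \<kappa>(d := undefined)"])
  fix \<kappa> assume "\<kappa> \<in> {\<kappa> \<in> {1..d} \<rightarrow>\<^sub>E V. \<kappa> d = z}"
  then show "\<kappa>(d := undefined) \<in> {1..<d} \<rightarrow>\<^sub>E V"
    and "(\<kappa>(d := undefined))(d := z) = \<kappa>" and "h ((\<kappa>(d := undefined))(d := z)) = h \<kappa>"
    by (auto simp: PiE_iff extensional_def)
next
  fix g assume "g \<in> {1..<d} \<rightarrow>\<^sub>E V"
  then show "g(d := z) \<in> {\<kappa> \<in> {1..d} \<rightarrow>\<^sub>E V. \<kappa> d = z}" "(g(d := z))(d := undefined) = g"
    using assms by (auto simp: PiE_iff extensional_def fun_eq_iff)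
qed

definition type_fact :: "nat multiset \<times> nat \<Rightarrow> rat" where
  "type_fact p = (\<Prod>c\<in>#fst p. fact c) * fact (snd p - 1)"

lemma type_fact_pos: "0 < type_fact p"
proof -
  have "0 < (\<Prod>c\<in>#l. fact c :: rat)" for l by (induction l) auto
  then show ?thesis by (simp add: type_fact_def)
qed

text \<open>The blocks are coloured independently. A block of size c without \<open>d\<close> gives
  c! e_c; in the block of \<open>d\<close> the colour \<open>z\<close> is taken, so its other b - 1
  positions give (b-1)! E_(b-1).\<close>

lemma phi_nc_e:
  assumes "1 \<le> d" "\<pi> \<in> partitions d" "finite V" "V \<subseteq> {1..}" "z \<in> V"
  shows "phi d (nc_e d \<pi>) V x z = type_fact (partition_type d \<pi>) * e_pointed (partition_type d \<pi>) V x z"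
proof -
  have \<pi>: "partition_on {1..d} \<pi>" using assms(2) by simp
  define B where "B = block \<pi> d"
  define A where "A = {1..d} - B"
  define C where "C = B - {d}"
  have B: "B \<in> \<pi>" "d \<in> B" using block_in[OF \<pi>] assms(1) by (auto simp: B_def)
  have Bsub: "B \<subseteq> {1..d}" using \<pi> B(1) by (auto simp: partition_on_def)
  have "{1..<d} = {1..d} - {d}" by auto
  then have AC: "{1..<d} = A \<union> C" "A \<inter> C = {}" using Bsub B(2) by (auto simp: A_def C_def)
  have finAC: "finite A" "finite C" using Bsub finite_subset[OF Bsub] by (auto simp: A_def C_def)
  have fin: "finite \<pi>" using finite_elements[OF _ \<pi>] by simp
  have part: "partition_on A (\<pi> - {B})" using partition_on_Diff_block[OF \<pi> B(1)] by (simp add: A_def)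
  have dA: "d \<notin> A" using B(2) by (simp add: A_def)
  have subA: "D \<subseteq> A" if "D \<in> \<pi> - {B}" for D using part that by (auto simp: partition_on_def)
  have "phi d (nc_e d \<pi>) V x z =
    (\<Sum>g\<in>(A \<union> C) \<rightarrow>\<^sub>E V. (of_bool (\<forall>D\<in>\<pi> - {B}. inj_on (restrict g A) D) * (\<Prod>i\<in>A. x (restrict g A i))) *
      (of_bool (inj_on (restrict g C) C \<and> z \<notin> restrict g C ` C) * (\<Prod>i\<in>C. x (restrict g C i))))"
    unfolding phi_def sum_PiE_last[OF assms(1,5)] AC(1)[symmetric]
  proof (rule sum.cong[OF refl])
    fix g assume g: "g \<in> {1..<d} \<rightarrow>\<^sub>E V"
    have "g(d := z) \<in> {1..d} \<rightarrow>\<^sub>E {1..}"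
    proof (rule PiE_I)
      fix i assume i: "i \<in> {1..d}"
      show "(g(d := z)) i \<in> {1..}"
      proof (cases "i = d")
        case False
        then have "g i \<in> V" using g i by (auto simp: PiE_iff)
        then show ?thesis using assms(4) False by auto
      qed (use assms(4,5) in auto)
    next
      fix i assume "i \<notin> {1..d}"
      then show "(g(d := z)) i = undefined" using g assms(1) by (auto simp: PiE_iff extensional_def)
    qed
    then have "nc_e d \<pi> (word d (g(d := z))) = of_bool (\<forall>D\<in>\<pi>. inj_on (g(d := z)) D)"
      by (rule nc_e_word[OF \<pi>])
    also have "(\<forall>D\<in>\<pi>. inj_on (g(d := z)) D) \<longleftrightarrow>
        (\<forall>D\<in>\<pi> - {B}. inj_on (g(d := z)) D) \<and> inj_on (g(d := z)) B"
      using B(1) by auto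
    also have "(\<forall>D\<in>\<pi> - {B}. inj_on (g(d := z)) D) \<longleftrightarrow> (\<forall>D\<in>\<pi> - {B}. inj_on (restrict g A) D)"
    proof (intro ball_cong refl inj_on_cong)
      fix D i assume "D \<in> \<pi> - {B}" "i \<in> D"
      then have "i \<in> A" "i \<noteq> d" using subA dA by auto
      then show "(g(d := z)) i = restrict g A i" by simp
    qed
    also have "inj_on (g(d := z)) B \<longleftrightarrow> inj_on (restrict g C) C \<and> z \<notin> restrict g C ` C"
    proof -
      have "B = insert d C" "d \<notin> C" using B(2) by (auto simp: C_def)
      then show ?thesis by (auto simp: inj_on_def)
    qed
    finally have ev: "nc_e d \<pi> (word d (g(d := z))) = of_bool ((\<forall>D\<in>\<pi> - {B}. inj_on (restrict g A) D) \<and>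
        inj_on (restrict g C) C \<and> z \<notin> restrict g C ` C)" .
    show "nc_e d \<pi> (word d (g(d := z))) * (\<Prod>i\<in>{1..<d}. x ((g(d := z)) i)) =
       (of_bool (\<forall>D\<in>\<pi> - {B}. inj_on (restrict g A) D) * (\<Prod>i\<in>A. x (restrict g A i))) *
      (of_bool (inj_on (restrict g C) C \<and> z \<notin> restrict g C ` C) * (\<Prod>i\<in>C. x (restrict g C i)))"
    proof -
      have "(\<Prod>i\<in>{1..<d}. x ((g(d := z)) i)) = (\<Prod>i\<in>A \<union> C. x (g i))"
        using AC by (intro prod.cong) auto
      also have "\<dots> = (\<Prod>i\<in>A. x (restrict g A i)) * (\<Prod>i\<in>C. x (restrict g C i))"
        using AC finAC by (simp add: prod.union_disjoint)
      finally show ?thesis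
        unfolding ev by (simp only: of_bool_conj mult_ac)
    qed
  qed
  also have "\<dots> = (\<Prod>D\<in>\<pi> - {B}. fact (card D) * es V x (card D)) *
      (\<Sum>g\<in>C \<rightarrow>\<^sub>E V. of_bool (inj_on g C \<and> z \<notin> g ` C) * (\<Prod>i\<in>C. x (g i)))"
    unfolding sum_PiE_Un[OF AC(2), of "\<lambda>f. of_bool (\<forall>D\<in>\<pi> - {B}. inj_on f D) * (\<Prod>i\<in>A. x (f i))"
        "\<lambda>g. of_bool (inj_on g C \<and> z \<notin> g ` C) * (\<Prod>i\<in>C. x (g i))" V]
    by (simp only: sum_partition_PiE[OF finite_Diff[OF fin] part finAC(1) assms(3)])
  also have "(\<Sum>g\<in>C \<rightarrow>\<^sub>E V. of_bool (inj_on g C \<and> z \<notin> g ` C) * (\<Prod>i\<in>C. x (g i))) =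
      (\<Sum>g\<in>C \<rightarrow>\<^sub>E (V - {z}). of_bool (inj_on g C) * (\<Prod>i\<in>C. x (g i)))"
  proof (rule sum.mono_neutral_cong_right)
    show "finite (C \<rightarrow>\<^sub>E V)" using finAC assms(3) by (intro finite_PiE) auto
    show "C \<rightarrow>\<^sub>E V - {z} \<subseteq> C \<rightarrow>\<^sub>E V" by (intro PiE_mono) auto
    show "\<forall>g\<in>(C \<rightarrow>\<^sub>E V) - (C \<rightarrow>\<^sub>E V - {z}). of_bool (inj_on g C \<and> z \<notin> g ` C) * (\<Prod>i\<in>C. x (g i)) = 0"
      by (auto simp: PiE_iff)
    show "of_bool (inj_on g C \<and> z \<notin> g ` C) * (\<Prod>i\<in>C. x (g i)) = of_bool (inj_on g C) * (\<Prod>i\<in>C. x (g i))"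
      if "g \<in> C \<rightarrow>\<^sub>E V - {z}" for g
      using that by (auto simp: PiE_iff)
  qed
  also have "\<dots> = fact (card C) * es (V - {z}) x (card C)"
    using sum_inj_PiE finAC assms(3) by blast
  also have "card C = card B - 1" using B(2) by (simp add: C_def)
  finally show ?thesis
    by (simp add: type_fact_def e_pointed_def partition_type_def B_def[symmetric] prod.distrib
        prod_unfold_prod_mset image_mset.compositionality o_def mult_ac)
qed

section \<open>Permuting the positions before the last one\<close>

definition rearrange :: "nat \<Rightarrow> (nat \<Rightarrow> nat) \<Rightarrow> nc_series \<Rightarrow> nc_series" where
  "rearrange d f F = (\<lambda>w. if length w = d then F (word d (\<lambda>i. w ! (f i - 1))) else 0)"

text \<open>Permutations of the positions other than the last, written as extensional surjections
  because \<open>sum_surj_PiE\<close> produces them in this form; \<open>g(d := d)\<close> is the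
  extension to all positions.\<close>

definition last_fixing :: "nat \<Rightarrow> (nat \<Rightarrow> nat) set" where
  "last_fixing d = {f \<in> {1..<d} \<rightarrow>\<^sub>E {1..<d}. f ` {1..<d} = {1..<d}}"

lemma rearrange_word:
  assumes "f \<in> {1..d} \<rightarrow> {1..d}"
  shows "rearrange d f F (word d t) = F (word d (\<lambda>i\<in>{1..d}. t (f i)))"
proof -
  have "word d t ! (f i - 1) = t (f i)" if "i \<in> {1..d}" for i
  proof -
    have "f i \<in> {1..d}" using assms that by auto
    then show ?thesis by (auto simp: nth_upt)
  qed
  then have "word d (\<lambda>i. word d t ! (f i - 1)) = word d (\<lambda>i\<in>{1..d}. t (f i))"
    by (intro map_cong refl) auto
  from arg_cong[OF this, of F] show ?thesis by (simp add: rearrange_def del: map_eq_conv)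
qed

lemma bij_betw_last_fixing:
  assumes "1 \<le> d" "g \<in> last_fixing d"
  shows "bij_betw (g(d := d)) {1..d} {1..d}"
proof -
  have d: "{1..d} - {d} = {1..<d}" "insert d {1..<d} = {1..d}" using assms(1) by auto
  have "g ` {1..<d} = {1..<d}" using assms(2) by (simp add: last_fixing_def)
  then have "(g(d := d)) ` {1..d} = {1..d}"
    using d assms(1) unfolding fun_upd_image by auto
  then show ?thesis by (simp add: bij_betw_def eq_card_imp_inj_on)
qed

text \<open>A relabelling of the positions carries blocks to blocks of the same size, and as
  \<open>f\<close> fixes \<open>d\<close>, the block of \<open>d\<close> to the block of
  \<open>d\<close>.\<close>

lemma rearrange_nc_e:
  assumes "bij_betw f {1..d} {1..d}" "f d = d" "1 \<le> d" "\<pi> \<in> partitions d"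
  shows "image f ` \<pi> \<in> partitions d"
    and "rearrange d f (nc_e d \<pi>) = nc_e d (image f ` \<pi>)"
    and "partition_type d (image f ` \<pi>) = partition_type d \<pi>"
proof -
  have \<pi>: "partition_on {1..d} \<pi>" using assms(4) by simp
  have inj: "inj_on f {1..d}" and img: "f ` {1..d} = {1..d}"
    using assms(1) by (auto simp: bij_betw_def)
  have sub: "B \<subseteq> {1..d}" if "B \<in> \<pi>" for B using that \<pi> by (auto simp: partition_on_def)
  have inj': "inj_on (image f) \<pi>"
    by (rule inj_on_subset[OF inj_on_image_Pow[OF inj]]) (use sub in blast)
  show part: "image f ` \<pi> \<in> partitions d"
  proof -
    have "image f ` \<pi> - {{}} = image f ` \<pi>" using partition_onD3[OF \<pi>] by auto
    then show ?thesis using partition_on_inj_image[OF \<pi> inj] img by simp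
  qed
  have fd: "f \<in> {1..d} \<rightarrow> {1..d}" using img by auto
  show "rearrange d f (nc_e d \<pi>) = nc_e d (image f ` \<pi>)"
  proof (rule nc_homogeneous_eqI)
    fix t :: "nat \<Rightarrow> nat" assume t: "t \<in> {1..d} \<rightarrow>\<^sub>E {1..}"
    have tf: "(\<lambda>i\<in>{1..d}. t (f i)) \<in> {1..d} \<rightarrow>\<^sub>E {1..}" using t fd by (auto simp: PiE_iff Pi_iff)
    have "inj_on (\<lambda>i\<in>{1..d}. t (f i)) B \<longleftrightarrow> inj_on t (f ` B)" if "B \<in> \<pi>" for B
    proof -
      have "inj_on (\<lambda>i\<in>{1..d}. t (f i)) B \<longleftrightarrow> inj_on (t \<circ> f) B"
        using sub[OF that] by (intro inj_on_cong) auto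
      then show ?thesis using comp_inj_on_iff[of f B t] inj_on_subset[OF inj sub[OF that]] by simp
    qed
    then show "rearrange d f (nc_e d \<pi>) (word d t) = nc_e d (image f ` \<pi>) (word d t)"
      using part t tf by (simp add: rearrange_word[OF fd] nc_e_word \<pi>)
  next
    show "nc_homogeneous d (rearrange d f (nc_e d \<pi>))"
      unfolding nc_homogeneous_def
    proof (intro allI impI)
      fix w assume w: "rearrange d f (nc_e d \<pi>) w \<noteq> 0"
      then have len: "length w = d" by (auto simp: rearrange_def split: if_splits)
      define t where "t = (\<lambda>i\<in>{1..d}. w ! (i - 1))"
      have wt: "w = word d t"
        using len by (intro nth_equalityI) (auto simp: t_def nth_upt)
      have "nc_e d \<pi> (word d (\<lambda>i\<in>{1..d}. t (f i))) \<noteq> 0"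
        using w unfolding wt rearrange_word[OF fd] .
      then obtain s where s: "s \<in> {1..d} \<rightarrow>\<^sub>E {1..}" "word d (\<lambda>i\<in>{1..d}. t (f i)) = word d s"
        using nc_homogeneous_nc_e unfolding nc_homogeneous_def by blast
      then have eq: "(\<lambda>i\<in>{1..d}. t (f i)) = s"
        using word_eq_iff[of "\<lambda>i\<in>{1..d}. t (f i)" d s] by (auto simp: PiE_def)
      have "t j \<in> {1..}" if "j \<in> {1..d}" for j
      proof -
        have "j \<in> f ` {1..d}" unfolding img by (rule that)
        then obtain i where i: "i \<in> {1..d}" "f i = j" by (elim imageE) simp
        then have "s i = t j" using fun_cong[OF eq, of i] by simp
        then show ?thesis using PiE_mem[OF s(1) i(1)] by simp
      qed
      then have "t \<in> {1..d} \<rightarrow>\<^sub>E {1..}" by (auto simp: t_def PiE_iff)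
      then show "\<exists>t\<in>{1..d} \<rightarrow>\<^sub>E {1..}. w = word d t" using wt by blast
    qed
  qed (rule nc_homogeneous_nc_e)
  have B: "block \<pi> d \<in> \<pi>" "d \<in> block \<pi> d" using block_in[OF \<pi>] assms(3) by auto
  have blk: "block (image f ` \<pi>) d = f ` block \<pi> d"
    using B assms(2) part by (intro block_eq[of "{1..d}"]) (auto simp: image_iff intro: bexI[of _ d])
  have card: "card (f ` B) = card B" if "B \<in> \<pi>" for B
    using inj_on_subset[OF inj sub[OF that]] by (rule card_image)
  have "image f ` \<pi> - {f ` block \<pi> d} = image f ` (\<pi> - {block \<pi> d})"
    using inj' B by (subst inj_on_image_set_diff[of "image f" \<pi>]) auto
  then have "image_mset card (mset_set (image f ` \<pi> - {f ` block \<pi> d})) =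
      image_mset card (image_mset (image f) (mset_set (\<pi> - {block \<pi> d})))"
    by (simp add: image_mset_mset_set inj_on_subset[OF inj'])
  also have "\<dots> = image_mset card (mset_set (\<pi> - {block \<pi> d}))"
    unfolding image_mset.compositionality o_def
    using finite_elements[OF _ \<pi>] by (intro image_mset_cong) (auto simp: card)
  finally show "partition_type d (image f ` \<pi>) = partition_type d \<pi>"
    using B by (simp add: partition_type_def blk card)
qed

lemma e_set_expansion:
  assumes "nc.independent (e_set d)" "F \<in> nc.span (e_set d)"
  shows "(\<Sum>\<pi>\<in>partitions d. nc_scale (nc.representation (e_set d) F (nc_e d \<pi>)) (nc_e d \<pi>)) = F"
  using nc.sum_representation_eq[OF assms _ subset_refl] finite_partitions[of d]
  by (simp add: sum.reindex[OF inj_on_nc_e] o_def)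

text \<open>The partitions \<open>\<rho> i\<close> may repeat, so the coefficient collects all
  \<open>i\<close> with the same partition. Repetitions do occur when different permutations of
  positions yield the same partition.\<close>

lemma representation_combination:
  assumes "nc.independent (e_set d)" "\<pi> \<in> partitions d"
    and \<rho>: "\<And>i. i \<in> I \<Longrightarrow> \<rho> i \<in> partitions d"
  shows "nc.representation (e_set d) (\<Sum>i\<in>I. nc_scale (c i) (nc_e d (\<rho> i))) (nc_e d \<pi>) =
    (\<Sum>i\<in>I. c i * of_bool (\<rho> i = \<pi>))"
proof -
  have "nc.representation (e_set d) (nc_scale (c i) (nc_e d (\<rho> i))) (nc_e d \<pi>) =
      c i * of_bool (\<rho> i = \<pi>)" if i: "i \<in> I" for i
  proof -
    have e: "nc_e d (\<rho> i) \<in> e_set d" using \<rho>[OF i] by blast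
    have "nc_e d (\<rho> i) = nc_e d \<pi> \<longleftrightarrow> \<rho> i = \<pi>"
      using inj_on_eq_iff[OF inj_on_nc_e] \<rho>[OF i] assms(2) by blast
    then show ?thesis
      unfolding nc.representation_scale[OF assms(1) nc.span_base[OF e]]
        nc.representation_basis[OF assms(1) e] by auto
  qed
  moreover have "nc_scale (c i) (nc_e d (\<rho> i)) \<in> nc.span (e_set d)" if "i \<in> I" for i
    using \<rho>[OF that] by (intro nc.span_scale nc.span_base) blast
  ultimately show ?thesis
    by (simp add: nc.representation_sum[OF assms(1)])
qed

lemma nu_combination:
  assumes "nc.independent (e_set d)" "\<And>i. i \<in> I \<Longrightarrow> \<rho> i \<in> partitions d"
  shows "Poly_Mapping.lookup (nu d (\<Sum>i\<in>I. nc_scale (c i) (nc_e d (\<rho> i)))) p =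
    (\<Sum>i\<in>I. c i * of_bool (partition_type d (\<rho> i) = p))"
proof -
  have "Poly_Mapping.lookup (nu d (\<Sum>i\<in>I. nc_scale (c i) (nc_e d (\<rho> i)))) p =
    (\<Sum>\<pi>\<in>partitions d. (\<Sum>i\<in>I. c i * of_bool (\<rho> i = \<pi>)) * of_bool (partition_type d \<pi> = p))"
    unfolding nu_def lookup_sum
    by (intro sum.cong refl)
       (simp add: representation_combination[OF assms(1) _ assms(2)] lookup_single when_def)
  also have "\<dots> = (\<Sum>i\<in>I. \<Sum>\<pi>\<in>partitions d. if \<pi> = \<rho> i then c i * of_bool (partition_type d \<pi> = p) else 0)"
    unfolding sum_distrib_right by (subst sum.swap) (intro sum.cong refl, auto)
  also have "\<dots> = (\<Sum>i\<in>I. c i * of_bool (partition_type d (\<rho> i) = p))"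
    using assms(2) finite_partitions[of d] by (intro sum.cong refl) (simp add: sum.delta)
  finally show ?thesis .
qed

lemma rearrange_combination:
  "rearrange d f (\<Sum>i\<in>I. nc_scale (c i) (F i)) = (\<Sum>i\<in>I. nc_scale (c i) (rearrange d f (F i)))"
  by (rule ext) (simp add: rearrange_def sum_series_apply nc_scale_def)

text \<open>Since \<open>\<nu>\<close> only sees the type of a set partition, it is invariant under permuting all positions
  but the last, hence it factors through the sum over these permutations.\<close>

lemma nu_sum_rearrange:
  assumes "1 \<le> d" "nc.independent (e_set d)" "F \<in> nc.span (e_set d)"
  shows "Poly_Mapping.lookup (nu d (\<Sum>g\<in>last_fixing d. rearrange d (g(d := d)) F)) p =
    of_nat (card (last_fixing d)) * Poly_Mapping.lookup (nu d F) p"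
proof -
  define c where "c \<pi> = nc.representation (e_set d) F (nc_e d \<pi>)" for \<pi>
  have F: "F = (\<Sum>\<pi>\<in>partitions d. nc_scale (c \<pi>) (nc_e d \<pi>))"
    using e_set_expansion[OF assms(2,3)] by (simp add: c_def)
  have re: "image (g(d := d)) ` \<pi> \<in> partitions d"
      "rearrange d (g(d := d)) (nc_e d \<pi>) = nc_e d (image (g(d := d)) ` \<pi>)"
      "partition_type d (image (g(d := d)) ` \<pi>) = partition_type d \<pi>"
    if "g \<in> last_fixing d" "\<pi> \<in> partitions d" for g \<pi>
    using rearrange_nc_e[OF bij_betw_last_fixing[OF assms(1) that(1)] _ assms(1) that(2)] by auto
  have "(\<Sum>g\<in>last_fixing d. rearrange d (g(d := d)) F) =
      (\<Sum>g\<in>last_fixing d. \<Sum>\<pi>\<in>partitions d. nc_scale (c \<pi>) (nc_e d (image (g(d := d)) ` \<pi>)))"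
    unfolding F rearrange_combination by (intro sum.cong refl) (simp only: re)
  also have "\<dots> = (\<Sum>(g, \<pi>)\<in>last_fixing d \<times> partitions d. nc_scale (c \<pi>) (nc_e d (image (g(d := d)) ` \<pi>)))"
    by (rule sum.cartesian_product)
  also have "\<dots> = (\<Sum>i\<in>last_fixing d \<times> partitions d. nc_scale (c (snd i)) (nc_e d (image ((fst i)(d := d)) ` snd i)))"
    by (simp add: case_prod_unfold)
  finally have eq: "(\<Sum>g\<in>last_fixing d. rearrange d (g(d := d)) F) =
      (\<Sum>i\<in>last_fixing d \<times> partitions d. nc_scale (c (snd i)) (nc_e d (image ((fst i)(d := d)) ` snd i)))" .
  have "Poly_Mapping.lookup (nu d (\<Sum>g\<in>last_fixing d. rearrange d (g(d := d)) F)) p =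
     (\<Sum>i\<in>last_fixing d \<times> partitions d. c (snd i) * of_bool (partition_type d (image ((fst i)(d := d)) ` snd i) = p))"
    unfolding eq using re(1) by (intro nu_combination[OF assms(2)]) auto
  also have "\<dots> = (\<Sum>i\<in>last_fixing d \<times> partitions d. c (snd i) * of_bool (partition_type d (snd i) = p))"
    using re(3) by (intro sum.cong refl) auto
  also have "\<dots> = (\<Sum>g\<in>last_fixing d. \<Sum>\<pi>\<in>partitions d. c \<pi> * of_bool (partition_type d \<pi> = p))"
    unfolding sum.cartesian_product by (simp add: case_prod_unfold)
  also have "\<dots> = of_nat (card (last_fixing d)) * Poly_Mapping.lookup (nu d F) p"
    using nu_combination[OF assms(2), of "partitions d" "\<lambda>\<pi>. \<pi>" c p] F by simp
  finally show ?thesis .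
qed

text \<open>The sum is the expansion of the product over \<open>A\<close> of the factors
  \<open>1 - of_bool (a \<notin> T)\<close>, which vanishes as soon as some element of
  \<open>A\<close> is missing from \<open>T\<close>.\<close>

lemma sum_supersets_sign:
  assumes "finite A" "T \<subseteq> A"
  shows "(\<Sum>S | S \<subseteq> A \<and> T \<subseteq> S. (- 1) ^ (card A - card S)) = (of_bool (T = A) :: 'b::comm_ring_1)"
proof -
  have "(\<Prod>a\<in>A. 1 - of_bool (a \<notin> T)) = (\<Sum>S\<in>Pow A. (-1) ^ (card A - card S) * (\<Prod>a\<in>S. 1) *
      (\<Prod>a\<in>A - S. of_bool (a \<notin> T) :: 'b))"
    by (rule prod_diff_conv_sum'[OF assms(1)])
  also have "\<dots> = (\<Sum>S\<in>Pow A. if T \<subseteq> S then (-1) ^ (card A - card S) else 0)"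
  proof (intro sum.cong refl)
    fix S assume "S \<in> Pow A"
    show "(-1) ^ (card A - card S) * (\<Prod>a\<in>S. 1) * (\<Prod>a\<in>A - S. of_bool (a \<notin> T) :: 'b) =
        (if T \<subseteq> S then (-1) ^ (card A - card S) else 0)"
    proof (cases "T \<subseteq> S")
      case True
      then have "(\<Prod>a\<in>A - S. of_bool (a \<notin> T) :: 'b) = 1" by (intro prod.neutral) auto
      then show ?thesis using True by simp
    next
      case False
      then obtain a where "a \<in> A - S" "a \<in> T" using assms(2) by auto
      then have "(\<Prod>a\<in>A - S. of_bool (a \<notin> T) :: 'b) = 0"
        using assms(1) by (intro prod_zero) auto
      then show ?thesis using False by simp
    qed
  qed
  also have "\<dots> = (\<Sum>S\<in>{S \<in> Pow A. T \<subseteq> S}. (-1) ^ (card A - card S))"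
    using assms(1) by (intro sum.inter_filter[symmetric]) simp
  also have "{S \<in> Pow A. T \<subseteq> S} = {S. S \<subseteq> A \<and> T \<subseteq> S}" by auto
  finally have "(\<Sum>S | S \<subseteq> A \<and> T \<subseteq> S. (- 1) ^ (card A - card S)) = (\<Prod>a\<in>A. 1 - of_bool (a \<notin> T) :: 'b)" ..
  also have "\<dots> = of_bool (T = A)"
  proof (cases "T = A")
    case True
    then show ?thesis by (auto intro: prod.neutral)
  next
    case False
    then obtain a where "a \<in> A" "a \<notin> T" using assms(2) by auto
    then show ?thesis using assms(1) False by (auto intro!: prod_zero)
  qed
  finally show ?thesis .
qed

text \<open>Polarization: with \<open>x c\<close> the number of positions in \<open>S\<close> coloured \<open>c\<close> by \<open>t\<close>, the pointed
  evaluation is a sum over all maps into \<open>S\<close>; inclusion-exclusion over \<open>S\<close> leaves the bijections.\<close>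

lemma phi_polarize:
  assumes "1 \<le> d" "S \<subseteq> {1..<d}"
  shows "phi d F (t ` {1..d}) (\<lambda>c. of_nat (card {j \<in> S. t j = c})) (t d) =
    (\<Sum>f\<in>{1..<d} \<rightarrow>\<^sub>E S. F (word d (\<lambda>i\<in>{1..d}. t ((f(d := d)) i))))"
proof -
  let ?A = "{1..<d}" and ?V = "t ` {1..d}"
  let ?K = "{\<kappa> \<in> {1..d} \<rightarrow>\<^sub>E ?V. \<kappa> d = t d}"
  let ?s = "\<lambda>f. \<lambda>i\<in>{1..d}. t ((f(d := d)) i)"
  have finS: "finite S" using assms(2) finite_subset by blast
  have finK: "finite ?K"
    by (rule finite_subset[of _ "{1..d} \<rightarrow>\<^sub>E ?V"]) (auto intro: finite_PiE)
  have finF: "finite (?A \<rightarrow>\<^sub>E S)" using finS by (intro finite_PiE) auto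
  have sK: "?s f \<in> ?K" if "f \<in> ?A \<rightarrow>\<^sub>E S" for f
  proof -
    have "f i \<in> {1..d}" if "i \<in> ?A" for i
      using \<open>f \<in> ?A \<rightarrow>\<^sub>E S\<close> that assms(2) by (fastforce simp: PiE_iff)
    then show ?thesis using assms(1) by auto
  qed
  \<comment> \<open>Expanding the product of the counts chooses, for each position \<open>i\<close>,
    a position \<open>f i\<close> in \<open>S\<close> whose colour under \<open>t\<close> is
    \<open>\<kappa> i\<close>.\<close>
  have "(\<Prod>i\<in>?A. of_nat (card {j \<in> S. t j = \<kappa> i})) = (\<Sum>f\<in>?A \<rightarrow>\<^sub>E S. of_bool (?s f = \<kappa>) :: rat)"
    if "\<kappa> \<in> ?K" for \<kappa>
  proof -
    have "(\<Prod>i\<in>?A. of_nat (card {j \<in> S. t j = \<kappa> i})) = (of_nat (card (\<Pi>\<^sub>E i\<in>?A. {j \<in> S. t j = \<kappa> i})) :: rat)"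
      by (simp add: card_PiE)
    also have "(\<Pi>\<^sub>E i\<in>?A. {j \<in> S. t j = \<kappa> i}) = {f \<in> ?A \<rightarrow>\<^sub>E S. ?s f = \<kappa>}"
    proof (intro equalityI subsetI)
      fix f assume f: "f \<in> (\<Pi>\<^sub>E i\<in>?A. {j \<in> S. t j = \<kappa> i})"
      have "?s f i = \<kappa> i" for i
        using f that by (cases "i = d") (auto simp: PiE_iff extensional_def)
      then show "f \<in> {f \<in> ?A \<rightarrow>\<^sub>E S. ?s f = \<kappa>}" using f by (auto simp: PiE_iff)
    next
      fix f assume "f \<in> {f \<in> ?A \<rightarrow>\<^sub>E S. ?s f = \<kappa>}"
      then have f: "f \<in> ?A \<rightarrow>\<^sub>E S" and eq: "\<kappa> = ?s f" by auto
      have "\<kappa> i = t (f i)" if "i \<in> ?A" for i using that by (simp add: eq)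
      then show "f \<in> (\<Pi>\<^sub>E i\<in>?A. {j \<in> S. t j = \<kappa> i})" using f by (auto simp: PiE_iff)
    qed
    finally show ?thesis using finF by (simp add: of_bool_def sum.inter_filter[symmetric])
  qed
  then have "phi d F ?V (\<lambda>c. of_nat (card {j \<in> S. t j = c})) (t d) =
      (\<Sum>\<kappa>\<in>?K. \<Sum>f\<in>?A \<rightarrow>\<^sub>E S. F (word d \<kappa>) * of_bool (?s f = \<kappa>))"
    unfolding phi_def sum_distrib_left[symmetric] by (intro sum.cong refl) simp
  also have "\<dots> = (\<Sum>f\<in>?A \<rightarrow>\<^sub>E S. \<Sum>\<kappa>\<in>?K. if \<kappa> = ?s f then F (word d \<kappa>) else 0)"
    by (subst sum.swap) (intro sum.cong refl, auto)
  also have "\<dots> = (\<Sum>f\<in>?A \<rightarrow>\<^sub>E S. F (word d (?s f)))"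
    using finK sK by (intro sum.cong refl) (simp only: sum.delta if_True)
  finally show ?thesis .
qed

text \<open>After the sums are exchanged, each \<open>f\<close> carries the signs of all supersets
  of its image within \<open>A\<close>; they cancel unless the image is \<open>A\<close>.\<close>

lemma sum_surj_PiE:
  fixes h :: "('a \<Rightarrow> 'a) \<Rightarrow> 'b::comm_ring_1"
  assumes "finite A"
  shows "(\<Sum>S\<in>Pow A. (- 1) ^ (card A - card S) * (\<Sum>f\<in>A \<rightarrow>\<^sub>E S. h f)) =
    (\<Sum>f | f \<in> A \<rightarrow>\<^sub>E A \<and> f ` A = A. h f)"
proof -
  have fin: "finite (A \<rightarrow>\<^sub>E A)" using assms by (intro finite_PiE) auto
  have "(\<Sum>f\<in>A \<rightarrow>\<^sub>E S. h f) = (\<Sum>f\<in>A \<rightarrow>\<^sub>E A. if f ` A \<subseteq> S then h f else 0)" if "S \<subseteq> A" for S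
  proof -
    have "A \<rightarrow>\<^sub>E S = {f \<in> A \<rightarrow>\<^sub>E A. f ` A \<subseteq> S}"
      using that by (auto simp: PiE_iff extensional_def)
    then show ?thesis using fin by (simp add: sum.inter_filter[symmetric])
  qed
  then have "(\<Sum>S\<in>Pow A. (- 1) ^ (card A - card S) * (\<Sum>f\<in>A \<rightarrow>\<^sub>E S. h f)) =
     (\<Sum>S\<in>Pow A. \<Sum>f\<in>A \<rightarrow>\<^sub>E A. if f ` A \<subseteq> S then (- 1) ^ (card A - card S) * h f else 0)"
    by (simp add: sum_distrib_left if_distrib cong: if_cong)
  also have "\<dots> = (\<Sum>f\<in>A \<rightarrow>\<^sub>E A. \<Sum>S\<in>Pow A. if f ` A \<subseteq> S then (- 1) ^ (card A - card S) * h f else 0)"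
    by (rule sum.swap)
  also have "\<dots> = (\<Sum>f\<in>A \<rightarrow>\<^sub>E A. if f ` A = A then h f else 0)"
  proof (rule sum.cong[OF refl])
    fix f assume f: "f \<in> A \<rightarrow>\<^sub>E A"
    have "(\<Sum>S\<in>Pow A. if f ` A \<subseteq> S then (- 1) ^ (card A - card S) * h f else 0) =
        (\<Sum>S\<in>{S \<in> Pow A. f ` A \<subseteq> S}. (- 1) ^ (card A - card S) * h f)"
      using assms by (intro sum.inter_filter[symmetric]) simp
    also have "{S \<in> Pow A. f ` A \<subseteq> S} = {S. S \<subseteq> A \<and> f ` A \<subseteq> S}" by auto
    also have "(\<Sum>S | S \<subseteq> A \<and> f ` A \<subseteq> S. (- 1) ^ (card A - card S) * h f) =
        (if f ` A = A then h f else 0)"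
      using f unfolding sum_distrib_right[symmetric]
      by (subst sum_supersets_sign[OF assms]) auto
    finally show "(\<Sum>S\<in>Pow A. if f ` A \<subseteq> S then (- 1) ^ (card A - card S) * h f else 0) =
        (if f ` A = A then h f else 0)" .
  qed
  also have "\<dots> = (\<Sum>f | f \<in> A \<rightarrow>\<^sub>E A \<and> f ` A = A. h f)"
    using fin by (simp add: sum.inter_filter[symmetric])
  finally show ?thesis .
qed

text \<open>By polarization the evaluations determine the sum of all rearrangements fixing the last
  position. On such sums \<open>nu\<close> is \<open>card (last_fixing d)\<close> times its original
  value, and this number is not 0.\<close>

lemma nu_eqI:
  assumes "1 \<le> d" "nc.independent (e_set d)" "F \<in> nc.span (e_set d)" "G \<in> nc.span (e_set d)"
    and phi: "\<And>V x z. finite V \<Longrightarrow> V \<subseteq> {1..} \<Longrightarrow> z \<in> V \<Longrightarrow> phi d F V x z = phi d G V x z"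
  shows "Poly_Mapping.lookup (nu d F) p = Poly_Mapping.lookup (nu d G) p"
proof -
  let ?A = "{1..<d}"
  have hom: "nc_homogeneous d (\<Sum>g\<in>last_fixing d. rearrange d (g(d := d)) H)"
    if "H \<in> nc.span (e_set d)" for H
  proof -
    define c where "c \<pi> = nc.representation (e_set d) H (nc_e d \<pi>)" for \<pi>
    have H: "H = (\<Sum>\<pi>\<in>partitions d. nc_scale (c \<pi>) (nc_e d \<pi>))"
      using e_set_expansion[OF assms(2) that] by (simp add: c_def)
    have "nc_homogeneous d (rearrange d (g(d := d)) H)" if "g \<in> last_fixing d" for g
      unfolding H rearrange_combination
      using rearrange_nc_e(2)[OF bij_betw_last_fixing[OF assms(1) that] _ assms(1)]
      by (intro nc_homogeneous_combination) (simp add: nc_homogeneous_nc_e)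
    then show ?thesis
      using nc_homogeneous_combination[of "last_fixing d" d "\<lambda>g. rearrange d (g(d := d)) H" "\<lambda>_. 1"]
      by (simp add: nc_scale_def)
  qed
  have ev: "(\<Sum>g\<in>last_fixing d. rearrange d (g(d := d)) H) (word d t) =
      (\<Sum>S\<in>Pow ?A. (- 1) ^ (card ?A - card S) *
        phi d H (t ` {1..d}) (\<lambda>c. of_nat (card {j \<in> S. t j = c})) (t d))" for H t
  proof -
    have "(\<Sum>g\<in>last_fixing d. rearrange d (g(d := d)) H) (word d t) =
       (\<Sum>g\<in>last_fixing d. H (word d (\<lambda>i\<in>{1..d}. t ((g(d := d)) i))))"
      unfolding sum_series_apply
      by (intro sum.cong refl rearrange_word bij_betw_imp_funcset bij_betw_last_fixing[OF assms(1)])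
    also have "\<dots> = (\<Sum>S\<in>Pow ?A. (- 1) ^ (card ?A - card S) *
        (\<Sum>f\<in>?A \<rightarrow>\<^sub>E S. H (word d (\<lambda>i\<in>{1..d}. t ((f(d := d)) i)))))"
      unfolding last_fixing_def by (rule sum_surj_PiE[symmetric]) simp
    finally show ?thesis using phi_polarize[OF assms(1)] by simp
  qed
  have "(\<Sum>g\<in>last_fixing d. rearrange d (g(d := d)) F) = (\<Sum>g\<in>last_fixing d. rearrange d (g(d := d)) G)"
  proof (rule nc_homogeneous_eqI[OF hom[OF assms(3)] hom[OF assms(4)]])
    fix t :: "nat \<Rightarrow> nat" assume "t \<in> {1..d} \<rightarrow>\<^sub>E {1..}"
    then have "t ` {1..d} \<subseteq> {1..}" by (auto simp: PiE_iff)
    then show "(\<Sum>g\<in>last_fixing d. rearrange d (g(d := d)) F) (word d t) =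
        (\<Sum>g\<in>last_fixing d. rearrange d (g(d := d)) G) (word d t)"
      unfolding ev using assms(1) by (intro sum.cong refl arg_cong2[where f = "(*)"] phi) auto
  qed
  moreover have "card (last_fixing d) \<noteq> 0"
  proof -
    have "(\<lambda>i\<in>?A. i) \<in> last_fixing d" by (auto simp: last_fixing_def)
    moreover have "finite (last_fixing d)"
      unfolding last_fixing_def by (rule finite_subset[of _ "?A \<rightarrow>\<^sub>E ?A"]) (auto intro: finite_PiE)
    ultimately show ?thesis by auto
  qed
  ultimately show ?thesis
    using nu_sum_rearrange[OF assms(1-3), of p] nu_sum_rearrange[OF assms(1,2,4), of p] by simp
qed

section \<open>Chromatic functions of concatenations\<close>

text \<open>Separated from the domain and range conditions of \<open>proper_colouring\<close>, so
  that it applies to composed and restricted maps as well.\<close>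

definition proper :: "nat set set \<Rightarrow> (nat \<Rightarrow> nat) \<Rightarrow> bool" where
  "proper G \<kappa> \<longleftrightarrow> (\<forall>u v. {u, v} \<in> G \<longrightarrow> \<kappa> u \<noteq> \<kappa> v)"

lemma labelled_graph_edge:
  assumes "labelled_graph d G" "e \<in> G"
  obtains u v where "e = {u, v}" "u \<in> {1..d}" "v \<in> {1..d}" "u \<noteq> v"
  using assms unfolding labelled_graph_def by blast

lemma labelled_graph_vertices:
  assumes "labelled_graph d G" "{u, v} \<in> G"
  shows "u \<in> {1..d}" "v \<in> {1..d}"
  using labelled_graph_edge[OF assms] by (metis doubleton_eq_iff)+

lemma proper_Un: "proper (G \<union> H) \<kappa> \<longleftrightarrow> proper G \<kappa> \<and> proper H \<kappa>"
  by (auto simp: proper_def)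

lemma proper_cong:
  assumes "labelled_graph d G" "\<And>i. i \<in> {1..d} \<Longrightarrow> \<kappa> i = \<mu> i"
  shows "proper G \<kappa> \<longleftrightarrow> proper G \<mu>"
proof -
  have "\<kappa> u = \<kappa> v \<longleftrightarrow> \<mu> u = \<mu> v" if "{u, v} \<in> G" for u v
    using labelled_graph_vertices[OF assms(1) that] assms(2) by simp
  then show ?thesis by (auto simp: proper_def)
qed

lemma proper_image:
  assumes "labelled_graph d G"
  shows "proper (image f ` G) \<kappa> \<longleftrightarrow> proper G (\<lambda>i. \<kappa> (f i))"
proof
  assume L: "proper (image f ` G) \<kappa>"
  show "proper G (\<lambda>i. \<kappa> (f i))"
    unfolding proper_def
  proof (intro allI impI)
    fix u v assume "{u, v} \<in> G"
    then have "{f u, f v} \<in> image f ` G" by (intro image_eqI[of _ _ "{u, v}"]) auto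
    then show "\<kappa> (f u) \<noteq> \<kappa> (f v)" using L by (simp add: proper_def)
  qed
next
  assume R: "proper G (\<lambda>i. \<kappa> (f i))"
  show "proper (image f ` G) \<kappa>"
    unfolding proper_def
  proof (intro allI impI)
    fix u v assume "{u, v} \<in> image f ` G"
    then obtain e where e: "e \<in> G" "{u, v} = f ` e" by auto
    then obtain a b where ab: "e = {a, b}" using labelled_graph_edge[OF assms] by metis
    then have "\<kappa> (f a) \<noteq> \<kappa> (f b)" using R e by (simp add: proper_def)
    moreover have "{u, v} = {f a, f b}" using e ab by simp
    ultimately show "\<kappa> u \<noteq> \<kappa> v" by (auto simp: doubleton_eq_iff)
  qed
qed

definition chrom :: "nat \<Rightarrow> nat set set \<Rightarrow> pointed" where
  "chrom d G V x z =
     (\<Sum>\<kappa> | \<kappa> \<in> {1..d} \<rightarrow>\<^sub>E V \<and> \<kappa> d = z. of_bool (proper G \<kappa>) * (\<Prod>i\<in>{1..<d}. x (\<kappa> i)))"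

lemma Y_nc_word:
  assumes "t \<in> {1..d} \<rightarrow>\<^sub>E {1..}"
  shows "Y_nc d G (word d t) = of_bool (proper G t)"
proof -
  have sub: "{\<kappa>. proper_colouring d G \<kappa>} \<subseteq> extensional {1..d}"
    unfolding proper_colouring_def PiE_def by blast
  have t: "t \<in> extensional {1..d}" using assms by (simp add: PiE_def)
  show ?thesis
    unfolding Y_nc_def nc_sum_word[OF sub t] using assms by (simp add: proper_colouring_def proper_def)
qed

lemma phi_Y_nc:
  assumes "V \<subseteq> {1..}"
  shows "phi d (Y_nc d G) V x z = chrom d G V x z"
  unfolding phi_def chrom_def
proof (intro sum.cong refl)
  fix \<kappa> assume "\<kappa> \<in> {\<kappa> \<in> {1..d} \<rightarrow>\<^sub>E V. \<kappa> d = z}"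
  then have "\<kappa> \<in> {1..d} \<rightarrow>\<^sub>E {1..}" using PiE_mono[of "{1..d}" "\<lambda>_. V" "\<lambda>_. {1..}"] assms by blast
  then show "Y_nc d G (word d \<kappa>) * (\<Prod>i\<in>{1..<d}. x (\<kappa> i)) =
      of_bool (proper G \<kappa>) * (\<Prod>i\<in>{1..<d}. x (\<kappa> i))"
    by (simp only: Y_nc_word)
qed

lemma symmetric_series_Y_nc:
  assumes "labelled_graph d G"
  shows "symmetric_series d (Y_nc d G)"
  unfolding symmetric_series_def
proof (intro conjI ballI impI)
  show "nc_homogeneous d (Y_nc d G)"
    unfolding Y_nc_def proper_colouring_def by (rule nc_homogeneous_nc_sum) blast
next
  fix s t :: "nat \<Rightarrow> nat"
  assume st: "s \<in> {1..d} \<rightarrow>\<^sub>E {1..}" "t \<in> {1..d} \<rightarrow>\<^sub>E {1..}"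
    and eq: "\<forall>j\<in>{1..d}. \<forall>k\<in>{1..d}. (s j = s k) = (t j = t k)"
  have "proper G s \<longleftrightarrow> proper G t"
    using eq labelled_graph_vertices[OF assms] unfolding proper_def by blast
  then show "Y_nc d G (word d s) = Y_nc d G (word d t)"
    by (simp only: Y_nc_word[OF st(1)] Y_nc_word[OF st(2)])
qed

text \<open>Positivity concerns only the sums of the coefficients over all partitions of one type.
  That suffices, because the evaluation of e_pi depends only on the type and the terms can be
  grouped.\<close>

lemma e_cone_chrom:
  assumes ind: "nc.independent (e_set d)" and G: "labelled_graph d G" "e_positive d G"
  shows "e_cone d (chrom d G)"
proof -
  have d: "1 \<le> d" using G(1) by (simp add: labelled_graph_def)
  define c where "c \<pi> = nc.representation (e_set d) (Y_nc d G) (nc_e d \<pi>)" for \<pi>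
  have Y: "Y_nc d G = (\<Sum>\<pi>\<in>partitions d. nc_scale (c \<pi>) (nc_e d \<pi>))"
    using e_set_expansion[OF ind symmetric_series_in_span[OF ind symmetric_series_Y_nc[OF G(1)]]]
    by (simp add: c_def)
  define y where "y p = Poly_Mapping.lookup (y_ubc d G) p" for p
  have y: "y p = (\<Sum>\<pi>\<in>{\<pi> \<in> partitions d. partition_type d \<pi> = p}. c \<pi>)" for p
  proof -
    have "y p = (\<Sum>\<pi>\<in>partitions d. c \<pi> * of_bool (partition_type d \<pi> = p))"
      unfolding y_def y_ubc_def Y by (rule nu_combination[OF ind])
    also have "\<dots> = (\<Sum>\<pi>\<in>partitions d. if partition_type d \<pi> = p then c \<pi> else 0)"
      by (intro sum.cong) auto
    finally show ?thesis using finite_partitions by (simp only: sum.inter_filter)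
  qed
  show ?thesis
    unfolding e_cone_def
  proof (intro exI conjI allI impI)
    \<comment> \<open>Positivity of \<open>G\<close> says nothing outside
      \<open>ubc_index d\<close>, while \<open>e_cone\<close> asks for nonnegative values
      everywhere; hence the default 0.\<close>
    show "0 \<le> (if p \<in> ubc_index d then y p * type_fact p else 0)" for p
      using G(2) type_fact_pos[of p] unfolding e_positive_def y_def by (simp add: less_imp_le)
    fix V x z assume V: "finite V" "V \<subseteq> {1..}" "z \<in> (V :: nat set)"
    have "chrom d G V x z = (\<Sum>\<pi>\<in>partitions d. c \<pi> * phi d (nc_e d \<pi>) V x z)"
      using phi_Y_nc[OF V(2), of d G] by (simp add: Y phi_combination)
    also have "\<dots> = (\<Sum>\<pi>\<in>partitions d. c \<pi> * (type_fact (partition_type d \<pi>) * e_pointed (partition_type d \<pi>) V x z))"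
      by (intro sum.cong refl) (simp only: phi_nc_e[OF d _ V])
    also have "\<dots> = (\<Sum>p\<in>ubc_index d. \<Sum>\<pi>\<in>{\<pi> \<in> partitions d. partition_type d \<pi> = p}.
        c \<pi> * (type_fact (partition_type d \<pi>) * e_pointed (partition_type d \<pi>) V x z))"
      using finite_partitions finite_ubc_index partition_type_image[OF d]
      by (intro sum.group[symmetric]) auto
    also have "\<dots> = (\<Sum>p\<in>ubc_index d. (if p \<in> ubc_index d then y p * type_fact p else 0) * e_pointed p V x z)"
      unfolding y by (intro sum.cong refl) (simp add: sum_distrib_right mult.assoc)
    finally show "chrom d G V x z =
        (\<Sum>p\<in>ubc_index d. (if p \<in> ubc_index d then y p * type_fact p else 0) * e_pointed p V x z)" .
  qed
qed

text \<open>Over a dependent family \<open>nc.representation\<close> is constantly 0. Hence the independence of the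
  \<open>e\<^sub>\<pi>\<close> may be assumed in the degree of the concatenation, and then holds in all lower degrees.\<close>

lemma e_positive_if_dependent:
  assumes "nc.dependent (e_set d)"
  shows "e_positive d G"
proof -
  have "y_ubc d G = 0"
    using assms by (simp add: y_ubc_def nu_def nc.representation_def)
  then show ?thesis by (simp add: e_positive_def)
qed

text \<open>Choosing one partition \<open>\<sigma> p\<close> of each type lifts the expansion to a
  series \<open>F\<close> with coefficients \<open>a p / type_fact p\<close>. It has the same
  evaluations as Y_G, so \<open>nu\<close> agrees on both, and for \<open>F\<close> its coefficients
  are visibly nonnegative.\<close>

lemma e_positive_if_e_cone:
  assumes G: "labelled_graph d G" and cone: "e_cone d (chrom d G)"
  shows "e_positive d G"
proof (cases "nc.independent (e_set d)")
  case ind: True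
  have d: "1 \<le> d" using G(1) by (simp add: labelled_graph_def)
  obtain a where a: "\<And>p. 0 \<le> a p" "\<And>V x z. finite V \<Longrightarrow> V \<subseteq> {1..} \<Longrightarrow> z \<in> V \<Longrightarrow>
      chrom d G V x z = (\<Sum>p\<in>ubc_index d. a p * e_pointed p V x z)"
    using cone unfolding e_cone_def by blast
  have "\<exists>\<pi>. \<pi> \<in> partitions d \<and> partition_type d \<pi> = p" if "p \<in> ubc_index d" for p
    using that unfolding partition_type_image[OF d, symmetric] by blast
  then obtain \<sigma> where \<sigma>: "\<And>p. p \<in> ubc_index d \<Longrightarrow> \<sigma> p \<in> partitions d"
      "\<And>p. p \<in> ubc_index d \<Longrightarrow> partition_type d (\<sigma> p) = p"
    by metis
  define F where "F = (\<Sum>p\<in>ubc_index d. nc_scale (a p / type_fact p) (nc_e d (\<sigma> p)))"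
  have "Poly_Mapping.lookup (y_ubc d G) p = Poly_Mapping.lookup (nu d F) p" for p
    unfolding y_ubc_def
  proof (rule nu_eqI[OF d ind])
    show "Y_nc d G \<in> nc.span (e_set d)"
      by (rule symmetric_series_in_span[OF ind symmetric_series_Y_nc[OF G]])
    show "F \<in> nc.span (e_set d)"
      unfolding F_def using \<sigma>(1) by (intro nc.span_sum nc.span_scale nc.span_base) blast
    fix V x z assume V: "finite V" "V \<subseteq> {1..}" "z \<in> (V :: nat set)"
    have "phi d F V x z = (\<Sum>p\<in>ubc_index d. a p / type_fact p * phi d (nc_e d (\<sigma> p)) V x z)"
      unfolding F_def by (rule phi_combination)
    also have "\<dots> = (\<Sum>p\<in>ubc_index d. a p * e_pointed p V x z)"
    proof (intro sum.cong refl)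
      fix p assume p: "p \<in> ubc_index d"
      show "a p / type_fact p * phi d (nc_e d (\<sigma> p)) V x z = a p * e_pointed p V x z"
        using type_fact_pos[of p] by (simp add: phi_nc_e[OF d \<sigma>(1)[OF p] V] \<sigma>(2)[OF p])
    qed
    finally show "phi d (Y_nc d G) V x z = phi d F V x z"
      by (simp only: phi_Y_nc[OF V(2)] a(2)[OF V])
  qed
  moreover have "0 \<le> Poly_Mapping.lookup (nu d F) p" for p
  proof -
    have "Poly_Mapping.lookup (nu d F) p =
        (\<Sum>q\<in>ubc_index d. a q / type_fact q * of_bool (partition_type d (\<sigma> q) = p))"
      unfolding F_def by (rule nu_combination[OF ind \<sigma>(1)])
    also have "\<dots> \<ge> 0"
      using a(1) type_fact_pos
      by (intro sum_nonneg mult_nonneg_nonneg divide_nonneg_nonneg) (auto intro: less_imp_le)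
    finally show ?thesis .
  qed
  ultimately show ?thesis by (simp add: e_positive_def)
qed (use e_positive_if_dependent in blast)

text \<open>Only interior vertices are weighted: the shared vertex receives its weight in
  \<open>transfer\<close>, and the variable of the last vertex is dropped.\<close>

definition graph_kernel :: "nat \<Rightarrow> nat set set \<Rightarrow> nat set \<Rightarrow> (nat \<Rightarrow> rat) \<Rightarrow> nat \<Rightarrow> nat \<Rightarrow> rat" where
  "graph_kernel M H V x c z =
     (\<Sum>\<kappa> | \<kappa> \<in> {1..M} \<rightarrow>\<^sub>E V \<and> \<kappa> 1 = c \<and> \<kappa> M = z. of_bool (proper H \<kappa>) * (\<Prod>i\<in>{1<..<M}. x (\<kappa> i)))"

lemma labelled_graph_image:
  assumes "labelled_graph m H" "inj_on f {1..m}" "f ` {1..m} \<subseteq> {1..d}"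
  shows "labelled_graph d (image f ` H)"
  unfolding labelled_graph_def
proof (intro conjI subsetI)
  have "1 \<in> {1..m}" using assms(1) by (simp add: labelled_graph_def)
  then have "f 1 \<in> {1..d}" using assms(3) by blast
  then show "1 \<le> d" by simp
  fix e assume "e \<in> image f ` H"
  then obtain e' where e': "e' \<in> H" "e = f ` e'" by auto
  then obtain u v where uv: "e' = {u, v}" "u \<in> {1..m}" "v \<in> {1..m}" "u \<noteq> v"
    using labelled_graph_edge[OF assms(1)] by metis
  then have "f u \<in> {1..d}" "f v \<in> {1..d}" using assms(3) by blast+
  moreover have "e = {f u, f v}" "f u \<noteq> f v"
    using e' uv assms(2) by (auto dest: inj_onD)
  ultimately show "e \<in> {{u, v} |u v. u \<in> {1..d} \<and> v \<in> {1..d} \<and> u \<noteq> v}" by blast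
qed

lemma labelled_graph_mono:
  assumes "labelled_graph n G" "n \<le> d"
  shows "labelled_graph d G"
proof -
  have "image (\<lambda>i. i) ` G = G" by simp
  then show ?thesis using labelled_graph_image[OF assms(1), of "\<lambda>i. i" d] assms(2) by auto
qed

lemma labelled_graph_concatenation:
  assumes "labelled_graph n G" "labelled_graph M H"
  shows "labelled_graph (n + M - 1) (concatenation n G H)"
proof -
  have "1 \<le> n" "1 \<le> M" using assms by (auto simp: labelled_graph_def)
  then have "labelled_graph (n + M - 1) (image (\<lambda>i. n - 1 + i) ` H)"
    by (intro labelled_graph_image[OF assms(2)]) (auto simp: inj_on_def)
  moreover have "labelled_graph (n + M - 1) G"
    using labelled_graph_mono[OF assms(1)] \<open>1 \<le> M\<close> by simp
  ultimately show ?thesis by (auto simp: labelled_graph_def concatenation_def)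
qed

lemma labelled_graph_reverse:
  assumes "labelled_graph M H"
  shows "labelled_graph M (reverse_graph M H)"
  unfolding reverse_graph_def
  by (rule labelled_graph_image[OF assms]) (auto simp: inj_on_def)

text \<open>The colourings are sorted by the colour of the shared vertex; given this colour, the two
  sides are independent. With \<open>2 \<le> M\<close> the shared vertex is not the last one, so its
  variable does occur.\<close>

lemma chrom_concatenation:
  assumes G: "labelled_graph n G" and H: "labelled_graph M H" and "2 \<le> M" "finite V"
  shows "chrom (n + M - 1) (concatenation n G H) V x z = transfer (graph_kernel M H) (chrom n G) V x z"
proof -
  have n: "1 \<le> n" using G by (simp add: labelled_graph_def)
  let ?D = "n + M - 1"
  define K1 where "K1 c = {\<kappa> \<in> {1..n} \<rightarrow>\<^sub>E V. \<kappa> n = c}" for c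
  define K2 where "K2 c = {\<kappa> \<in> {1..M} \<rightarrow>\<^sub>E V. \<kappa> 1 = c \<and> \<kappa> M = z}" for c
  define w1 where "w1 \<kappa> = of_bool (proper G \<kappa>) * (\<Prod>i\<in>{1..<n}. x (\<kappa> i))" for \<kappa>
  define w2 where "w2 \<kappa> = of_bool (proper H \<kappa>) * (\<Prod>i\<in>{1<..<M}. x (\<kappa> i))" for \<kappa>
  have fin: "finite (K1 c)" "finite (K2 c)" for c
    unfolding K1_def K2_def using assms(4)
    by (auto intro: finite_subset[OF _ finite_PiE[of "{1..n}" "\<lambda>_. V"]]
        finite_subset[OF _ finite_PiE[of "{1..M}" "\<lambda>_. V"]])
  have "transfer (graph_kernel M H) (chrom n G) V x z =
      (\<Sum>c\<in>V. \<Sum>p\<in>K1 c \<times> K2 c. x c * (w1 (fst p) * w2 (snd p)))"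
    unfolding transfer_def chrom_def graph_kernel_def K1_def[symmetric] K2_def[symmetric]
      w1_def[symmetric] w2_def[symmetric]
  proof (rule sum.cong[OF refl])
    fix c
    have *: "(\<Sum>\<kappa>\<in>K1 c. w1 \<kappa>) * (\<Sum>\<kappa>\<in>K2 c. w2 \<kappa>) = (\<Sum>p\<in>K1 c \<times> K2 c. w1 (fst p) * w2 (snd p))"
      by (simp only: sum_product sum.cartesian_product case_prod_unfold)
    show "x c * (\<Sum>\<kappa>\<in>K1 c. w1 \<kappa>) * (\<Sum>\<kappa>\<in>K2 c. w2 \<kappa>) =
        (\<Sum>p\<in>K1 c \<times> K2 c. x c * (w1 (fst p) * w2 (snd p)))"
      unfolding mult.assoc[of "x c"] * by (rule sum_distrib_left)
  qed
  also have "\<dots> = (\<Sum>q\<in>Sigma V (\<lambda>c. K1 c \<times> K2 c). x (fst q) * (w1 (fst (snd q)) * w2 (snd (snd q))))"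
    using fin assms(4) by (subst sum.Sigma) (auto simp: case_prod_unfold)
  also have "\<dots> = chrom ?D (concatenation n G H) V x z"
    unfolding chrom_def
  \<comment> \<open>A colouring is cut at vertex \<open>n\<close>, and \<open>i + 1 - n\<close>
    undoes the shift \<open>n - 1 + i\<close>. Gluing reads vertex \<open>n\<close> from the part on
    \<open>G\<close>; the part on \<open>H\<close> agrees there since its first colour is the same
    \<open>c\<close>.\<close>
  proof (rule sum.reindex_bij_witness[symmetric, of _
      "\<lambda>q i. if i \<in> {1..n} then fst (snd q) i else if i \<in> {1..?D} then snd (snd q) (i + 1 - n) else undefined"
      "\<lambda>\<kappa>. (\<kappa> n, restrict \<kappa> {1..n}, \<lambda>i\<in>{1..M}. \<kappa> (n - 1 + i))"])
    fix \<kappa> assume k: "\<kappa> \<in> {\<kappa> \<in> {1..?D} \<rightarrow>\<^sub>E V. \<kappa> ?D = z}"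
    then have kV: "\<kappa> i \<in> V" if "i \<in> {1..?D}" for i using that by (auto simp: PiE_iff)
    let ?q = "(\<kappa> n, restrict \<kappa> {1..n}, \<lambda>i\<in>{1..M}. \<kappa> (n - 1 + i))"
    show "(\<lambda>i. if i \<in> {1..n} then fst (snd ?q) i else if i \<in> {1..?D} then snd (snd ?q) (i + 1 - n) else undefined) = \<kappa>"
    proof
      fix i
      consider "i \<in> {1..n}" | "i \<notin> {1..n}" "i \<in> {1..?D}" | "i \<notin> {1..n}" "i \<notin> {1..?D}" by blast
      then show "(if i \<in> {1..n} then fst (snd ?q) i else if i \<in> {1..?D}
          then snd (snd ?q) (i + 1 - n) else undefined) = \<kappa> i"
      proof cases
        case 2
        then have "n - 1 + (i + 1 - n) = i" "i + 1 - n \<in> {1..M}" using n by auto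
        then show ?thesis using 2 by (simp only: if_True if_False fst_conv snd_conv restrict_apply)
      next
        case 3
        then have "\<kappa> i = undefined" using PiE_arb[of \<kappa>] k by blast
        then show ?thesis using 3 by (simp only: if_False)
      qed simp
    qed
    have "restrict \<kappa> {1..n} \<in> K1 (\<kappa> n)"
      using n assms(3) kV by (auto simp: K1_def)
    moreover have "(\<lambda>i\<in>{1..M}. \<kappa> (n - 1 + i)) \<in> K2 (\<kappa> n)"
    proof -
      have "\<kappa> (n - 1 + i) \<in> V" if "i \<in> {1..M}" for i
        by (rule kV) (use that n in auto)
      moreover have "n - 1 + 1 = n" "n - 1 + M = ?D" using n by auto
      ultimately show ?thesis using assms(3) k unfolding K2_def by auto
    qed
    moreover have "\<kappa> n \<in> V" using n assms(3) by (intro kV) auto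
    ultimately show "?q \<in> Sigma V (\<lambda>c. K1 c \<times> K2 c)" by simp
    have "proper (concatenation n G H) \<kappa> \<longleftrightarrow>
        proper G (restrict \<kappa> {1..n}) \<and> proper H (\<lambda>i\<in>{1..M}. \<kappa> (n - 1 + i))"
      unfolding concatenation_def proper_Un proper_image[OF H]
      by (intro arg_cong2[where f = "(\<and>)"] proper_cong[OF G] proper_cong[OF H]) auto
    moreover have "(\<Prod>i\<in>{1..<?D}. x (\<kappa> i)) =
        x (\<kappa> n) * ((\<Prod>i\<in>{1..<n}. x (restrict \<kappa> {1..n} i)) * (\<Prod>i\<in>{1<..<M}. x ((\<lambda>i\<in>{1..M}. \<kappa> (n - 1 + i)) i)))"
    proof -
      have "{1..<?D} = {1..<n} \<union> insert n ((\<lambda>i. n - 1 + i) ` {1<..<M})"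
      proof (intro equalityI subsetI)
        fix i assume i: "i \<in> {1..<?D}"
        show "i \<in> {1..<n} \<union> insert n ((\<lambda>i. n - 1 + i) ` {1<..<M})"
        proof (cases "i \<le> n")
          case False
          then have "i = n - 1 + (i + 1 - n)" "i + 1 - n \<in> {1<..<M}" using i n by auto
          then show ?thesis by blast
        qed (use i in auto)
      qed (use n assms(3) in auto)
      moreover have "{1..<n} \<inter> insert n ((\<lambda>i. n - 1 + i) ` {1<..<M}) = {}"
        and "n \<notin> (\<lambda>i. n - 1 + i) ` {1<..<M}" using n by auto
      moreover have "inj_on (\<lambda>i. n - 1 + i) {1<..<M}" by (auto simp: inj_on_def)
      ultimately have "(\<Prod>i\<in>{1..<?D}. x (\<kappa> i)) =
          (\<Prod>i\<in>{1..<n}. x (\<kappa> i)) * (x (\<kappa> n) * (\<Prod>i\<in>{1<..<M}. x (\<kappa> (n - 1 + i))))"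
        by (simp add: prod.union_disjoint prod.reindex)
      then show ?thesis by (simp add: mult_ac)
    qed
    ultimately show "x (fst ?q) * (w1 (fst (snd ?q)) * w2 (snd (snd ?q))) =
        of_bool (proper (concatenation n G H) \<kappa>) * (\<Prod>i\<in>{1..<?D}. x (\<kappa> i))"
      by (simp only: w1_def w2_def fst_conv snd_conv of_bool_conj mult_ac)
  next
    fix q assume "q \<in> Sigma V (\<lambda>c. K1 c \<times> K2 c)"
    then obtain c f g where q: "q = (c, f, g)" "c \<in> V" "f \<in> K1 c" "g \<in> K2 c" by auto
    let ?\<kappa> = "\<lambda>i. if i \<in> {1..n} then fst (snd q) i else if i \<in> {1..?D} then snd (snd q) (i + 1 - n) else undefined"
    have f: "f \<in> {1..n} \<rightarrow>\<^sub>E V" "f n = c" using q(3) by (auto simp: K1_def)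
    have g: "g \<in> {1..M} \<rightarrow>\<^sub>E V" "g 1 = c" "g M = z" using q(4) by (auto simp: K2_def)
    have shift: "?\<kappa> (n - 1 + i) = g i" if "i \<in> {1..M}" for i
    proof (cases "i = 1")
      case True
      then show ?thesis using n f g q(1) by simp
    next
      case False
      then show ?thesis using that n q(1) by auto
    qed
    have "?\<kappa> n = c" using n f q(1) by simp
    moreover have "restrict ?\<kappa> {1..n} = f" using f(1) q(1) by (auto simp: fun_eq_iff PiE_iff extensional_def)
    moreover have "(\<lambda>i\<in>{1..M}. ?\<kappa> (n - 1 + i)) = g"
    proof
      fix i show "(\<lambda>i\<in>{1..M}. ?\<kappa> (n - 1 + i)) i = g i"
        using shift[of i] g(1) by (cases "i \<in> {1..M}") (auto simp: PiE_iff extensional_def)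
    qed
    ultimately show "(?\<kappa> n, restrict ?\<kappa> {1..n}, \<lambda>i\<in>{1..M}. ?\<kappa> (n - 1 + i)) = q"
      using q(1) by simp
    have "?D \<notin> {1..n}" "?D \<in> {1..?D}" "?D + 1 - n = M" using n assms(3) by auto
    then have "?\<kappa> ?D = z" using g(3) q(1) by (simp only: if_True if_False fst_conv snd_conv)
    moreover have "?\<kappa> \<in> {1..?D} \<rightarrow>\<^sub>E V"
    proof (rule PiE_I)
      fix i assume i: "i \<in> {1..?D}"
      show "?\<kappa> i \<in> V"
      proof (cases "i \<in> {1..n}")
        case True
        then show ?thesis using PiE_mem[OF f(1) True] q(1) by simp
      next
        case False
        then have "i + 1 - n \<in> {1..M}" using i by auto
        then show ?thesis using PiE_mem[OF g(1)] q(1) i False by simp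
      qed
    next
      fix i assume i: "i \<notin> {1..?D}"
      then have "i \<notin> {1..n}" using assms(3) by auto
      then show "?\<kappa> i = undefined" using i by (simp only: if_False)
    qed
    ultimately show "?\<kappa> \<in> {\<kappa> \<in> {1..?D} \<rightarrow>\<^sub>E V. \<kappa> ?D = z}" by simp
  qed
  finally show ?thesis ..
qed

lemma graph_kernel_reverse:
  assumes "labelled_graph M H"
  shows "graph_kernel M (reverse_graph M H) V x c z = graph_kernel M H V x z c"
proof -
  have M: "1 \<le> M" using assms by (simp add: labelled_graph_def)
  let ?r = "\<lambda>\<kappa>. \<lambda>i\<in>{1..M}. \<kappa> (M + 1 - i)"
  have rr: "?r (?r \<kappa>) = \<kappa>" if "\<kappa> \<in> {1..M} \<rightarrow>\<^sub>E V" for \<kappa>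
  proof
    fix i
    show "?r (?r \<kappa>) i = \<kappa> i"
    proof (cases "i \<in> {1..M}")
      case True
      then have "M + 1 - i \<in> {1..M}" "M + 1 - (M + 1 - i) = i" by auto
      then show ?thesis using True by simp
    next
      case False
      then show ?thesis using PiE_arb[OF that False] by simp
    qed
  qed
  have rV: "?r \<kappa> \<in> {1..M} \<rightarrow>\<^sub>E V" if "\<kappa> \<in> {1..M} \<rightarrow>\<^sub>E V" for \<kappa>
  proof (rule restrict_PiE_iff[THEN iffD2], rule ballI)
    fix i assume "i \<in> {1..M}"
    then have "M + 1 - i \<in> {1..M}" by auto
    then show "\<kappa> (M + 1 - i) \<in> V" using PiE_mem[OF that] by blast
  qed
  show ?thesis
    unfolding graph_kernel_def
  proof (rule sum.reindex_bij_witness[of _ ?r ?r])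
    fix \<kappa> assume k: "\<kappa> \<in> {\<kappa> \<in> {1..M} \<rightarrow>\<^sub>E V. \<kappa> 1 = c \<and> \<kappa> M = z}"
    then show "?r (?r \<kappa>) = \<kappa>" using rr by blast
    show "?r \<kappa> \<in> {\<kappa> \<in> {1..M} \<rightarrow>\<^sub>E V. \<kappa> 1 = z \<and> \<kappa> M = c}"
      using k M rV by simp
    have "proper H (?r \<kappa>) \<longleftrightarrow> proper (reverse_graph M H) \<kappa>"
      unfolding reverse_graph_def proper_image[OF assms] by (rule proper_cong[OF assms]) simp
    moreover have "(\<Prod>i\<in>{1<..<M}. x (?r \<kappa> i)) = (\<Prod>i\<in>{1<..<M}. x (\<kappa> i))"
      by (rule prod.reindex_bij_witness[of _ "\<lambda>i. M + 1 - i" "\<lambda>i. M + 1 - i"]) auto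
    ultimately show "of_bool (proper H (?r \<kappa>)) * (\<Prod>i\<in>{1<..<M}. x (?r \<kappa> i)) =
        of_bool (proper (reverse_graph M H) \<kappa>) * (\<Prod>i\<in>{1<..<M}. x (\<kappa> i))"
      by simp
  next
    fix \<kappa> assume k: "\<kappa> \<in> {\<kappa> \<in> {1..M} \<rightarrow>\<^sub>E V. \<kappa> 1 = z \<and> \<kappa> M = c}"
    then show "?r (?r \<kappa>) = \<kappa>" using rr by blast
    show "?r \<kappa> \<in> {\<kappa> \<in> {1..M} \<rightarrow>\<^sub>E V. \<kappa> 1 = c \<and> \<kappa> M = z}"
      using k M rV by simp
  qed
qed

lemma appendable_e_positiveI:
  assumes H: "labelled_graph (m + 1) H" and "1 \<le> m"
    and cone: "\<And>n f. e_cone n f \<Longrightarrow> e_cone (n + m) (transfer (graph_kernel (m + 1) H) f)"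
  shows "appendable_e_positive (m + 1) H"
  unfolding appendable_e_positive_def
proof (intro conjI allI impI H)
  fix n G assume G: "labelled_graph n G \<and> e_positive n G"
  have D: "n + (m + 1) - 1 = n + m" by simp
  show "e_positive (n + (m + 1) - 1) (concatenation n G H)"
  proof (cases "nc.independent (e_set (n + m))")
    case True
    then have "nc.independent (e_set n)" by (rule independent_e_set_mono[rotated]) simp
    then have "e_cone n (chrom n G)" using G e_cone_chrom by blast
    from cone[OF this] have "e_cone (n + m) (chrom (n + (m + 1) - 1) (concatenation n G H))"
      by (rule e_cone_cong) (use G H assms(2) in \<open>intro chrom_concatenation, auto\<close>)
    then show ?thesis
      using labelled_graph_concatenation[of n G "m + 1" H] G H by (intro e_positive_if_e_cone) (simp_all only: D)
  next
    case False
    then show ?thesis using e_positive_if_dependent unfolding D by blast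
  qed
qed

section \<open>Wide melting lollipop graphs\<close>

lemma proper_graph_of_seq:
  "proper (graph_of_seq d w) \<kappa> \<longleftrightarrow>
    (\<forall>b a. 1 \<le> a \<and> a < b \<and> b \<le> d \<and> w b \<le> a \<longrightarrow> \<kappa> a \<noteq> \<kappa> b)"
proof
  assume "proper (graph_of_seq d w) \<kappa>"
  then show "\<forall>b a. 1 \<le> a \<and> a < b \<and> b \<le> d \<and> w b \<le> a \<longrightarrow> \<kappa> a \<noteq> \<kappa> b"
    unfolding proper_def edge_graph_of_seq_iff by blast
next
  assume R: "\<forall>b a. 1 \<le> a \<and> a < b \<and> b \<le> d \<and> w b \<le> a \<longrightarrow> \<kappa> a \<noteq> \<kappa> b"
  show "proper (graph_of_seq d w) \<kappa>"
    unfolding proper_def edge_graph_of_seq_iff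
  proof (intro allI impI, elim disjE)
    fix u v assume "1 \<le> u \<and> u < v \<and> v \<le> d \<and> w v \<le> u"
    then show "\<kappa> u \<noteq> \<kappa> v" using R by blast
  next
    fix u v assume "1 \<le> v \<and> v < u \<and> u \<le> d \<and> w u \<le> v"
    then have "\<kappa> v \<noteq> \<kappa> u" using R by blast
    then show "\<kappa> u \<noteq> \<kappa> v" by simp
  qed
qed

lemma proper_WL:
  assumes "4 \<le> m" "1 \<le> k" "k \<le> m - 2"
  shows "proper (WL m k) \<kappa> \<longleftrightarrow> inj_on \<kappa> {1..m - 1} \<and> (\<forall>j\<in>{k + 1..m - 1}. \<kappa> j \<noteq> \<kappa> m) \<and>
    \<kappa> (m - 1) \<noteq> \<kappa> (m + 1) \<and> \<kappa> m \<noteq> \<kappa> (m + 1)"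
proof
  assume "proper (WL m k) \<kappa>"
  then have P: "\<kappa> a \<noteq> \<kappa> b" if "1 \<le> a" "a < b" "b \<le> m + 1" "WL_seq m k b \<le> a" for a b
    using that unfolding WL_def proper_graph_of_seq by blast
  have "inj_on \<kappa> {1..m - 1}"
  proof (rule linorder_inj_onI)
    fix a b assume "a < b" "a \<in> {1..m - 1}" "b \<in> {1..m - 1}"
    then show "\<kappa> a \<noteq> \<kappa> b" by (intro P) (auto simp: WL_seq_def)
  qed auto
  moreover have "\<forall>j\<in>{k + 1..m - 1}. \<kappa> j \<noteq> \<kappa> m"
    using assms by (intro ballI P) (auto simp: WL_seq_def)
  moreover have "\<kappa> (m - 1) \<noteq> \<kappa> (m + 1)" "\<kappa> m \<noteq> \<kappa> (m + 1)"
    using assms by (intro P; auto simp: WL_seq_def)+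
  ultimately show "inj_on \<kappa> {1..m - 1} \<and> (\<forall>j\<in>{k + 1..m - 1}. \<kappa> j \<noteq> \<kappa> m) \<and>
    \<kappa> (m - 1) \<noteq> \<kappa> (m + 1) \<and> \<kappa> m \<noteq> \<kappa> (m + 1)" by blast
next
  assume R: "inj_on \<kappa> {1..m - 1} \<and> (\<forall>j\<in>{k + 1..m - 1}. \<kappa> j \<noteq> \<kappa> m) \<and>
    \<kappa> (m - 1) \<noteq> \<kappa> (m + 1) \<and> \<kappa> m \<noteq> \<kappa> (m + 1)"
  show "proper (WL m k) \<kappa>"
    unfolding WL_def proper_graph_of_seq
  proof (intro allI impI)
    fix b a assume ab: "1 \<le> a \<and> a < b \<and> b \<le> m + 1 \<and> WL_seq m k b \<le> a"
    consider "b \<le> m - 1" | "b = m" | "b = m + 1" using ab by linarith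
    then show "\<kappa> a \<noteq> \<kappa> b"
    proof cases
      case 1
      then have "a \<in> {1..m - 1}" "b \<in> {1..m - 1}" "a \<noteq> b" using ab by auto
      then show ?thesis using R by (meson inj_onD)
    next
      case 2
      then have "a \<in> {k + 1..m - 1}" using ab assms by (auto simp: WL_seq_def split: if_splits)
      then show ?thesis using R 2 by blast
    next
      case 3
      then have "a = m - 1 \<or> a = m" using ab assms by (auto simp: WL_seq_def split: if_splits)
      then show ?thesis using R 3 by auto
    qed
  qed
qed

lemma sum_of_bool_filter:
  "finite S \<Longrightarrow> (\<Sum>s\<in>S. of_bool (P s) * h s) = (\<Sum>s\<in>{s \<in> S. P s}. h s :: 'b::semiring_1)"
  unfolding sum.inter_filter by (intro sum.cong) auto

text \<open>Here \<open>u\<close> and \<open>v\<close> are the colours of the vertices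
  \<open>m - 1\<close> and \<open>m\<close>, and \<open>f\<close> colours the interior vertices.
  Since \<open>1 \<le> k\<close>, the vertices 1 and \<open>m\<close> are not adjacent, so
  \<open>v = c\<close> is allowed; the remaining neighbours of \<open>m\<close> in the interior are
  \<open>{k + 1..m - 2}\<close>.\<close>

lemma graph_kernel_WL:
  assumes "4 \<le> m" "1 \<le> k" "k \<le> m - 2" "finite V" "c \<in> V" "z \<in> V"
  shows "graph_kernel (m + 1) (WL m k) V x c z =
    (\<Sum>u\<in>V - {c, z}. \<Sum>v\<in>V - {u, z}. x u * x v *
      (\<Sum>f\<in>{2..m - 2} \<rightarrow>\<^sub>E (V - {c, u}). of_bool (inj_on f {2..m - 2} \<and> v \<notin> f ` {k + 1..m - 2}) *
        (\<Prod>i\<in>{2..m - 2}. x (f i))))"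
proof -
  let ?I = "{2..m - 2}" and ?J = "{k + 1..m - 2}"
  define F where "F u v = {f \<in> ?I \<rightarrow>\<^sub>E (V - {c, u}). inj_on f ?I \<and> v \<notin> f ` ?J}" for u v
  define Q where "Q = Sigma (V - {c, z}) (\<lambda>u. Sigma (V - {u, z}) (F u))"
  define K where "K = {\<kappa> \<in> {1..m + 1} \<rightarrow>\<^sub>E V. \<kappa> 1 = c \<and> \<kappa> (m + 1) = z}"
  have ar: "1 \<le> m - 1" "m - 1 \<noteq> 1" "1 \<noteq> m - 1" "m - 1 \<le> m + 1" "m - 1 \<noteq> m" "m - 1 \<noteq> m + 1"
    "m - 1 \<notin> ?I" "m \<notin> ?I" "m - 1 \<in> {k + 1..m - 1}"
    using assms(1,3) by auto
  have finF': "finite (?I \<rightarrow>\<^sub>E (V - {c, u}))" for u using assms(4) by (intro finite_PiE) auto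
  then have finF: "finite (F u v)" for u v by (simp add: F_def)
  have finK: "finite K"
    unfolding K_def by (rule finite_subset[of _ "{1..m + 1} \<rightarrow>\<^sub>E V"]) (use assms(4) in \<open>auto intro: finite_PiE\<close>)
  have I: "{1..m - 1} = insert 1 (insert (m - 1) ?I)" using assms(1) by auto
  have J: "{k + 1..m - 1} = insert (m - 1) ?J" using assms by auto
  have JI: "?J \<subseteq> ?I" using assms(2) by auto
  have "(\<Sum>u\<in>V - {c, z}. \<Sum>v\<in>V - {u, z}. x u * x v *
      (\<Sum>f\<in>?I \<rightarrow>\<^sub>E (V - {c, u}). of_bool (inj_on f ?I \<and> v \<notin> f ` ?J) * (\<Prod>i\<in>?I. x (f i)))) =
    (\<Sum>u\<in>V - {c, z}. \<Sum>v\<in>V - {u, z}. \<Sum>f\<in>F u v. x u * x v * (\<Prod>i\<in>?I. x (f i)))"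
    unfolding sum_of_bool_filter[OF finF'] F_def sum_distrib_left ..
  also have "\<dots> = (\<Sum>u\<in>V - {c, z}. \<Sum>p\<in>Sigma (V - {u, z}) (F u). x u * x (fst p) * (\<Prod>i\<in>?I. x (snd p i)))"
    using assms(4) finF by (intro sum.cong refl) (simp add: sum.Sigma case_prod_unfold)
  also have "\<dots> = (\<Sum>q\<in>Q. x (fst q) * x (fst (snd q)) * (\<Prod>i\<in>?I. x (snd (snd q) i)))"
    unfolding Q_def using assms(4) finF by (subst sum.Sigma) (auto simp: case_prod_unfold)
  also have "\<dots> = (\<Sum>\<kappa>\<in>{\<kappa> \<in> K. proper (WL m k) \<kappa>}. \<Prod>i\<in>{1<..<m + 1}. x (\<kappa> i))"
  proof (rule sum.reindex_bij_witness[symmetric, of _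
        "\<lambda>q. (snd (snd q))(1 := c, m - 1 := fst q, m := fst (snd q), m + 1 := z)"
        "\<lambda>\<kappa>. (\<kappa> (m - 1), \<kappa> m, restrict \<kappa> ?I)"])
    fix \<kappa> assume "\<kappa> \<in> {\<kappa> \<in> K. proper (WL m k) \<kappa>}"
    then have k: "\<kappa> \<in> {1..m + 1} \<rightarrow>\<^sub>E V" "\<kappa> 1 = c" "\<kappa> (m + 1) = z"
      and inj: "inj_on \<kappa> {1..m - 1}" and nm: "\<forall>j\<in>{k + 1..m - 1}. \<kappa> j \<noteq> \<kappa> m"
      and nz: "\<kappa> (m - 1) \<noteq> z" "\<kappa> m \<noteq> z"
      using proper_WL[OF assms(1-3)] by (auto simp: K_def)
    have kV: "\<kappa> i \<in> V" if "1 \<le> i" "i \<le> m + 1" for i using PiE_mem[OF k(1)] that by simp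
    show "(snd (snd (\<kappa> (m - 1), \<kappa> m, restrict \<kappa> ?I)))(1 := c, m - 1 := fst (\<kappa> (m - 1), \<kappa> m, restrict \<kappa> ?I),
        m := fst (snd (\<kappa> (m - 1), \<kappa> m, restrict \<kappa> ?I)), m + 1 := z) = \<kappa>"
    proof
      fix i
      consider "i \<in> ?I" | "i = 1" | "i = m - 1" | "i = m" | "i = m + 1" | "i \<notin> {1..m + 1}" "i \<notin> ?I"
        using assms(1) by force
      then show "((snd (snd (\<kappa> (m - 1), \<kappa> m, restrict \<kappa> ?I)))(1 := c, m - 1 := fst (\<kappa> (m - 1), \<kappa> m, restrict \<kappa> ?I),
        m := fst (snd (\<kappa> (m - 1), \<kappa> m, restrict \<kappa> ?I)), m + 1 := z)) i = \<kappa> i"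
        using assms(1) k(2,3) PiE_arb[OF k(1), of i] by cases auto
    qed
    have u: "\<kappa> (m - 1) \<in> V - {c, z}"
      using inj_onD[OF inj, of 1 "m - 1"] kV[of "m - 1"] ar k(2) nz by auto
    have v: "\<kappa> m \<in> V - {\<kappa> (m - 1), z}"
      using nm kV[of m] assms(1) nz ar(9) by auto
    have "\<kappa> i \<noteq> c" "\<kappa> i \<noteq> \<kappa> (m - 1)" "\<kappa> i \<in> V" if "i \<in> ?I" for i
    proof -
      have i: "i \<in> {1..m - 1}" "i \<noteq> 1" "i \<noteq> m - 1" "1 \<le> i" "i \<le> m + 1" using that by auto
      then show "\<kappa> i \<noteq> c" "\<kappa> i \<noteq> \<kappa> (m - 1)" "\<kappa> i \<in> V"
        using inj_onD[OF inj, of i 1] inj_onD[OF inj, of i "m - 1"] kV[of i] k(2) ar(1) by auto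
    qed
    then have "restrict \<kappa> ?I \<in> ?I \<rightarrow>\<^sub>E (V - {c, \<kappa> (m - 1)})" by auto
    moreover have "inj_on (restrict \<kappa> ?I) ?I"
      unfolding inj_on_restrict_eq by (rule inj_on_subset[OF inj]) auto
    moreover have "\<kappa> m \<notin> restrict \<kappa> ?I ` ?J" using nm J JI by auto
    ultimately have "restrict \<kappa> ?I \<in> F (\<kappa> (m - 1)) (\<kappa> m)" by (simp add: F_def)
    then show "(\<kappa> (m - 1), \<kappa> m, restrict \<kappa> ?I) \<in> Q" using u v by (simp add: Q_def)
    have "{1<..<m + 1} = insert (m - 1) (insert m ?I)" using assms(1) by auto
    then have "(\<Prod>i\<in>{1<..<m + 1}. x (\<kappa> i)) = x (\<kappa> (m - 1)) * (x (\<kappa> m) * (\<Prod>i\<in>?I. x (\<kappa> i)))"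
      using ar by simp
    then show "x (fst (\<kappa> (m - 1), \<kappa> m, restrict \<kappa> ?I)) * x (fst (snd (\<kappa> (m - 1), \<kappa> m, restrict \<kappa> ?I))) *
        (\<Prod>i\<in>?I. x (snd (snd (\<kappa> (m - 1), \<kappa> m, restrict \<kappa> ?I)) i)) = (\<Prod>i\<in>{1<..<m + 1}. x (\<kappa> i))"
      by simp
  next
    fix q assume Q: "q \<in> Q"
    obtain u v f where q: "q = (u, v, f)" by (cases q)
    have u: "u \<in> V" "u \<noteq> c" "u \<noteq> z" and v: "v \<in> V" "v \<noteq> u" "v \<noteq> z"
      and f: "f \<in> ?I \<rightarrow>\<^sub>E (V - {c, u})" "inj_on f ?I" "v \<notin> f ` ?J"
      using Q unfolding q Q_def F_def by blast+
    define \<kappa> where "\<kappa> = f(1 := c, m - 1 := u, m := v, m + 1 := z)"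
    have \<kappa>: "\<kappa> 1 = c" "\<kappa> (m - 1) = u" "\<kappa> m = v" "\<kappa> (m + 1) = z" "\<And>i. i \<in> ?I \<Longrightarrow> \<kappa> i = f i"
      using assms(1) ar by (auto simp: \<kappa>_def)
    have fV: "f i \<in> V" "f i \<noteq> c" "f i \<noteq> u" if "i \<in> ?I" for i using PiE_mem[OF f(1) that] by auto
    have "restrict \<kappa> ?I = f"
    proof
      fix i show "restrict \<kappa> ?I i = f i"
        using \<kappa>(5)[of i] PiE_arb[OF f(1), of i] by (cases "i \<in> ?I") simp_all
    qed
    then show "((\<lambda>\<kappa>. (\<kappa> (m - 1), \<kappa> m, restrict \<kappa> ?I))
        ((snd (snd q))(1 := c, m - 1 := fst q, m := fst (snd q), m + 1 := z))) = q"
      using \<kappa> by (simp add: q \<kappa>_def[symmetric])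
    have "\<kappa> \<in> {1..m + 1} \<rightarrow>\<^sub>E V"
    proof (rule PiE_I)
      fix i assume i: "i \<in> {1..m + 1}"
      consider "i \<in> ?I" | "i = 1" | "i = m - 1" | "i = m" | "i = m + 1"
        using assms(1) i by force
      then show "\<kappa> i \<in> V" using \<kappa> fV u v assms(5,6) by cases auto
    next
      fix i assume "i \<notin> {1..m + 1}"
      then have "i \<notin> ?I" "i \<noteq> 1" "i \<noteq> m - 1" "i \<noteq> m" "i \<noteq> m + 1" using assms(1) by auto
      then show "\<kappa> i = undefined" using PiE_arb[OF f(1), of i] by (simp add: \<kappa>_def)
    qed
    moreover have "proper (WL m k) \<kappa>"
      unfolding proper_WL[OF assms(1-3)]
    proof (intro conjI)
      have "inj_on \<kappa> ?I" using f(2) inj_on_cong[of ?I \<kappa> f] \<kappa>(5) by simp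
      moreover have "\<kappa> ` ?I = f ` ?I" using \<kappa>(5) by (intro image_cong) auto
      then have "u \<notin> \<kappa> ` ?I" "c \<notin> \<kappa> ` ?I" using fV(2,3) by (metis imageE)+
      ultimately show "inj_on \<kappa> {1..m - 1}"
        unfolding I using \<kappa>(1,2) u(2) by (auto simp: image_iff)
      show "\<forall>j\<in>{k + 1..m - 1}. \<kappa> j \<noteq> \<kappa> m"
      proof
        fix j assume "j \<in> {k + 1..m - 1}"
        then consider "j = m - 1" | "j \<in> ?J" unfolding J by blast
        then show "\<kappa> j \<noteq> \<kappa> m"
        proof cases
          case 1
          then show ?thesis using \<kappa>(2,3) v(2) by simp
        next
          case 2
          then have "\<kappa> j = f j" using JI \<kappa>(5) by blast
          then show ?thesis using 2 f(3) \<kappa>(3) by (metis imageI)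
        qed
      qed
    qed (use \<kappa> u v in auto)
    ultimately show "(snd (snd q))(1 := c, m - 1 := fst q, m := fst (snd q), m + 1 := z) \<in>
        {\<kappa> \<in> K. proper (WL m k) \<kappa>}"
      using \<kappa>(1,4) by (simp add: q \<kappa>_def[symmetric] K_def)
  qed
  also have "\<dots> = graph_kernel (m + 1) (WL m k) V x c z"
    unfolding graph_kernel_def K_def[symmetric] by (rule sum_of_bool_filter[OF finK, symmetric])
  finally show ?thesis ..
qed

text \<open>The kernel of the clique on \<open>a + 2\<close> vertices followed by a triangle, up to the factor \<open>a!\<close>.\<close>

definition flat_kernel :: "nat \<Rightarrow> 'a set \<Rightarrow> ('a \<Rightarrow> 'b::comm_ring_1) \<Rightarrow> 'a \<Rightarrow> 'a \<Rightarrow> 'b" where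
  "flat_kernel a V x p q = (\<Sum>u\<in>V. x u * clique_kernel a V x p u * clique_kernel 1 V x u q)"

lemma flat_kernel_eq:
  assumes "finite V"
  shows "flat_kernel a V x p q =
    (\<Sum>u\<in>V - {p, q}. \<Sum>v\<in>V - {u, q}. x u * x v * es (V - {p, u}) x a)"
proof -
  have "flat_kernel a V x p q = (\<Sum>u\<in>V - {p, q}. x u * es (V - {p, u}) x a * es (V - {u, q}) x 1)"
    unfolding flat_kernel_def using assms
    by (intro sum.mono_neutral_cong_right) (auto simp: clique_kernel_def)
  also have "\<dots> = (\<Sum>u\<in>V - {p, q}. \<Sum>v\<in>V - {u, q}. x u * x v * es (V - {p, u}) x a)"
  proof (intro sum.cong refl)
    fix u
    have es1: "es (V - {u, q}) x 1 = (\<Sum>v\<in>V - {u, q}. x v)"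
      using sum_es_remove[of "V - {u, q}" x 0] assms by (simp add: One_nat_def)
    show "x u * es (V - {p, u}) x a * es (V - {u, q}) x 1 =
        (\<Sum>v\<in>V - {u, q}. x u * x v * es (V - {p, u}) x a)"
      unfolding es1 sum_distrib_left by (intro sum.cong refl) (simp only: mult_ac)
  qed
  finally show ?thesis .
qed

text \<open>Deleting the edges from vertex \<open>m\<close> to vertices of the clique one at a time changes the kernel
  by the same amount each time, so it interpolates linearly in \<open>k\<close> between the two extreme cases
  \<open>k = m - 2\<close> and \<open>k = 1\<close>.\<close>

lemma graph_kernel_WL_interpolation:
  fixes V :: "nat set"
  assumes "4 \<le> m" "1 \<le> k" "k \<le> m - 2" "finite V" "c \<in> V" "z \<in> V"
  defines "a \<equiv> m - 3" and "t \<equiv> of_nat (m - 2 - k) / of_nat (m - 3)"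
  shows "graph_kernel (m + 1) (WL m k) V x c z =
    fact a * (1 - t) * flat_kernel a V x c z + fact a * t * melt_kernel a V x c z"
proof -
  obtain a' where a': "a = Suc a'" using assms(1) by (cases a) (auto simp: a_def)
  have card: "card {2..m - 2} = a" "card {k + 1..m - 2} = m - 2 - k"
    using assms(1) by (auto simp: a_def)
  have sub: "{k + 1..m - 2} \<subseteq> {2..m - 2}" using assms(2) by auto
  have t: "t * of_nat a = of_nat (m - 2 - k)" using assms(1) by (simp add: t_def a_def)
  have inner: "(\<Sum>f\<in>{2..m - 2} \<rightarrow>\<^sub>E (V - {c, u}). of_bool (inj_on f {2..m - 2} \<and> v \<notin> f ` {k + 1..m - 2}) *
      (\<Prod>i\<in>{2..m - 2}. x (f i))) =
      fact a * (1 - t) * es (V - {c, u}) x a + fact a * t * es (V - {c, u, v}) x a" for u v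
  proof -
    let ?W = "V - {c, u}"
    have fin: "finite ?W" using assms(4) by simp
    have W: "V - {c, u, v} = ?W - {v}" by auto
    define b where "b = of_bool (v \<in> ?W) * (x v * es (?W - {v}) x a')"
    have b: "es ?W x a = es (?W - {v}) x a + b"
    proof (cases "v \<in> ?W")
      case True
      then show ?thesis using es_remove[OF fin True, of x a'] by (simp add: b_def a')
    next
      case False
      then have "?W - {v} = ?W" by auto
      then show ?thesis using False by (simp add: b_def)
    qed
    have "(\<Sum>f\<in>{2..m - 2} \<rightarrow>\<^sub>E ?W. of_bool (inj_on f {2..m - 2} \<and> v \<notin> f ` {k + 1..m - 2}) *
        (\<Prod>i\<in>{2..m - 2}. x (f i))) = fact a * es ?W x a - t * of_nat a * (fact a' * b)"
      unfolding sum_inj_PiE_avoiding[OF finite_atLeastAtMost fin sub] card t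
      by (simp add: a' b_def)
    also have "\<dots> = fact a * es ?W x a - t * (fact a * b)" by (simp add: a')
    also have "\<dots> = fact a * (1 - t) * es ?W x a + fact a * t * es (?W - {v}) x a"
      unfolding b by (simp add: algebra_simps)
    finally show ?thesis unfolding W .
  qed
  show ?thesis
    unfolding graph_kernel_WL[OF assms(1-6)] inner flat_kernel_eq[OF assms(4)] melt_kernel_def
      sum_distrib_left sum.distrib[symmetric]
    by (intro sum.cong refl) (simp add: algebra_simps)
qed

lemma clique_kernel_commute: "clique_kernel j V x p q = clique_kernel j V x q p"
  by (simp add: clique_kernel_def insert_commute eq_commute)

text \<open>The kernel is a composition of two clique kernels. These are symmetric in their end
  colours, so transposing the composition only exchanges the order in which the two cliques are
  appended.\<close>

lemma e_cone_flat_kernel: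
  assumes "e_cone n f"
  shows "e_cone (n + (a + 3)) (transfer (flat_kernel a) f)"
    and "e_cone (n + (a + 3)) (transfer (\<lambda>V x p q. flat_kernel a V x q p) f)"
proof -
  have comp: "transfer (clique_kernel i) (transfer (clique_kernel j) f) V x z =
      (\<Sum>c\<in>V. x c * f V x c * (\<Sum>u\<in>V. x u * clique_kernel j V x c u * clique_kernel i V x u z))"
    for i j V x z
  proof -
    have "transfer (clique_kernel i) (transfer (clique_kernel j) f) V x z =
        (\<Sum>u\<in>V. \<Sum>c\<in>V. x c * f V x c * (x u * clique_kernel j V x c u * clique_kernel i V x u z))"
      by (simp add: transfer_def sum_distrib_left sum_distrib_right mult_ac)
    also have "\<dots> = (\<Sum>c\<in>V. \<Sum>u\<in>V. x c * f V x c * (x u * clique_kernel j V x c u * clique_kernel i V x u z))"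
      by (rule sum.swap)
    finally show ?thesis by (simp only: sum_distrib_left)
  qed
  have deg: "n + (j + 1) + (i + 1) = n + (a + 3)" if "i + j = a + 1" for i j using that by simp
  have cone: "e_cone (n + (a + 3)) (transfer (clique_kernel i) (transfer (clique_kernel j) f))"
    if "i + j = a + 1" for i j
    using e_cone_clique_kernel[OF e_cone_clique_kernel[OF assms], of j i] unfolding deg[OF that] .
  show "e_cone (n + (a + 3)) (transfer (flat_kernel a) f)"
  proof (rule e_cone_cong[OF cone[of 1 a]])
    show "transfer (flat_kernel a) f V x z = transfer (clique_kernel 1) (transfer (clique_kernel a) f) V x z"
      for V x z
      unfolding comp unfolding transfer_def flat_kernel_def ..
  qed simp
  have swap: "flat_kernel a V x q p = (\<Sum>u\<in>V. x u * clique_kernel 1 V x p u * clique_kernel a V x u q)"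
    for V and x :: "nat \<Rightarrow> rat" and p q
    unfolding flat_kernel_def
    by (intro sum.cong refl) (simp only: clique_kernel_commute[of _ V x _ p] clique_kernel_commute[of _ V x q] mult_ac)
  show "e_cone (n + (a + 3)) (transfer (\<lambda>V x p q. flat_kernel a V x q p) f)"
  proof (rule e_cone_cong[OF cone[of a 1]])
    show "transfer (\<lambda>V x p q. flat_kernel a V x q p) f V x z =
        transfer (clique_kernel a) (transfer (clique_kernel 1) f) V x z" for V x z
      unfolding comp unfolding transfer_def swap ..
  qed simp
qed

lemma transfer_combination:
  assumes "\<And>c. c \<in> V \<Longrightarrow> K V x c z = s * K1 V x c z + t * K2 V x c z"
  shows "transfer K f V x z = s * transfer K1 f V x z + t * transfer K2 f V x z"
  using assms unfolding transfer_def
  by (simp add: sum_distrib_left algebra_simps flip: sum.distrib)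

theorem proposition5p8:
  fixes m k :: nat
  assumes "4 \<le> m" and "1 \<le> k" and "k \<le> m - 2"
  shows "appendable_e_positive (m + 1) (WL m k) \<and>
         appendable_e_positive (m + 1) (reverse_graph (m + 1) (WL m k))"
proof -
  define a where "a = m - 3"
  define s t :: rat where "s = fact a * (1 - of_nat (m - 2 - k) / of_nat (m - 3))"
    and "t = fact a * (of_nat (m - 2 - k) / of_nat (m - 3))"
  have a: "1 \<le> a" "a + 3 = m" using assms(1) by (auto simp: a_def)
  \<comment> \<open>Because \<open>1 \<le> k\<close>, the ratio of these numbers lies between 0 and
    1: the kernel is a! times a convex combination of the two extreme kernels.\<close>
  have "of_nat (m - 2 - k) \<le> (of_nat (m - 3) :: rat)" "0 < (of_nat (m - 3) :: rat)"
    using assms by auto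
  then have st: "0 \<le> s" "0 \<le> t" by (simp_all add: s_def t_def)
  have kernel: "graph_kernel (m + 1) (WL m k) V x c z =
      s * flat_kernel a V x c z + t * melt_kernel a V x c z"
    if "finite V" "c \<in> V" "z \<in> V" for V x c z
    using graph_kernel_WL_interpolation[OF assms that] by (simp add: s_def t_def a_def)
  have WL: "labelled_graph (m + 1) (WL m k)"
    using WL_unit_interval_graph(1)[OF assms] by (simp add: unit_interval_graph_def)
  have cone: "e_cone (n + m) (transfer K f)"
    if f: "e_cone n f" and K: "\<And>V x c z. finite V \<Longrightarrow> c \<in> V \<Longrightarrow> z \<in> V \<Longrightarrow>
        K V x c z = s * K1 V x c z + t * K2 V x c z"
      and "e_cone (n + (a + 3)) (transfer K1 f)" "e_cone (n + (a + 3)) (transfer K2 f)" for n f K K1 K2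
  proof -
    have "e_cone (n + m) (\<lambda>V x z. s * transfer K1 f V x z + t * transfer K2 f V x z)"
      using that(3,4) st unfolding a(2) by (intro e_cone_add e_cone_scale)
    then show ?thesis by (rule e_cone_cong) (intro transfer_combination K)
  qed
  have "appendable_e_positive (m + 1) (WL m k)"
  proof (rule appendable_e_positiveI[OF WL])
    show "e_cone (n + m) (transfer (graph_kernel (m + 1) (WL m k)) f)" if "e_cone n f" for n f
      by (rule cone[OF that kernel e_cone_flat_kernel(1)[OF that] e_cone_melt_kernel(1)[OF that a(1)]])
  qed (use assms(1) in simp)
  moreover have "appendable_e_positive (m + 1) (reverse_graph (m + 1) (WL m k))"
  proof (rule appendable_e_positiveI[OF labelled_graph_reverse[OF WL]])
    show "e_cone (n + m) (transfer (graph_kernel (m + 1) (reverse_graph (m + 1) (WL m k))) f)"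
      if "e_cone n f" for n f
      by (rule cone[OF that _ e_cone_flat_kernel(2)[OF that] e_cone_melt_kernel(2)[OF that a(1)]])
         (simp only: graph_kernel_reverse[OF WL] kernel)
  qed (use assms(1) in simp)
  ultimately show ?thesis ..
qed

end
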